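(* In the setting of the context (reducible case $\rho_2=\mu_q$): (1) For $1\le i\le p-1$, $1\le k\le r_i$, $1\le h\le\ell_{i,k}$ one has, for $x\in\mathcal S_i^+\cup\mathcal S_{i+1}^-$, $$U'_{t_i,k,h}(x)=\sum_{\tilde k=1}^{r_{i+1}}\sum_{\tilde h=1}^{\ell_{i+1,\tilde k}}C'_{t_{i+1},\tilde k,\tilde h;t_i,k,h}\,U'_{t_{i+1},\tilde k,\tilde h}(x)+\mathrm{hol}(x-t_{i+1}),$$ $$C'_{t_{i+1},\tilde k,\tilde h;t_i,k,h}=\frac{e^{\pi\sqrt{-1}\lambda_{i,k}}(t_i-t_{p+1})^{2\lambda_{i,k}-\rho_1-\mu_q}}{e^{\pi\sqrt{-1}\lambda_{i+1,\tilde k}}(t_{i+1}-t_{p+1})^{2\lambda_{i+1,\tilde k}-\rho_1-\mu_q}}\,c_{t'_{i+1},\tilde k,\tilde h;t'_i,k,h}.$$ (2) For $2\le i\le p$, $1\le k\le r_i$, $1\le h\le\ell_{i,k}$ one has, for $x\in\mathcal S_i^-\cup\mathcal S_{i-1}^+$, $$U'_{t_i,k,h}(x)=\sum_{\tilde k=1}^{r_{i-1}}\sum_{\tilde h=1}^{\ell_{i-1,\tilde k}}C'_{t_{i-1},\tilde k,\tilde h;t_i,k,h}\,U'_{t_{i-1},\tilde k,\tilde h}(x)+\mathrm{hol}(x-t_{i-1}),$$ $$C'_{t_{i-1},\tilde k,\tilde h;t_i,k,h}=\frac{e^{\pi\sqrt{-1}\lambda_{i,k}}(t_i-t_{p+1})^{2\lambda_{i,k}-\rho_1-\mu_q}}{e^{\pi\sqrt{-1}\lambda_{i-1,\tilde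 k}}(t_{i-1}-t_{p+1})^{2\lambda_{i-1,\tilde k}-\rho_1-\mu_q}}\,c_{t'_{i-1},\tilde k,\tilde h;t'_i,k,h}.$$
   Context: **System.** Let $t_1,\dots,t_{p+1}\in\mathbb C$ be distinct, no three on a straight line; $T=\mathrm{diag}(t_1I_{n_1},\dots,t_pI_{n_p})$, $n=n_1+\dots+n_p$. Let $A\in M(n;\mathbb C)$, partitioned in blocks $A_{ij}$ like $T$, have diagonal blocks $A_{ii}=\mathrm{diag}(\lambda_{i,1}I_{\ell_{i,1}},\dots,\lambda_{i,r_i}I_{\ell_{i,r_i}})$ ($\lambda_{i,k}$ distinct for fixed $i$), and let $P\in GL(n;\mathbb C)$ be such that $A'=P^{-1}AP=\mathrm{diag}(\mu_1I_{m_1},\dots,\mu_qI_{m_q})$ ($\mu_k$ distinct). Let $\rho_1\in\mathbb C$ and $\rho_2=\mu_q$. Put $$\mathcal A_P=\begin{pmatrix}A&P\\-(A'-\rho_1I_n)(A'-\rho_2I_n)P^{-1}&(\rho_1+\rho_2)I_n-A'\end{pmatrix}.$$ Since $\rho_2=\mu_q$, $\mathcal A_P=\begin{pmatrix}\mathcal A'_P&*\\O&\rho_1I_{m_q}\end{pmatrix}$ with $\mathcal A'_P\in M(2n-m_q;\mathbb C)$. The system considered is $$(xI_{2n-m_q}-\mathcal T')\frac{dU'}{dx}=\mathcal A'_PU',\qquad \mathcal T'=\begin{pmatrix}T&\\&t_{p+1}I_{n-m_q}\end{pmatrix}.$$ **Assumptions.** None of the following is an integer: $\lambda_{i,k}$;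 $\lambda_{i,k}-\lambda_{i,h}$ ($k\ne h$); $\mu_k$; $\mu_k-\mu_h$ ($k\neq h$); $\lambda_{i,k}-\mu_h$; $\rho_1$; $\rho_1-\lambda_{i,k}$; $\rho_1-\mu_k$ ($1\le k\le q$) (all admissible indices). **Sectors.** Arguments $\theta_i=\arg(t_i-t_{p+1})$ are fixed with $\theta_1<\dots<\theta_p<\theta_1+2\pi$, and $\theta_{p+1}$ is a fixed real number with $\theta_p<\theta_{p+1}<\theta_1+2\pi$; $\theta_0=\theta_{p+1}-2\pi$. With $\delta>0$ fixed and sufficiently small, $\mathcal S_i^+=\{\theta_i<\arg(x-t_{p+1})<\min(\theta_{i+1}-\delta,\theta_i+\pi)\}$, $\mathcal S_i^-=\{\max(\theta_{i-1}+\delta,\theta_i-\pi)<\arg(x-t_{p+1})<\theta_i\}$ ($1\le i\le p$). $\arg(x-t_i)\in(\theta_i,\theta_i+\pi)$ in $\mathcal S_i^+$ and $\in(\theta_i-\pi,\theta_i)$ in $\mathcal S_i^-$. Powers of $t_i-t_{p+1}$ use $\arg=\theta_i$. In (1) $U'_{t_i,k,h}$ is taken with its branch on $\mathcal S_i^+$ and $U'_{t_{i+1},\tilde k,\tilde h}$ with its branch on $\mathcal S_{i+1}^-$, both continued analytically in the (connected) sector $\mathcal S_i^+\cup\mathcal S_{i+1}^-$; similarly in (2). **Local solutions.** $\varepsilon_m(k)$ is the $k$-th unit $m$-vector. $U'_{t_i,k,h}$ ($1\le i\le p$) is the unique solution of the system of the form $U'_{t_i,k,h}(x)=(x-t_i)^{\lambda_{i,k}}\{\varepsilon_{2n-m_q}(n_1+\dots+n_{i-1}+\ell_{i,1}+\dots+\ell_{i,k-1}+h)+\sum_{m\ge1}G'(m)(x-t_i)^m\}$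 (convergent near $t_i$). $\mathrm{hol}(x-a)$ denotes a vector function holomorphic in a neighbourhood of $x=a$. **Underlying system.** Fix $\eta_0\in\mathbb C$; $t'_i=\eta_0+\frac1{t_i-t_{p+1}}$, $T'=\mathrm{diag}(t'_1I_{n_1},\dots,t'_pI_{n_p})$, $\theta'_i=\arg(t'_i-\eta_0)=-\theta_i$. The underlying system is $(\zeta I_n-T')\frac{dw}{d\zeta}=(\rho I_n+A)w$. For $\rho=0$ it has the unique solutions $w_{t'_i,k,h}(0;\zeta)=(\zeta-t'_i)^{\lambda_{i,k}}\{\varepsilon_n(n_1+\dots+n_{i-1}+\ell_{i,1}+\dots+\ell_{i,k-1}+h)+O(\zeta-t'_i)\}$ near $t'_i$ ($O$-term a convergent power series). Let $\mathcal P'=\mathbb C\setminus\bigcup_i\{\eta_0+(t'_i-\eta_0)s: s\ge1\}$; in $\mathcal P'$ the branch of $w_{t'_i,k,h}$ is fixed by $\arg(\zeta-t'_i)\in(\theta'_i-2\pi,\theta'_i)$. The constants $c_{t'_\nu,\tilde k,\tilde h;t'_i,k,h}$ ($\nu\ne i$) are the connection coefficients of the underlying system with $\rho=0$, defined in $\mathcal P'$ by $$w_{t'_i,k,h}(0;\zeta)=\sum_{\tilde k=1}^{r_\nu}\sum_{\tilde h=1}^{\ell_{\nu,\tilde k}}c_{t'_\nu,\tilde k,\tilde h;t'_i,k,h}\,w_{t'_\nu,\tilde k,\tilde h}(0;\zeta)+\mathrm{hol}(\zeta-t'_\nu).$$ *)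

theory Defs
  imports "HOL-Complex_Analysis.Complex_Analysis" "Jordan_Normal_Form.Matrix"
begin

text \<open>Vectors and matrices are those of \<^theory>\<open>Jordan_Normal_Form.Matrix\<close>; their entries are
  numbered from 0, whereas the indices \<open>i, k, h\<close> of the blocks start at 1.\<close>

type_synonym cvec = "complex Matrix.vec"
type_synonym cmat = "complex Matrix.mat"

definition scalar_blocks :: "nat \<Rightarrow> (nat \<Rightarrow> nat) \<Rightarrow> (nat \<Rightarrow> complex) \<Rightarrow> cmat" where
  "scalar_blocks b s c = diag_block_mat (map (\<lambda>i. c i \<cdot>\<^sub>m 1\<^sub>m (s i)) [1..<Suc b])"

definition matrix_block :: "(nat \<Rightarrow> nat) \<Rightarrow> cmat \<Rightarrow> nat \<Rightarrow> nat \<Rightarrow> cmat" where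
  "matrix_block s M i j = Matrix.mat (s i) (s j)
     (\<lambda>(a, b). M $$ ((\<Sum>u\<in>{1..<i}. s u) + a, (\<Sum>u\<in>{1..<j}. s u) + b))"

definition leading_block :: "nat \<Rightarrow> cmat \<Rightarrow> cmat" where
  "leading_block d M = Matrix.mat d d (\<lambda>(a, b). M $$ (a, b))"

definition extension_matrix :: "nat \<Rightarrow> cmat \<Rightarrow> cmat \<Rightarrow> cmat \<Rightarrow> cmat \<Rightarrow> complex \<Rightarrow> complex \<Rightarrow> cmat" where
  "extension_matrix N A A' P Pinv \<rho>1 \<rho>2 = four_block_mat
     A
     P
     (- ((A' - \<rho>1 \<cdot>\<^sub>m 1\<^sub>m N) * (A' - \<rho>2 \<cdot>\<^sub>m 1\<^sub>m N) * Pinv))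
     ((\<rho>1 + \<rho>2) \<cdot>\<^sub>m 1\<^sub>m N - A')"

text \<open>The unit vector \<open>\<epsilon>\<^sub>d(n\<^sub>1 + \<dots> + n\<^bsub>i-1\<^esub> + \<ell>\<^bsub>i,1\<^esub> + \<dots> + \<ell>\<^bsub>i,k-1\<^esub> + h)\<close>;
  the final \<open>- 1\<close> converts the 1-based position.\<close>

definition block_unit_vec ::
  "nat \<Rightarrow> (nat \<Rightarrow> nat) \<Rightarrow> (nat \<Rightarrow> nat \<Rightarrow> nat) \<Rightarrow> nat \<Rightarrow> nat \<Rightarrow> nat \<Rightarrow> cvec" where
  "block_unit_vec d n l i k h =
     unit_vec d ((\<Sum>u\<in>{1..<i}. n u) + (\<Sum>u\<in>{1..<k}. l i u) + h - 1)"

text \<open>The logarithm whose argument is taken in \<open>(\<alpha> - \<pi>, \<alpha> + \<pi>]\<close>, and the powers formed with it.\<close>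

definition branch_ln :: "real \<Rightarrow> complex \<Rightarrow> complex" where
  "branch_ln \<alpha> z = Ln (z * cis (- \<alpha>)) + \<i> * of_real \<alpha>"

definition branch_powr :: "real \<Rightarrow> complex \<Rightarrow> complex \<Rightarrow> complex" where
  "branch_powr \<alpha> z e = exp (e * branch_ln \<alpha> z)"

lemma branch_ln:
  assumes "z \<noteq> 0"
  shows "exp (branch_ln \<alpha> z) = z" "Im (branch_ln \<alpha> z) \<in> {\<alpha> - pi<..\<alpha> + pi}"
proof -
  have "z * cis (- \<alpha>) \<noteq> 0" using assms by simp
  then show "exp (branch_ln \<alpha> z) = z" "Im (branch_ln \<alpha> z) \<in> {\<alpha> - pi<..\<alpha> + pi}"
    using mpi_less_Im_Ln[of "z * cis (- \<alpha>)"] Im_Ln_le_pi[of "z * cis (- \<alpha>)"]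
    by (auto simp: branch_ln_def exp_add cis_conv_exp[symmetric] mult.assoc cis_mult)
qed

definition sector :: "complex \<Rightarrow> real \<Rightarrow> real \<Rightarrow> complex set" where
  "sector a \<alpha> \<beta> = {a + of_real r * cis \<phi> | r \<phi>. 0 < r \<and> \<alpha> < \<phi> \<and> \<phi> < \<beta>}"

definition sector_plus ::
  "nat \<Rightarrow> (nat \<Rightarrow> complex) \<Rightarrow> (nat \<Rightarrow> real) \<Rightarrow> real \<Rightarrow> nat \<Rightarrow> complex set" where
  "sector_plus p t \<theta> \<delta> i = sector (t (p + 1)) (\<theta> i) (min (\<theta> (i + 1) - \<delta>) (\<theta> i + pi))"

definition sector_minus ::
  "nat \<Rightarrow> (nat \<Rightarrow> complex) \<Rightarrow> (nat \<Rightarrow> real) \<Rightarrow> real \<Rightarrow> nat \<Rightarrow> complex set" where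
  "sector_minus p t \<theta> \<delta> i = sector (t (p + 1)) (max (\<theta> (i - 1) + \<delta>) (\<theta> i - pi)) (\<theta> i)"

definition cut_plane :: "nat \<Rightarrow> (nat \<Rightarrow> complex) \<Rightarrow> complex \<Rightarrow> complex set" where
  "cut_plane p t' \<eta>0 = UNIV - (\<Union>i\<in>{1..p}. {\<eta>0 + (t' i - \<eta>0) * of_real s | s. 1 \<le> s})"

definition vec_holomorphic_on :: "nat \<Rightarrow> (complex \<Rightarrow> cvec) \<Rightarrow> complex set \<Rightarrow> bool" where
  "vec_holomorphic_on d F S \<longleftrightarrow>
     (\<forall>x\<in>S. F x \<in> carrier_vec d) \<and> (\<forall>a<d. (\<lambda>x. vec_index (F x) a) holomorphic_on S)"

definition vec_deriv :: "nat \<Rightarrow> (complex \<Rightarrow> cvec) \<Rightarrow> complex \<Rightarrow> cvec" where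
  "vec_deriv d F x = Matrix.vec d (\<lambda>a. deriv (\<lambda>y. vec_index (F y) a) x)"

text \<open>Single-valued holomorphic solutions of \<open>(x - T) dF/dx = M F\<close> on an open set \<open>S\<close>.\<close>

definition solves_okubo :: "nat \<Rightarrow> cmat \<Rightarrow> cmat \<Rightarrow> complex set \<Rightarrow> (complex \<Rightarrow> cvec) \<Rightarrow> bool" where
  "solves_okubo d T M S F \<longleftrightarrow> vec_holomorphic_on d F S \<and>
     (\<forall>x\<in>S. (x \<cdot>\<^sub>m 1\<^sub>m d - T) *\<^sub>v vec_deriv d F x = M *\<^sub>v F x)"

text \<open>The solution \<open>F\<close> on \<open>S\<close> which, near \<open>a\<close> and on \<open>S0 \<subseteq> S\<close>, is
  \<open>(x - a)\<^sup>e \<cdot> (v + O(x - a))\<close> with a convergent power series in \<open>x - a\<close> as second factor and the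
  argument of \<open>x - a\<close> in \<open>(\<alpha> - \<pi>, \<alpha> + \<pi>]\<close>. On \<open>S\<close> it is the analytic continuation of that branch.\<close>

definition local_solution ::
  "nat \<Rightarrow> cmat \<Rightarrow> cmat \<Rightarrow> complex \<Rightarrow> complex \<Rightarrow> cvec \<Rightarrow> real \<Rightarrow> complex set \<Rightarrow> complex set \<Rightarrow>
   (complex \<Rightarrow> cvec) \<Rightarrow> bool" where
  "local_solution d T M a e v \<alpha> S0 S F \<longleftrightarrow> solves_okubo d T M S F \<and>
     (\<exists>\<epsilon>>0. \<exists>G. vec_holomorphic_on d G (ball a \<epsilon>) \<and> G a = v \<and>
        (\<forall>x\<in>S0 \<inter> ball a \<epsilon>. F x = branch_powr \<alpha> (x - a) e \<cdot>\<^sub>v G x))"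

text \<open>\<open>F = \<Sum>\<^bsub>k,h\<^esub> C\<^bsub>k,h\<^esub> V\<^bsub>k,h\<^esub> + hol(x - a)\<close> on \<open>S\<close>: the remainder, defined on \<open>S\<close>, extends
  holomorphically to a neighbourhood of \<open>a\<close>, which lies on the boundary of \<open>S\<close>.\<close>

definition connection_relation ::
  "nat \<Rightarrow> complex set \<Rightarrow> complex \<Rightarrow> nat \<Rightarrow> (nat \<Rightarrow> nat) \<Rightarrow> (nat \<Rightarrow> nat \<Rightarrow> complex) \<Rightarrow>
   (complex \<Rightarrow> cvec) \<Rightarrow> (nat \<Rightarrow> nat \<Rightarrow> complex \<Rightarrow> cvec) \<Rightarrow> bool" where
  "connection_relation d S a r l C F V \<longleftrightarrow>
     (\<exists>H. (\<exists>\<epsilon>>0. vec_holomorphic_on d H (ball a \<epsilon>)) \<and>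
        (\<forall>x\<in>S. H x \<in> carrier_vec d \<and> (\<forall>j<d. vec_index (F x) j =
           (\<Sum>k=1..r. \<Sum>h=1..l k. C k h * vec_index (V k h x) j) + vec_index (H x) j)))"

end

theory Submission
  imports Defs
begin

text \<open>In the coordinate \<open>z\<close> with \<open>x = t\<^bsub>p+1\<^esub> + e\<^bsup>-z\<^esup>\<close>, \<open>\<zeta> = \<eta>\<^sub>0 + e\<^sup>z\<close> the sector between two neighbouring points becomes a
  horizontal strip of width less than \<open>2\<pi>\<close> with one point \<open>A\<close>, \<open>B\<close> on each edge. With \<open>D = d/dz\<close>,
  \<open>\<tau> = T - t\<^bsub>p+1\<^esub>\<close> and \<open>\<sigma> = \<rho>\<^sub>1 + \<rho>\<^sub>2\<close>, eliminating the lower components turns the extended system into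
  \<open>(D + \<rho>\<^sub>1)(D + \<rho>\<^sub>2) u = (D + \<sigma> - A) \<tau> e\<^sup>z D u\<close>, while \<open>\<omega> = \<tau>\<^sup>-\<^sup>1 dw/d\<zeta>\<close> satisfies \<open>D \<omega> = (D - A) \<tau> e\<^sup>z \<omega>\<close>.
  Formally \<open>e\<^bsup>\<sigma>z\<^esup> u = m(D) \<omega>\<close> with
  \<open>m(s) = \<Gamma>(s + 1) \<Gamma>(s - \<sigma>) / (\<Gamma>(s + 1 - \<rho>\<^sub>1) \<Gamma>(s + 1 - \<rho>\<^sub>2))\<close>. As \<open>m(s) \<sim> 1/s\<close>, this operator is an integral
  \<open>\<integral>\<^sub>A\<^sup>z \<kappa>(z - s) \<omega>(s) ds\<close> whose kernel is holomorphic on the diagonal: the composite of the two Euler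
  transforms and a multiplication by a power needs no fractional integral. Replacing the base point \<open>A\<close> by
  \<open>B\<close> therefore changes the integral only by a function holomorphic at \<open>B\<close>, and the connection
  coefficients of \<open>w\<close> and \<open>u\<close> agree up to the normalisations of the local solutions. Integrals that
  diverge at the base point are avoided by first raising the exponents of \<open>w\<close>.\<close>

section \<open>The kernel\<close>

text \<open>The constant C' is read off at the two edge points. Near an edge point A one has x - t ~
  -e^{-A} (z - A) and \<zeta> - t' ~ e^A (z - A). The powers with exponent \<lambda> therefore
  differ by (-e^{-2A})^\<lambda>, that is e^{\<pi>i\<lambda>} (t - t_{p+1})^{2\<lambda>}, while
  e^{\<sigma>z} contributes (t - t_{p+1})^{-\<sigma>}. With the prescribed arguments the logarithm
  of -e^{-2A} is \<pi>i - 2A on both edges, so that the same sign of \<pi>i occurs in numerator and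
  denominator. That the integral is a multiple of the given local solution is seen by uniqueness,
  not by computing it: leading coefficients at A determine a solution of the second-order system,
  since no \<lambda> and no difference of two different \<lambda> in a block is an integer. The
  kernel equation is singular at the points of 2\<pi>i Z. This forces strips narrower than 2\<pi>,
  hence neighbouring points only. In the reducible case the deleted m_q components are put back as
  zeros; as \<mu> = \<rho>2 on them, the padded vector solves the full system, in which P is still
  square and invertible.\<close>

definition ray_mean :: "(complex \<Rightarrow> complex) \<Rightarrow> complex \<Rightarrow> complex" where
  "ray_mean f z = integral {0..1} (\<lambda>s::real. f (of_real s * z))"

lemma ray_in_convex:
  assumes "convex S" "(0::complex) \<in> S" "z \<in> S" "s \<in> {0..1}"
  shows "of_real s * z \<in> S"
proof -
  have "(1 - s) *\<^sub>R 0 + s *\<^sub>R z \<in> S"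
    using assms by (intro convexD) auto
  then show ?thesis by (simp add: scaleR_conv_of_real)
qed

lemma continuous_on_ray:
  fixes f :: "complex \<Rightarrow> complex"
  assumes "convex S" "0 \<in> S" "z \<in> S" "continuous_on S f"
  shows "continuous_on {0..1} (\<lambda>s::real. f (of_real s * z))"
  by (rule continuous_on_compose2[OF assms(4)])
     (use ray_in_convex[OF assms(1-3)] in \<open>auto intro!: continuous_intros\<close>)

lemma ray_mean_holomorphic:
  assumes "open S" "convex S" "0 \<in> S" "f holomorphic_on S"
  shows "ray_mean f holomorphic_on S"
proof -
  have "(\<lambda>z. integral (cbox 0 1) (\<lambda>s::real. f (of_real s * z))) holomorphic_on S"
  proof (rule leibniz_rule_holomorphic[where fx = "\<lambda>z s. of_real s * deriv f (of_real s * z)"])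
    fix z and s :: real assume z: "z \<in> S" "s \<in> cbox 0 1"
    then have "of_real s * z \<in> S" using ray_in_convex[OF assms(2,3)] by auto
    then have *: "(f has_field_derivative deriv f (of_real s * z)) (at (of_real s * z))"
      using assms holomorphic_derivI by blast
    have "((\<lambda>z. of_real s * z) has_field_derivative of_real s) (at z within S)"
      by (auto intro!: derivative_eq_intros)
    from DERIV_chain2[OF * this]
    show "((\<lambda>z. f (of_real s * z)) has_field_derivative of_real s * deriv f (of_real s * z)) (at z within S)"
      by (simp add: mult.commute)
  next
    fix z assume "z \<in> S"
    then show "(\<lambda>s::real. f (of_real s * z)) integrable_on cbox 0 1"
      using continuous_on_ray[OF assms(2,3) _ holomorphic_on_imp_continuous_on[OF assms(4)]]
      by (intro integrable_continuous) auto
  next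
    have c: "continuous_on S (deriv f)"
      using assms holomorphic_deriv holomorphic_on_imp_continuous_on by blast
    show "continuous_on (S \<times> cbox 0 1) (\<lambda>(z, s::real). of_real s * deriv f (of_real s * z))"
      unfolding case_prod_beta
      by (intro continuous_intros continuous_on_compose2[OF c])
         (use ray_in_convex[OF assms(2,3)] in auto)
  qed (use assms in auto)
  then show ?thesis by (simp add: ray_mean_def[abs_def])
qed

text \<open>\<open>ray_mean f z\<close> is z^{-1} times the primitive of f that vanishes at 0. In
  this form the quotient by z is holomorphic at 0, so that a simple zero in a denominator can be
  cancelled without a case distinction.\<close>

lemma ray_mean_primitive:
  assumes "open S" "convex S" "0 \<in> S" "f holomorphic_on S" "z \<in> S"
  shows "((\<lambda>z. z * ray_mean f z) has_field_derivative f z) (at z)"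
proof -
  obtain g where g: "\<And>x. x \<in> S \<Longrightarrow> (g has_field_derivative f x) (at x within S)"
    by (rule holomorphic_convex_primitive'[OF assms(2,1,4)]) blast
  have g': "(g has_field_derivative f x) (at x)" if "x \<in> S" for x
    using g[OF that] at_within_open[OF that assms(1)] by simp
  have eq: "x * ray_mean f x = g x - g 0" if x: "x \<in> S" for x
  proof -
    have "((\<lambda>s::real. x * f (of_real s * x)) has_integral g (of_real 1 * x) - g (of_real 0 * x)) {0..1}"
    proof (rule fundamental_theorem_of_calculus)
      fix s :: real assume s: "s \<in> {0..1}"
      then have "of_real s * x \<in> S" using ray_in_convex[OF assms(2,3) x] by auto
      note * = g'[OF this]
      have "((\<lambda>s. s * x) has_field_derivative x) (at (of_real s))"
        by (auto intro!: derivative_eq_intros)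
      from DERIV_chain2[OF * this]
      have "((\<lambda>s. g (s * x)) has_field_derivative x * f (of_real s * x)) (at (of_real s))"
        by (simp only: mult.commute)
      then show "((\<lambda>s::real. g (of_real s * x)) has_vector_derivative x * f (of_real s * x)) (at s within {0..1})"
        by (rule has_vector_derivative_real_field)
    qed simp
    from integral_unique[OF this] show ?thesis by (simp add: ray_mean_def)
  qed
  have "((\<lambda>z. g z - g 0) has_field_derivative f z) (at z)"
    using DERIV_diff[OF g'[OF assms(5)] DERIV_const[of "g 0"]] by simp
  then show ?thesis
    by (rule has_field_derivative_transform_within_open[OF _ assms(1,5)]) (simp add: eq)
qed

text \<open>The factor 1 / (n + 1) is the integral of s^n over [0, 1]; in the Picard iteration these
  factors multiply up to a factorial.\<close>

lemma ray_mean_bound: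
  assumes "convex C" "0 \<in> C" "continuous_on C f" "z \<in> C"
    and "\<And>y. y \<in> C \<Longrightarrow> norm (f y) \<le> c * norm y ^ n"
  shows "norm (ray_mean f z) \<le> c * norm z ^ n / (n + 1)"
proof -
  have i: "((\<lambda>s::real. c * norm z ^ n * s ^ n) has_integral c * norm z ^ n * (1 / (n + 1))) {0..1}"
  proof (rule has_integral_mult_right)
    have "((\<lambda>s::real. s ^ n) has_integral (1 ^ (n+1) / (n + 1) - 0 ^ (n+1) / (n + 1))) {0..1}"
    proof (rule fundamental_theorem_of_calculus)
      fix s :: real
      have "((\<lambda>s::real. s ^ (n+1) / (n+1)) has_real_derivative s ^ n) (at s within {0..1})"
        by (rule derivative_eq_intros refl | simp)+
      then show "((\<lambda>s::real. s ^ (n+1) / (n+1)) has_vector_derivative s ^ n) (at s within {0..1})"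
        by (simp add: has_real_derivative_iff_has_vector_derivative)
    qed simp
    then show "((\<lambda>s::real. s ^ n) has_integral 1 / (n + 1)) {0..1}" by simp
  qed
  have "norm (ray_mean f z) \<le> integral {0..1} (\<lambda>s::real. c * norm z ^ n * s ^ n)"
    unfolding ray_mean_def
  proof (rule integral_norm_bound_integral)
    show "(\<lambda>s::real. f (of_real s * z)) integrable_on {0..1}"
      using continuous_on_ray[OF assms(1,2,4,3)] integrable_continuous_real by blast
    show "(\<lambda>s::real. c * norm z ^ n * s ^ n) integrable_on {0..1}" using i by blast
    fix s :: real assume s: "s \<in> {0..1}"
    then have "norm (f (of_real s * z)) \<le> c * norm (of_real s * z) ^ n"
      using ray_in_convex[OF assms(1,2,4)] assms(5) by blast
    with s show "norm (f (of_real s * z)) \<le> c * norm z ^ n * s ^ n"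
      by (simp add: norm_mult power_mult_distrib mult_ac)
  qed
  also have "\<dots> = c * norm z ^ n / (n + 1)"
    using integral_unique[OF i] by simp
  finally show ?thesis .
qed

lemma ray_mean_diff:
  assumes "convex C" "0 \<in> C" "continuous_on C f" "continuous_on C g" "z \<in> C"
  shows "ray_mean (\<lambda>y. f y - g y) z = ray_mean f z - ray_mean g z"
  unfolding ray_mean_def
  by (intro integral_diff integrable_continuous_real continuous_on_ray[OF assms(1,2,5)] assms)

text \<open>Picard iteration; it converges on all of \<open>S\<close> since every step integrates along rays from 0.\<close>

lemma picard_ray_mean:
  assumes S: "open S" "convex S" "0 \<in> S" and h: "h holomorphic_on S" and g: "g holomorphic_on S"
  shows "\<exists>\<kappa>. \<kappa> holomorphic_on S \<and>
           (\<forall>z\<in>S. \<kappa> z = 1 + z * ray_mean (\<lambda>y. h y * ray_mean (\<lambda>v. g v * \<kappa> v) y) z)"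
proof -
  define \<Phi> where "\<Phi> = (\<lambda>f z. z * ray_mean (\<lambda>y. h y * ray_mean (\<lambda>v. g v * f v) y) z)"
  define e where "e = rec_nat (\<lambda>_::complex. 1::complex) (\<lambda>_. \<Phi>)"
  have e0: "e 0 = (\<lambda>_. 1)" and eS: "\<And>n. e (Suc n) = \<Phi> (e n)" by (simp_all add: e_def)
  have \<Phi>hol: "\<Phi> f holomorphic_on S" if "f holomorphic_on S" for f
    unfolding \<Phi>_def by (intro holomorphic_intros ray_mean_holomorphic S h g that)
  have ehol: "e n holomorphic_on S" for n
    by (induction n) (auto simp: e0 eS intro: \<Phi>hol)
  have bound\<Phi>: "\<exists>M\<ge>0. \<forall>f n c z. f holomorphic_on S \<and> z \<in> C \<and> (\<forall>y\<in>C. norm (f y) \<le> c * norm y ^ n) \<and> c \<ge> 0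
      \<longrightarrow> norm (\<Phi> f z) \<le> M * c * norm z ^ Suc n / (n + 1)"
    if C: "compact C" "convex C" "0 \<in> C" "C \<subseteq> S" for C
  proof -
    have bdd: "\<exists>M>0. \<forall>y\<in>C. norm (f y) \<le> M" if "f holomorphic_on S" for f :: "complex \<Rightarrow> complex"
    proof -
      have "continuous_on C f"
        using holomorphic_on_imp_continuous_on[OF that] C(4) by (rule continuous_on_subset)
      then have "bounded (f ` C)" using C(1) by (intro compact_imp_bounded compact_continuous_image)
      then show ?thesis unfolding bounded_pos by blast
    qed
    obtain Mh Mg where Mh: "Mh > 0" "\<And>y. y \<in> C \<Longrightarrow> norm (h y) \<le> Mh" and Mg: "Mg > 0" "\<And>y. y \<in> C \<Longrightarrow> norm (g y) \<le> Mg"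
      using bdd[OF h] bdd[OF g] by blast
    have "norm (\<Phi> f z) \<le> Mh * Mg * c * norm z ^ Suc n / (n + 1)"
      if f: "f holomorphic_on S" "z \<in> C" "\<And>y. y \<in> C \<Longrightarrow> norm (f y) \<le> c * norm y ^ n" "c \<ge> 0" for f n c z
    proof -
      have hol1: "(\<lambda>v. g v * f v) holomorphic_on S" by (intro holomorphic_intros f g)
      then have hol2: "ray_mean (\<lambda>v. g v * f v) holomorphic_on S" by (intro ray_mean_holomorphic S)
      have b1: "norm (ray_mean (\<lambda>v. g v * f v) y) \<le> Mg * c * norm y ^ n" if "y \<in> C" for y
      proof -
        have "norm (ray_mean (\<lambda>v. g v * f v) y) \<le> Mg * c * norm y ^ n / (n + 1)"
        proof (rule ray_mean_bound[OF C(2,3) _ that])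
          show "continuous_on C (\<lambda>v. g v * f v)"
            using hol1 C(4) continuous_on_subset holomorphic_on_imp_continuous_on by blast
          show "norm (g v * f v) \<le> Mg * c * norm v ^ n" if "v \<in> C" for v
            using mult_mono[OF Mg(2)[OF that] f(3)[OF that]] Mg(1) by (simp add: norm_mult mult.assoc)
        qed
        \<comment> \<open>The factor 1 / (n + 1) of the inner mean is given away; the one of the
          outer mean suffices for an exponential majorant.\<close>
        also have "\<dots> \<le> Mg * c * norm y ^ n"
        proof -
          have "0 \<le> Mg * c * norm y ^ n" using Mg(1) f(4) by simp
          from mult_left_mono[OF _ this, of 1 "real n + 1"] show ?thesis by (simp add: divide_le_eq add.commute)
        qed
        finally show ?thesis .
      qed
      have "norm (ray_mean (\<lambda>y. h y * ray_mean (\<lambda>v. g v * f v) y) z) \<le> Mh * Mg * c * norm z ^ n / (n + 1)"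
      proof (rule ray_mean_bound[OF C(2,3) _ f(2)])
        show "continuous_on C (\<lambda>y. h y * ray_mean (\<lambda>v. g v * f v) y)"
          using holomorphic_on_mult[OF h hol2] C(4) continuous_on_subset holomorphic_on_imp_continuous_on by blast
        show "norm (h v * ray_mean (\<lambda>v. g v * f v) v) \<le> Mh * Mg * c * norm v ^ n" if "v \<in> C" for v
          using mult_mono[OF Mh(2)[OF that] b1[OF that]] Mh(1) by (simp add: norm_mult mult.assoc)
      qed
      from mult_left_mono[OF this, of "norm z"] show ?thesis
        by (simp add: \<Phi>_def norm_mult mult_ac)
    qed
    then show ?thesis using Mh Mg by (intro exI[of _ "Mh * Mg"]) auto
  qed
  define K where "K = (\<lambda>n z. \<Sum>i<n. e i z)"
  have Khol: "K n holomorphic_on S" for n unfolding K_def by (intro holomorphic_intros ehol)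
  define \<kappa> where "\<kappa> = (\<lambda>z. \<Sum>i. e i z)"
  have unif: "uniform_limit C K \<kappa> sequentially" if C: "compact C" "convex C" "0 \<in> C" "C \<subseteq> S" for C
  proof -
    obtain M where M: "M \<ge> 0" "\<And>f n c z. f holomorphic_on S \<Longrightarrow> z \<in> C \<Longrightarrow> (\<forall>y\<in>C. norm (f y) \<le> c * norm y ^ n) \<Longrightarrow> c \<ge> 0
      \<Longrightarrow> norm (\<Phi> f z) \<le> M * c * norm z ^ Suc n / (n + 1)"
      using bound\<Phi>[OF C] by blast
    have eb: "norm (e n z) \<le> M ^ n / fact n * norm z ^ n" if "z \<in> C" for n z
      using that
    proof (induction n arbitrary: z)
      case (Suc n)
      then have "norm (\<Phi> (e n) z) \<le> M * (M ^ n / fact n) * norm z ^ Suc n / (n + 1)"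
        using M(1) by (intro M(2) ehol) auto
      then show ?case by (simp add: eS field_simps)
    qed (auto simp: e0)
    obtain R where R: "\<And>z. z \<in> C \<Longrightarrow> norm z \<le> R" "R > 0"
      using compact_imp_bounded[OF C(1)] unfolding bounded_pos by blast
    have "norm (e n z) \<le> (M * R) ^ n / fact n" if "z \<in> C" for n z
    proof -
      have "norm (e n z) \<le> M ^ n / fact n * norm z ^ n" by (rule eb[OF that])
      also have "\<dots> \<le> M ^ n / fact n * R ^ n"
        using M(1) R that by (intro mult_left_mono power_mono) auto
      finally show ?thesis by (simp add: power_mult_distrib)
    qed
    moreover have "summable (\<lambda>n. (M * R) ^ n / fact n)"
      using summable_exp_generic[of "M * R"] by (simp add: divide_inverse mult.commute)
    ultimately show ?thesis
      unfolding K_def \<kappa>_def by (intro Weierstrass_m_test)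
  qed
  \<comment> \<open>The estimates integrate along rays from 0, so uniform convergence near x is
    obtained on a compact convex set that contains 0 together with a disc about x.\<close>
  have C_ex: "\<exists>d>0. \<exists>C. cball x d \<subseteq> C \<and> cball x d \<subseteq> S \<and> compact C \<and> convex C \<and> 0 \<in> C \<and> C \<subseteq> S" if x: "x \<in> S" for x
  proof -
    obtain d where d: "d > 0" "cball x d \<subseteq> S" using S(1) x open_contains_cball by blast
    have "convex hull (insert 0 (cball x d)) \<subseteq> S" using d S by (intro hull_minimal) auto
    moreover have "compact (convex hull (insert 0 (cball x d)))" by (intro compact_convex_hull) auto
    moreover have "insert 0 (cball x d) \<subseteq> convex hull (insert 0 (cball x d))" by (rule hull_subset)
    ultimately show ?thesis using d
      by (intro exI[of _ d] conjI exI[of _ "convex hull (insert 0 (cball x d))"]) auto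
  qed
  have \<kappa>hol: "\<kappa> holomorphic_on S"
  proof (rule holomorphic_uniform_sequence[OF S(1) Khol])
    fix x assume "x \<in> S"
    from C_ex[OF this] obtain d C where d: "d > 0" "cball x d \<subseteq> C" "cball x d \<subseteq> S"
      and C: "compact C" "convex C" "0 \<in> C" "C \<subseteq> S" by blast
    have "uniform_limit (cball x d) K \<kappa> sequentially" by (rule uniform_limit_on_subset[OF unif[OF C] d(2)])
    then show "\<exists>d>0. cball x d \<subseteq> S \<and> uniform_limit (cball x d) K \<kappa> sequentially" using d by blast
  qed
  have lin: "\<Phi> (\<lambda>z. f1 z - f2 z) z = \<Phi> f1 z - \<Phi> f2 z"
    if f: "f1 holomorphic_on S" "f2 holomorphic_on S" "z \<in> S" for f1 f2 z
  proof -
    have cont: "continuous_on S (\<lambda>v. g v * f1 v)" "continuous_on S (\<lambda>v. g v * f2 v)"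
      "continuous_on S (\<lambda>y. h y * ray_mean (\<lambda>v. g v * f1 v) y)" "continuous_on S (\<lambda>y. h y * ray_mean (\<lambda>v. g v * f2 v) y)"
      by (intro holomorphic_on_imp_continuous_on holomorphic_intros ray_mean_holomorphic S h g f)+
    have "ray_mean (\<lambda>y. h y * ray_mean (\<lambda>v. g v * (f1 v - f2 v)) y) z
        = ray_mean (\<lambda>y. h y * ray_mean (\<lambda>v. g v * f1 v) y - h y * ray_mean (\<lambda>v. g v * f2 v) y) z"
      unfolding ray_mean_def[of _ z]
    proof (rule integral_cong, goal_cases)
      case (1 s)
      have "of_real s * z \<in> S" using ray_in_convex[OF S(2,3) f(3) 1] .
      from ray_mean_diff[OF S(2,3) cont(1,2) this] show ?case
        by (simp only: right_diff_distrib)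
    qed
    then show ?thesis
      using ray_mean_diff[OF S(2,3) cont(3,4) f(3)] by (simp only: \<Phi>_def right_diff_distrib)
  qed
  have Krec: "K (Suc n) z = 1 + \<Phi> (K n) z" if z: "z \<in> S" for n z
  proof (induction n)
    case 0
    have "\<Phi> (\<lambda>_. 0) z = 0" by (simp add: \<Phi>_def ray_mean_def)
    then show ?case by (simp add: K_def e0)
  next
    case (Suc n)
    have "e n = (\<lambda>z. K (Suc n) z - K n z)" by (auto simp: K_def)
    then have "\<Phi> (e n) z = \<Phi> (K (Suc n)) z - \<Phi> (K n) z" using lin[OF Khol Khol z, of "Suc n" n] by simp
    moreover have "K (Suc (Suc n)) z = K (Suc n) z + \<Phi> (e n) z" by (simp add: K_def eS)
    ultimately show ?case using Suc.IH by simp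
  qed
  have "\<kappa> z = 1 + \<Phi> \<kappa> z" if z: "z \<in> S" for z
  proof -
    obtain C where C: "z \<in> C" "compact C" "convex C" "0 \<in> C" "C \<subseteq> S"
    proof -
      from C_ex[OF z] obtain d C where d: "d > 0" "cball z d \<subseteq> C" and C: "compact C" "convex C" "0 \<in> C" "C \<subseteq> S" by blast
      have "z \<in> C" using d by auto
      then show ?thesis using C that by blast
    qed
    obtain M where M: "M \<ge> 0" "\<And>f n c z. f holomorphic_on S \<Longrightarrow> z \<in> C \<Longrightarrow> (\<forall>y\<in>C. norm (f y) \<le> c * norm y ^ n) \<Longrightarrow> c \<ge> 0
      \<Longrightarrow> norm (\<Phi> f z) \<le> M * c * norm z ^ Suc n / (n + 1)"
      using bound\<Phi>[OF C(2-5)] by blast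
    have lim1: "(\<lambda>n. K n z) \<longlonglongrightarrow> \<kappa> z" by (rule tendsto_uniform_limitI[OF unif[OF C(2-5)] C(1)])
    have "(\<lambda>n. \<Phi> (K n) z) \<longlonglongrightarrow> \<Phi> \<kappa> z"
    proof (rule tendstoI)
      fix \<epsilon> :: real assume "\<epsilon> > 0"
      \<comment> \<open>\<open>bound\<Phi>\<close> with n = 0 turns a uniform error c into an error
        of at most M c |z|. The summand 1 keeps the denominator positive when M |z| = 0.\<close>
      define c where "c = \<epsilon> / (2 * (M * norm z + 1))"
      have "M * norm z + 1 > 0" using M(1) by (simp add: add_nonneg_pos)
      with \<open>\<epsilon> > 0\<close> have c: "c > 0" by (simp add: c_def)
      have "M * c * norm z < \<epsilon>"
      proof -
        have "c * (M * norm z + 1) = \<epsilon> / 2"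
          using \<open>M * norm z + 1 > 0\<close> unfolding c_def by (subst times_divide_eq_left, subst divide_eq_eq) auto
        then show ?thesis using c \<open>\<epsilon> > 0\<close> by (simp add: algebra_simps)
      qed
      have "\<forall>\<^sub>F n in sequentially. \<forall>y\<in>C. dist (K n y) (\<kappa> y) < c"
        using unif[OF C(2-5)] c by (simp add: uniform_limit_iff)
      then show "\<forall>\<^sub>F n in sequentially. dist (\<Phi> (K n) z) (\<Phi> \<kappa> z) < \<epsilon>"
      proof eventually_elim
        case (elim n)
        have "norm (\<Phi> (\<lambda>z. K n z - \<kappa> z) z) \<le> M * c * norm z ^ Suc 0 / (0 + 1)"
        proof -
          have "\<forall>y\<in>C. norm (K n y - \<kappa> y) \<le> c * norm y ^ 0"
            using elim by (simp add: dist_norm less_imp_le)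
          from M(2)[OF holomorphic_on_diff[OF Khol \<kappa>hol] C(1) this] c show ?thesis by simp
        qed
        then have "norm (\<Phi> (\<lambda>z. K n z - \<kappa> z) z) < \<epsilon>" using \<open>M * c * norm z < \<epsilon>\<close> by simp
        then show ?case using lin[OF Khol \<kappa>hol z, of n] by (simp add: dist_norm)
      qed
    qed
    then have "(\<lambda>n. K (Suc n) z) \<longlonglongrightarrow> 1 + \<Phi> \<kappa> z" using Krec[OF z] by (auto intro!: tendsto_intros)
    moreover have "(\<lambda>n. K (Suc n) z) \<longlonglongrightarrow> \<kappa> z" using lim1 by (rule LIMSEQ_Suc)
    ultimately show ?thesis by (metis LIMSEQ_unique)
  qed
  then show ?thesis using \<kappa>hol by (auto simp: \<Phi>_def)
qed

section \<open>The kernel on the strip |Im z| < 2\<pi>\<close>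

definition exp_slit :: "complex set" where "exp_slit = {z. \<bar>Im z\<bar> < 2 * pi}"

lemma exp_slit_props: "open exp_slit" "convex exp_slit" "0 \<in> exp_slit"
proof -
  have eq: "exp_slit = {z. Im z < 2 * pi} \<inter> {z. Im z > - (2 * pi)}" by (auto simp: exp_slit_def)
  show "open exp_slit"
    unfolding eq by (intro open_Int open_halfspace_Im_lt open_halfspace_Im_gt)
  show "convex exp_slit"
    unfolding eq by (intro convex_Int convex_halfspace_Im_lt convex_halfspace_Im_gt)
qed (simp add: exp_slit_def)

text \<open>The zeros 2\<pi>ik of e^z - 1 are the singular points of the kernel equation. Inside |Im
  z| < 2\<pi> only 0 is left, and there the holomorphic solution is taken.\<close>

lemma exp_eq_1_exp_slit: "z \<in> exp_slit \<Longrightarrow> exp z = 1 \<longleftrightarrow> z = 0"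
proof
  assume z: "z \<in> exp_slit" "exp z = 1"
  then obtain k :: int where k: "Re z = 0" "Im z = of_int (2 * k) * pi" by (auto simp: exp_eq_1)
  with z(1) have "\<bar>of_int k\<bar> * (2*pi) < 1 * (2*pi)" by (auto simp: exp_slit_def abs_mult)
  then have "\<bar>real_of_int k\<bar> < 1" using pi_gt_zero mult_less_cancel_right_pos[of "2*pi"] by simp
  then have "k = 0" by linarith
  with k show "z = 0" by (simp add: complex_eq_iff)
qed auto

text \<open>For \<open>\<sigma> = \<rho>\<^sub>1 + \<rho>\<^sub>2\<close> and \<open>\<pi>' = \<rho>\<^sub>1 \<rho>\<^sub>2\<close> the solution is \<open>e\<^bsup>\<rho>\<^sub>1z\<^esup> F(1 + \<rho>\<^sub>1, -\<rho>\<^sub>2; 1; 1 - e\<^sup>z)\<close>. The equation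
  has a regular singular point at 0 with exponents 0, 0, and its self-adjoint form is
  \<open>(e\<^bsup>-\<sigma>z\<^esup> (e\<^sup>z - 1) \<kappa>')' = e\<^bsup>-\<sigma>z\<^esup> (\<pi>' + \<sigma> e\<^sup>z) \<kappa>\<close>.\<close>

lemma kernel_exists:
  fixes \<sigma> \<pi>' :: complex
  shows "\<exists>\<kappa>. \<kappa> holomorphic_on exp_slit \<and> \<kappa> 0 = 1 \<and>
    (\<forall>z\<in>exp_slit. deriv (deriv \<kappa>) z - \<sigma> * deriv \<kappa> z + \<pi>' * \<kappa> z
       = exp z * (deriv (deriv \<kappa>) z + (1 - \<sigma>) * deriv \<kappa> z - \<sigma> * \<kappa> z))"
proof -
  note S = exp_slit_props
  \<comment> \<open>Integrating the self-adjoint form from 0 gives e^{-\<sigma>z} (e^z - 1)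
    \<kappa>' = z m(z), where m is the ray mean of g \<kappa>. As e^z - 1 = z q(z), the factor z
    cancels and \<kappa>' = h m; integrating once more yields the equation solved by Picard
    iteration.\<close>
  define q where "q = (\<lambda>z::complex. if z = 0 then 1 else (exp z - 1) / z)"
  have qhol: "q holomorphic_on exp_slit"
  proof -
    have "(\<lambda>z. if z = 0 then deriv (\<lambda>z::complex. exp z - 1) 0 else (exp z - 1) / z - (exp 0 - 1) / (z - 0)) holomorphic_on exp_slit"
      using S(1,3) by (intro pole_theorem_open[of _ _ 0]) (auto intro!: holomorphic_intros)
    moreover have "deriv (\<lambda>z::complex. exp z - 1) 0 = 1" by (rule DERIV_imp_deriv) (auto intro!: derivative_eq_intros)
    ultimately show ?thesis unfolding q_def by (simp cong: if_cong)
  qed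
  have qnz: "q z \<noteq> 0" if "z \<in> exp_slit" for z using exp_eq_1_exp_slit[OF that] by (auto simp: q_def)
  have qz: "z * q z = exp z - 1" for z by (simp add: q_def)
  define h where "h = (\<lambda>z. exp (\<sigma> * z) / q z)"
  define g where "g = (\<lambda>z. exp (- \<sigma> * z) * (\<pi>' + \<sigma> * exp z))"
  have h: "h holomorphic_on exp_slit" unfolding h_def using qnz by (intro holomorphic_intros qhol) auto
  have g: "g holomorphic_on exp_slit" unfolding g_def by (intro holomorphic_intros)
  obtain \<kappa> where \<kappa>: "\<kappa> holomorphic_on exp_slit"
    "\<And>z. z \<in> exp_slit \<Longrightarrow> \<kappa> z = 1 + z * ray_mean (\<lambda>y. h y * ray_mean (\<lambda>v. g v * \<kappa> v) y) z"
    using picard_ray_mean[OF S h g] by blast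
  define m where "m = ray_mean (\<lambda>v. g v * \<kappa> v)"
  have gk: "(\<lambda>v. g v * \<kappa> v) holomorphic_on exp_slit" by (intro holomorphic_intros g \<kappa>)
  have m: "m holomorphic_on exp_slit" unfolding m_def by (intro ray_mean_holomorphic S gk)
  have d1: "(\<kappa> has_field_derivative h z * m z) (at z)" if z: "z \<in> exp_slit" for z
  proof -
    have "((\<lambda>z. z * ray_mean (\<lambda>y. h y * m y) z) has_field_derivative h z * m z) (at z)"
      by (rule ray_mean_primitive[OF S _ z]) (intro holomorphic_intros h m)
    from DERIV_add[OF DERIV_const[of 1] this]
    have "((\<lambda>z. 1 + z * ray_mean (\<lambda>y. h y * m y) z) has_field_derivative h z * m z) (at z)" by simp
    then show ?thesis
      by (rule has_field_derivative_transform_within_open[OF _ S(1) z]) (simp only: \<kappa>(2)[symmetric] m_def)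
  qed
  have key: "deriv (deriv \<kappa>) z * (exp z - 1) + (exp z - \<sigma> * (exp z - 1)) * deriv \<kappa> z = (\<pi>' + \<sigma> * exp z) * \<kappa> z"
    if z: "z \<in> exp_slit" for z
  proof -
    have eq: "y * m y = exp (- \<sigma> * y) * (exp y - 1) * deriv \<kappa> y" if "y \<in> exp_slit" for y
    proof -
      have "deriv \<kappa> y = h y * m y" using d1[OF that] by (rule DERIV_imp_deriv)
      moreover have "exp (- \<sigma> * y) * (exp y - 1) * h y = y"
        using qnz[OF that] by (simp add: h_def exp_minus field_simps flip: qz)
      ultimately show ?thesis by (simp add: mult.assoc[symmetric])
    qed
    have "((\<lambda>y. y * m y) has_field_derivative g z * \<kappa> z) (at z)"
      unfolding m_def by (rule ray_mean_primitive[OF S gk z])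
    then have l: "((\<lambda>y. exp (- \<sigma> * y) * (exp y - 1) * deriv \<kappa> y) has_field_derivative g z * \<kappa> z) (at z)"
      by (rule has_field_derivative_transform_within_open[OF _ S(1) z]) (use eq in auto)
    have d: "(deriv \<kappa> has_field_derivative deriv (deriv \<kappa>) z) (at z)"
      using holomorphic_deriv[OF \<kappa>(1) S(1)] z S(1) holomorphic_derivI by blast
    have r: "((\<lambda>y. exp (- \<sigma> * y) * (exp y - 1) * deriv \<kappa> y) has_field_derivative
       exp (- \<sigma> * z) * ((exp z - 1) * deriv (deriv \<kappa>) z + (exp z - \<sigma> * (exp z - 1)) * deriv \<kappa> z)) (at z)"
      by (rule derivative_eq_intros d refl | simp)+ (simp add: algebra_simps)
    have "exp (- \<sigma> * z) * (deriv (deriv \<kappa>) z * (exp z - 1) + (exp z - \<sigma> * (exp z - 1)) * deriv \<kappa> z)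
        = exp (- \<sigma> * z) * ((\<pi>' + \<sigma> * exp z) * \<kappa> z)"
      using DERIV_unique[OF l r] by (simp only: g_def mult.assoc) (simp only: mult.commute mult.left_commute)
    then show ?thesis by (simp only: mult_cancel_left exp_not_eq_zero simp_thms)
  qed
  have "\<kappa> 0 = 1" by (subst \<kappa>(2)[OF S(3)]) simp
  then show ?thesis using \<kappa>(1) key by (intro exI[of _ \<kappa>]) (auto simp: algebra_simps)
qed

section \<open>Functions with a branch point on the edge of a strip\<close>

definition strip :: "real \<Rightarrow> real \<Rightarrow> complex set" where
  "strip a b = {z. a < Im z \<and> Im z < b}"

text \<open>The bound on the width keeps every difference z - A with z in the strip inside
  \<open>exp_slit\<close>, where the kernel is holomorphic. As A is on an edge, z - A stays in an
  open upper or lower half plane, away from the cut of the principal power.\<close>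

definition edge_point :: "real \<Rightarrow> real \<Rightarrow> complex \<Rightarrow> bool" where
  "edge_point a b A \<longleftrightarrow> a < b \<and> b - a < 2 * pi \<and> (Im A = a \<or> Im A = b)"

text \<open>On a strip with \<open>A\<close> on its edge the principal power of \<open>z - A\<close> is holomorphic. For \<open>e = 0\<close> the
  predicate says that \<open>f\<close> extends holomorphically to a neighbourhood of \<open>A\<close>.\<close>

definition branch_at :: "complex \<Rightarrow> complex set \<Rightarrow> complex \<Rightarrow> (complex \<Rightarrow> complex) \<Rightarrow> complex \<Rightarrow> bool" where
  "branch_at A S e f L \<longleftrightarrow> (\<exists>\<epsilon>>0. \<exists>G. G holomorphic_on ball A \<epsilon> \<and> G A = L \<and>
     (\<forall>z\<in>S \<inter> ball A \<epsilon>. f z = (z - A) powr e * G z))"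

lemma strip_open: "open (strip a b)" and strip_convex: "convex (strip a b)"
proof -
  have eq: "strip a b = {z. Im z < b} \<inter> {z. Im z > a}" by (auto simp: strip_def)
  show "open (strip a b)" unfolding eq by (intro open_Int open_halfspace_Im_lt open_halfspace_Im_gt)
  show "convex (strip a b)" unfolding eq by (intro convex_Int convex_halfspace_Im_lt convex_halfspace_Im_gt)
qed

lemma edge_point_nonpos: "edge_point a b A \<Longrightarrow> z \<in> strip a b \<Longrightarrow> z - A \<notin> \<real>\<^sub>\<le>\<^sub>0"
  by (auto simp: edge_point_def strip_def complex_nonpos_Reals_iff)

lemma edge_point_neq: "edge_point a b A \<Longrightarrow> z \<in> strip a b \<Longrightarrow> z - A \<noteq> 0"
  by (auto simp: edge_point_def strip_def)

lemma edge_point_ray: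
  assumes "edge_point a b A" "z \<in> strip a b" "0 < s" "s \<le> 1"
  shows "A + of_real s * (z - A) \<in> strip a b"
proof -
  have "Im (A + of_real s * (z - A)) = Im A + s * (Im z - Im A)" by simp
  moreover have "a < Im A + s * (Im z - Im A) \<and> Im A + s * (Im z - Im A) < b"
    using assms(1)
  proof (simp only: edge_point_def, elim conjE disjE)
    assume "Im A = a" "a < b"
    moreover have "s * (Im z - a) \<le> Im z - a" "s * (Im z - a) > 0"
      using assms by (auto simp: strip_def mult_left_le_one_le)
    ultimately show ?thesis using assms by (auto simp: strip_def)
  next
    assume "Im A = b" "a < b"
    moreover have "s * (b - Im z) \<le> b - Im z" "s * (b - Im z) > 0"
      using assms by (auto simp: strip_def mult_left_le_one_le)
    ultimately show ?thesis using assms by (auto simp: strip_def algebra_simps)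
  qed
  ultimately show ?thesis by (simp add: strip_def)
qed

text \<open>Functions on the strip are extended continuously to A alone and not to the whole edge,
  so this set serves as the domain for paths that start at A.\<close>

lemma edge_point_convex:
  assumes "edge_point a b A"
  shows "convex (insert A (strip a b))"
  unfolding convex_alt
proof (intro ballI allI impI)
  fix x y and u :: real assume *: "x \<in> insert A (strip a b)" "y \<in> insert A (strip a b)" "0 \<le> u \<and> u \<le> 1"
  have eq: "(1 - u) *\<^sub>R x + u *\<^sub>R y = x + of_real u * (y - x)" by (simp add: scaleR_conv_of_real algebra_simps)
  have eq': "(1 - u) *\<^sub>R x + u *\<^sub>R y = y + of_real (1 - u) * (x - y)" by (simp add: scaleR_conv_of_real algebra_simps)
  consider "x = A" "y = A" | "x = A" "y \<in> strip a b" "u = 0" | "x = A" "y \<in> strip a b" "0 < u"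
    | "x \<in> strip a b" "y = A" "u = 1" | "x \<in> strip a b" "y = A" "u < 1" | "x \<in> strip a b" "y \<in> strip a b"
    using * by force
  then show "(1 - u) *\<^sub>R x + u *\<^sub>R y \<in> insert A (strip a b)"
  proof cases
    case 3 then show ?thesis unfolding eq using edge_point_ray[OF assms, of y u] * by auto
  next
    case 5 then show ?thesis unfolding eq' using edge_point_ray[OF assms, of x "1 - u"] * by auto
  next
    case 6 then show ?thesis using convexD_alt[OF strip_convex, of x a b y u] * by auto
  qed (simp_all add: eq)
qed

lemma edge_point_exp_slit:
  assumes "edge_point a b A" "z \<in> strip a b" shows "z - A \<in> exp_slit"
  using assms by (auto simp: edge_point_def strip_def exp_slit_def)

lemma edge_point_strip_ball:
  assumes "edge_point a b A" "\<epsilon> > 0" shows "\<exists>z. z \<in> strip a b \<inter> ball A \<epsilon>"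
proof -
  define d where "d = min (\<epsilon> / 2) ((b - a) / 2)"
  have d: "0 < d" "d < \<epsilon>" "d < b - a" using assms by (auto simp: d_def edge_point_def min_def)
  show ?thesis
  proof (cases "Im A = a")
    case True
    then show ?thesis using d by (intro exI[of _ "A + \<i> * of_real d"]) (auto simp: strip_def dist_norm norm_mult)
  next
    case False
    then have "Im A = b" using assms by (simp add: edge_point_def)
    then show ?thesis using d by (intro exI[of _ "A - \<i> * of_real d"]) (auto simp: strip_def dist_norm norm_mult)
  qed
qed

lemma branch_at_cong:
  assumes "branch_at A S e f L" "\<And>z. z \<in> S \<Longrightarrow> f z = g z"
  shows "branch_at A S e g L"
proof -
  obtain \<epsilon> G where 1: "\<epsilon> > 0" "G holomorphic_on ball A \<epsilon>" "G A = L" "\<And>z. z \<in> S \<inter> ball A \<epsilon> \<Longrightarrow> f z = (z - A) powr e * G z"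
    using assms(1) unfolding branch_at_def by blast
  have "g z = (z - A) powr e * G z" if "z \<in> S \<inter> ball A \<epsilon>" for z
    using 1(4)[OF that] assms(2)[of z] that by simp
  then show ?thesis unfolding branch_at_def using 1(1-3) by blast
qed

lemma branch_at_mult:
  assumes "branch_at A S e1 f L1" "branch_at A S e2 g L2"
  shows "branch_at A S (e1 + e2) (\<lambda>z. f z * g z) (L1 * L2)"
proof -
  obtain \<epsilon>1 G1 where 1: "\<epsilon>1 > 0" "G1 holomorphic_on ball A \<epsilon>1" "G1 A = L1" "\<And>z. z \<in> S \<inter> ball A \<epsilon>1 \<Longrightarrow> f z = (z - A) powr e1 * G1 z"
    using assms(1) unfolding branch_at_def by blast
  obtain \<epsilon>2 G2 where 2: "\<epsilon>2 > 0" "G2 holomorphic_on ball A \<epsilon>2" "G2 A = L2" "\<And>z. z \<in> S \<inter> ball A \<epsilon>2 \<Longrightarrow> g z = (z - A) powr e2 * G2 z"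
    using assms(2) unfolding branch_at_def by blast
  show ?thesis unfolding branch_at_def
  proof (intro exI conjI ballI)
    show "min \<epsilon>1 \<epsilon>2 > 0" using 1 2 by simp
    show "(\<lambda>z. G1 z * G2 z) holomorphic_on ball A (min \<epsilon>1 \<epsilon>2)"
      by (intro holomorphic_on_mult holomorphic_on_subset[OF 1(2)] holomorphic_on_subset[OF 2(2)]) auto
    show "G1 A * G2 A = L1 * L2" using 1 2 by simp
    fix z assume z: "z \<in> S \<inter> ball A (min \<epsilon>1 \<epsilon>2)"
    then show "f z * g z = (z - A) powr (e1 + e2) * (G1 z * G2 z)"
      using 1(4)[of z] 2(4)[of z] by (simp add: powr_add)
  qed
qed

lemma branch_at_add:
  assumes "branch_at A S e f L1" "branch_at A S e g L2"
  shows "branch_at A S e (\<lambda>z. f z + g z) (L1 + L2)"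
proof -
  obtain \<epsilon>1 G1 where 1: "\<epsilon>1 > 0" "G1 holomorphic_on ball A \<epsilon>1" "G1 A = L1" "\<And>z. z \<in> S \<inter> ball A \<epsilon>1 \<Longrightarrow> f z = (z - A) powr e * G1 z"
    using assms(1) unfolding branch_at_def by blast
  obtain \<epsilon>2 G2 where 2: "\<epsilon>2 > 0" "G2 holomorphic_on ball A \<epsilon>2" "G2 A = L2" "\<And>z. z \<in> S \<inter> ball A \<epsilon>2 \<Longrightarrow> g z = (z - A) powr e * G2 z"
    using assms(2) unfolding branch_at_def by blast
  show ?thesis unfolding branch_at_def
  proof (intro exI conjI ballI)
    show "min \<epsilon>1 \<epsilon>2 > 0" using 1 2 by simp
    show "(\<lambda>z. G1 z + G2 z) holomorphic_on ball A (min \<epsilon>1 \<epsilon>2)"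
      by (intro holomorphic_on_add holomorphic_on_subset[OF 1(2)] holomorphic_on_subset[OF 2(2)]) auto
    show "G1 A + G2 A = L1 + L2" using 1 2 by simp
    fix z assume z: "z \<in> S \<inter> ball A (min \<epsilon>1 \<epsilon>2)"
    then show "f z + g z = (z - A) powr e * (G1 z + G2 z)"
      using 1(4)[of z] 2(4)[of z] by (simp add: distrib_left)
  qed
qed

lemma branch_at_holomorphic:
  assumes "G holomorphic_on ball A \<epsilon>" "\<epsilon> > 0" "A \<notin> S"
  shows "branch_at A S 0 G (G A)"
  unfolding branch_at_def using assms by (intro exI[of _ \<epsilon>] exI[of _ G] conjI) auto

lemma branch_at_const: "A \<notin> S \<Longrightarrow> branch_at A S 0 (\<lambda>_. c) c"
  using branch_at_holomorphic[of "\<lambda>_. c" A 1 S] by simp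

lemma branch_at_cmult:
  assumes "branch_at A S e f L" "A \<notin> S"
  shows "branch_at A S e (\<lambda>z. c * f z) (c * L)"
  using branch_at_mult[OF branch_at_const[OF assms(2), of c] assms(1)] by simp

lemma branch_at_zero: "branch_at A S e (\<lambda>_. 0) 0"
  unfolding branch_at_def by (rule exI[of _ 1], simp, rule exI[of _ "\<lambda>_. 0"]) auto

lemma branch_at_sum:
  assumes "\<And>i. i \<in> I \<Longrightarrow> branch_at A S e (f i) (L i)"
  shows "branch_at A S e (\<lambda>z. \<Sum>i\<in>I. f i z) (\<Sum>i\<in>I. L i)"
  using assms by (induction I rule: infinite_finite_induct) (auto simp: branch_at_zero intro: branch_at_add)

lemma branch_at_diff:
  assumes "branch_at A S e f L1" "branch_at A S e g L2" "A \<notin> S"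
  shows "branch_at A S e (\<lambda>z. f z - g z) (L1 - L2)"
  using branch_at_add[OF assms(1) branch_at_cmult[OF assms(2,3), of "-1"]] by simp

text \<open>The coefficient L in \<open>branch_at\<close> may be 0, so the exponent is only
  determined up to such shifts. Terms whose exponents differ by an integer are compared at the
  lowest of them, and \<open>branch_at_lift\<close> leads back up once a coefficient is known to
  vanish.\<close>

lemma branch_at_lower:
  assumes "branch_at A S e f L" "A \<notin> S"
  shows "branch_at A S (e - 1) f 0"
proof -
  obtain \<epsilon> G where 1: "\<epsilon> > 0" "G holomorphic_on ball A \<epsilon>" "G A = L" "\<And>z. z \<in> S \<inter> ball A \<epsilon> \<Longrightarrow> f z = (z - A) powr e * G z"
    using assms(1) unfolding branch_at_def by blast
  show ?thesis unfolding branch_at_def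
  proof (intro exI conjI ballI)
    show "(\<lambda>z. (z - A) * G z) holomorphic_on ball A \<epsilon>" by (intro holomorphic_intros 1)
    fix z assume z: "z \<in> S \<inter> ball A \<epsilon>"
    then have "z - A \<noteq> 0" using assms(2) by auto
    then have "(z - A) powr e = (z - A) powr (e - 1) * (z - A)"
      using powr_add[of "z - A" "e - 1" 1] by simp
    then show "f z = (z - A) powr (e - 1) * ((z - A) * G z)" using 1(4)[OF z] by (simp add: mult.assoc)
  qed (use 1 in auto)
qed

lemma divide_out_zero:
  assumes "G holomorphic_on ball A \<epsilon>" "\<epsilon> > 0" "G A = 0"
  shows "\<exists>H. H holomorphic_on ball A \<epsilon> \<and> (\<forall>z\<in>ball A \<epsilon>. G z = (z - A) * H z)"
proof -
  have "(\<lambda>z. if z = A then deriv G A else G z / (z - A) - G A / (z - A)) holomorphic_on ball A \<epsilon>"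
    using assms by (intro pole_theorem_open[of G]) auto
  then show ?thesis using assms(3)
    by (intro exI[of _ "\<lambda>z. if z = A then deriv G A else G z / (z - A) - G A / (z - A)"]) auto
qed

lemma branch_at_lift:
  assumes "branch_at A S e f 0" "A \<notin> S"
  shows "\<exists>L. branch_at A S (e + 1) f L"
proof -
  obtain \<epsilon> G where 1: "\<epsilon> > 0" "G holomorphic_on ball A \<epsilon>" "G A = 0" "\<And>z. z \<in> S \<inter> ball A \<epsilon> \<Longrightarrow> f z = (z - A) powr e * G z"
    using assms(1) unfolding branch_at_def by blast
  obtain H where H: "H holomorphic_on ball A \<epsilon>" "\<And>z. z \<in> ball A \<epsilon> \<Longrightarrow> G z = (z - A) * H z"
    using divide_out_zero[OF 1(2,1,3)] by blast
  have "f z = (z - A) powr (e + 1) * H z" if z: "z \<in> S \<inter> ball A \<epsilon>" for z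
  proof -
    have "z - A \<noteq> 0" using assms(2) z by auto
    then have "(z - A) powr (e + 1) = (z - A) powr e * (z - A)"
      by (simp add: powr_add)
    then show ?thesis using 1(4)[OF z] H(2)[of z] z by simp
  qed
  then show ?thesis unfolding branch_at_def using 1(1) H(1) by blast
qed

lemma branch_at_deriv:
  assumes A: "edge_point a b A" and "branch_at A (strip a b) e f L"
  shows "branch_at A (strip a b) (e - 1) (deriv f) (e * L)"
proof -
  obtain \<epsilon> G where 1: "\<epsilon> > 0" "G holomorphic_on ball A \<epsilon>" "G A = L" "\<And>z. z \<in> strip a b \<inter> ball A \<epsilon> \<Longrightarrow> f z = (z - A) powr e * G z"
    using assms(2) unfolding branch_at_def by blast
  show ?thesis unfolding branch_at_def
  proof (intro exI conjI ballI)
    show "(\<lambda>z. e * G z + (z - A) * deriv G z) holomorphic_on ball A \<epsilon>"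
      by (intro holomorphic_intros holomorphic_deriv 1) auto
    fix z assume z: "z \<in> strip a b \<inter> ball A \<epsilon>"
    then have nz: "z - A \<noteq> 0" "z - A \<notin> \<real>\<^sub>\<le>\<^sub>0" using A edge_point_neq edge_point_nonpos by blast+
    have G': "(G has_field_derivative deriv G z) (at z)"
      using 1(2) z holomorphic_derivI by blast
    have p: "((\<lambda>z. (z - A) powr e) has_field_derivative e * (z - A) powr (e - 1)) (at z)"
      using nz by (auto intro!: derivative_eq_intros)
    have "((\<lambda>z. (z - A) powr e * G z) has_field_derivative
        e * (z - A) powr (e - 1) * G z + deriv G z * (z - A) powr e) (at z)"
      by (rule DERIV_mult[OF p G'])
    moreover have "(z - A) powr e = (z - A) powr (e - 1) * (z - A)"
      using powr_add[of "z - A" "e - 1" 1] nz by simp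
    ultimately have "((\<lambda>z. (z - A) powr e * G z) has_field_derivative
        (z - A) powr (e - 1) * (e * G z + (z - A) * deriv G z)) (at z)" by (simp add: algebra_simps)
    then have "(f has_field_derivative (z - A) powr (e - 1) * (e * G z + (z - A) * deriv G z)) (at z)"
      by (rule has_field_derivative_transform_within_open[of _ _ _ "strip a b \<inter> ball A \<epsilon>"])
         (use z 1(4) in \<open>auto intro: strip_open\<close>)
    then show "deriv f z = (z - A) powr (e - 1) * (e * G z + (z - A) * deriv G z)" by (rule DERIV_imp_deriv)
  qed (use 1 in auto)
qed

text \<open>The part of the ball inside the strip is open and nonempty, so the identity theorem
  carries an equality over to A, which is not in the strip.\<close>

lemma strip_ball_identity:
  assumes A: "edge_point a b A" and "\<epsilon> > 0" "G holomorphic_on ball A \<epsilon>" "H holomorphic_on ball A \<epsilon>"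
    and "\<And>z. z \<in> strip a b \<inter> ball A \<epsilon> \<Longrightarrow> G z = H z" and z: "z \<in> ball A \<epsilon>"
  shows "G z = H z"
proof -
  obtain w where "w \<in> strip a b \<inter> ball A \<epsilon>" using edge_point_strip_ball[OF A assms(2)] by blast
  then show ?thesis
    by (intro analytic_continuation_open[of "strip a b \<inter> ball A \<epsilon>" "ball A \<epsilon>" G H z])
       (use assms strip_open in auto)
qed

text \<open>Turns an identity between functions into one between leading coefficients: the power of
  z - A has no zeros on the strip, so the holomorphic factors agree there and hence at A.\<close>

lemma branch_at_unique:
  assumes A: "edge_point a b A" and "branch_at A (strip a b) e f L1" "branch_at A (strip a b) e f L2"
  shows "L1 = L2"
proof -
  obtain \<epsilon>1 G1 where 1: "\<epsilon>1 > 0" "G1 holomorphic_on ball A \<epsilon>1" "G1 A = L1" "\<And>z. z \<in> strip a b \<inter> ball A \<epsilon>1 \<Longrightarrow> f z = (z - A) powr e * G1 z"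
    using assms(2) unfolding branch_at_def by blast
  obtain \<epsilon>2 G2 where 2: "\<epsilon>2 > 0" "G2 holomorphic_on ball A \<epsilon>2" "G2 A = L2" "\<And>z. z \<in> strip a b \<inter> ball A \<epsilon>2 \<Longrightarrow> f z = (z - A) powr e * G2 z"
    using assms(3) unfolding branch_at_def by blast
  define \<epsilon> where "\<epsilon> = min \<epsilon>1 \<epsilon>2"
  have \<epsilon>: "\<epsilon> > 0" "ball A \<epsilon> \<subseteq> ball A \<epsilon>1" "ball A \<epsilon> \<subseteq> ball A \<epsilon>2" using 1 2 by (auto simp: \<epsilon>_def)
  have "G1 z = G2 z" if z: "z \<in> strip a b \<inter> ball A \<epsilon>" for z
  proof -
    have "(z - A) powr e * G1 z = (z - A) powr e * G2 z"
    proof -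
      have "z \<in> strip a b \<inter> ball A \<epsilon>1" "z \<in> strip a b \<inter> ball A \<epsilon>2" using z \<epsilon> by blast+
      from 1(4)[OF this(1)] 2(4)[OF this(2)] show ?thesis by (simp only:)
    qed
    moreover have "(z - A) powr e \<noteq> 0" using edge_point_neq[OF A, of z] z by (auto simp: powr_def)
    ultimately show ?thesis by simp
  qed
  then have "G1 A = G2 A"
    by (rule strip_ball_identity[OF A \<epsilon>(1) holomorphic_on_subset[OF 1(2) \<epsilon>(2)] holomorphic_on_subset[OF 2(2) \<epsilon>(3)]])
       (use \<epsilon>(1) in simp_all)
  then show ?thesis using 1 2 by simp
qed

lemma edge_point_notin: "edge_point a b A \<Longrightarrow> A \<notin> strip a b"
  by (auto simp: edge_point_def strip_def)

text \<open>For Re e > 0 the limit at A exists and is 0, which explains the value chosen at the base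
  point of a convolution.\<close>

lemma branch_at_continuous:
  assumes A: "edge_point a b A" and f: "f holomorphic_on strip a b" "branch_at A (strip a b) e f L" and e: "Re e > 0"
  shows "continuous_on (insert A (strip a b)) (f(A := 0))"
proof -
  obtain \<epsilon> G where 1: "\<epsilon> > 0" "G holomorphic_on ball A \<epsilon>" "G A = L" "\<And>z. z \<in> strip a b \<inter> ball A \<epsilon> \<Longrightarrow> f z = (z - A) powr e * G z"
    using f(2) unfolding branch_at_def by blast
  show ?thesis unfolding continuous_on_eq_continuous_within
  proof
    fix z assume z: "z \<in> insert A (strip a b)"
    show "continuous (at z within insert A (strip a b)) (f(A := 0))"
    proof (cases "z = A")
      case False
      then have z: "z \<in> strip a b" using z by simp
      have "\<forall>\<^sub>F x in nhds z. x \<in> strip a b" using z strip_open eventually_nhds by blast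
      then have ev: "\<forall>\<^sub>F x in nhds z. f x = (f(A := 0)) x"
        by eventually_elim (use edge_point_notin[OF A] in auto)
      have "isCont f z" using holomorphic_on_imp_continuous_on[OF f(1)] z continuous_on_eq_continuous_at[OF strip_open] by blast
      then have "isCont (f(A := 0)) z" using isCont_cong[OF ev] by (simp only:)
      then show ?thesis by (rule continuous_at_imp_continuous_at_within)
    next
      case True
      have "isCont G A" using holomorphic_on_imp_continuous_on[OF 1(2)] 1(1) continuous_on_eq_continuous_at[OF open_ball, of A \<epsilon> G] by auto
      then have "(G \<longlongrightarrow> G A) (at A within insert A (strip a b))"
        unfolding continuous_within[symmetric] by (rule continuous_at_imp_continuous_at_within)
      moreover have "((\<lambda>z. (z - A) powr e) \<longlongrightarrow> 0) (at A within insert A (strip a b))"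
      proof (rule tendsto_powr_complex_0)
        show "((\<lambda>z. z - A) \<longlongrightarrow> 0) (at A within insert A (strip a b))"
          by (rule tendsto_eq_intros refl | simp)+
      qed (use e in auto)
      ultimately have "((\<lambda>z. (z - A) powr e * G z) \<longlongrightarrow> 0 * G A) (at A within insert A (strip a b))"
        by (intro tendsto_mult)
      moreover have "\<forall>\<^sub>F z in at A within insert A (strip a b). (z - A) powr e * G z = (f(A := 0)) z"
      proof -
        have "\<forall>\<^sub>F z in at A within insert A (strip a b). z \<in> ball A \<epsilon>"
          by (rule eventually_mono[OF eventually_at_ball[OF 1(1)]]) auto
        moreover have "\<forall>\<^sub>F z in at A within insert A (strip a b). z \<in> strip a b"
          by (auto simp: eventually_at_filter)
        ultimately show ?thesis
          by eventually_elim (use 1(4) edge_point_notin[OF A] in auto)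
      qed
      ultimately have "((f(A := 0)) \<longlongrightarrow> 0 * G A) (at A within insert A (strip a b))"
        by (rule Lim_transform_eventually)
      then show ?thesis unfolding True continuous_within by (simp only: fun_upd_same mult_zero_left)
    qed
  qed
qed

section \<open>Convolution with a holomorphic kernel\<close>

text \<open>The end point d is kept apart from the argument z of the kernel: for fixed d the
  integral is studied as a function of z near a boundary point, while d = z gives the
  convolution.\<close>

definition seg_int :: "complex \<Rightarrow> complex \<Rightarrow> (complex \<Rightarrow> complex) \<Rightarrow> (complex \<Rightarrow> complex) \<Rightarrow> complex \<Rightarrow> complex" where
  "seg_int c d k f z =
     integral {0..1} (\<lambda>s::real. (d - c) * k (z - (c + of_real s * (d - c))) * f (c + of_real s * (d - c)))"

text \<open>\<open>f\<close> is given on the strip only; at the base point it is replaced by its limit 0.\<close>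

definition volterra :: "complex \<Rightarrow> (complex \<Rightarrow> complex) \<Rightarrow> (complex \<Rightarrow> complex) \<Rightarrow> complex \<Rightarrow> complex" where
  "volterra A k f z = seg_int A z k (f(A := 0)) z"

lemma segment_in_convex:
  assumes "convex D" "c \<in> D" "d \<in> D" "s \<in> {0..1}"
  shows "c + of_real s * (d - c) \<in> (D :: complex set)"
proof -
  have "(1 - s) *\<^sub>R c + s *\<^sub>R d \<in> D"
    using assms by (intro convexD) auto
  then show ?thesis by (simp add: scaleR_conv_of_real algebra_simps)
qed

lemma exp_slit_scale: "z - c \<in> exp_slit \<Longrightarrow> s \<in> {0..1} \<Longrightarrow> z - (c + of_real s * (z - c)) \<in> exp_slit"
proof -
  assume a: "z - c \<in> exp_slit" "s \<in> {0..1}"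
  have eq: "z - (c + of_real s * (z - c)) = of_real (1 - s) * (z - c)" by (simp add: algebra_simps)
  have "of_real (1 - s) * (z - c) \<in> exp_slit"
    by (rule ray_in_convex[OF exp_slit_props(2,3) a(1)]) (use a in auto)
  then show ?thesis by (simp only: eq)
qed

lemma seg_int_integrand_continuous:
  assumes k: "k holomorphic_on exp_slit" and D: "convex D" "c \<in> D" "d \<in> D" and f: "continuous_on D f"
    and E: "\<And>s. s \<in> {0..1} \<Longrightarrow> z - (c + of_real s * (d - c)) \<in> exp_slit"
  shows "continuous_on {0..1} (\<lambda>s::real. (d - c) * k (z - (c + of_real s * (d - c))) * f (c + of_real s * (d - c)))"
proof (intro continuous_on_mult continuous_on_const)
  show "continuous_on {0..1} (\<lambda>s::real. k (z - (c + of_real s * (d - c))))"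
    by (rule continuous_on_compose2[OF holomorphic_on_imp_continuous_on[OF k]])
       (use E in \<open>auto intro!: continuous_intros\<close>)
  show "continuous_on {0..1} (\<lambda>s::real. f (c + of_real s * (d - c)))"
    by (rule continuous_on_compose2[OF f])
       (use segment_in_convex[OF D] in \<open>auto intro!: continuous_intros\<close>)
qed

text \<open>U is the open set on which f is differentiated and D adds the base point c, where f and
  f' are only continuous. There are two uses: the strip with an edge point adjoined, and a disc with
  U = D.\<close>

context
  fixes U D :: "complex set" and c :: complex and k f f' :: "complex \<Rightarrow> complex"
  assumes U: "open U" "convex U" "U \<subseteq> D" and D: "convex D" "c \<in> D"
    and ray: "\<And>z s. z \<in> U \<Longrightarrow> 0 < s \<Longrightarrow> s \<le> 1 \<Longrightarrow> c + of_real s * (z - c) \<in> U"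
    and E: "\<And>z. z \<in> U \<Longrightarrow> z - c \<in> exp_slit"
    and k: "k holomorphic_on exp_slit"
    and f: "continuous_on D f" "continuous_on D f'" "\<And>z. z \<in> U \<Longrightarrow> (f has_field_derivative f' z) (at z)"
begin

lemma kernel_deriv:
  "z \<in> exp_slit \<Longrightarrow> (k has_field_derivative deriv k z) (at z)" "deriv k holomorphic_on exp_slit"
  using k exp_slit_props holomorphic_derivI holomorphic_deriv by blast+

lemma seg_int_integrable:
  assumes "z \<in> U" "kk \<in> {k, deriv k}" "ff \<in> {f, f'}"
  shows "continuous_on {0..1} (\<lambda>s::real. (z - c) * kk (z - (c + of_real s * (z - c))) * ff (c + of_real s * (z - c)))"
proof (rule seg_int_integrand_continuous[OF _ D(1,2)])
  show "kk holomorphic_on exp_slit" using assms(2) k kernel_deriv(2) by auto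
  show "z \<in> D" using assms(1) U by blast
  show "continuous_on D ff" using assms(3) f by auto
  show "z - (c + of_real s * (z - c)) \<in> exp_slit" if "s \<in> {0..1}" for s
    by (rule exp_slit_scale[OF E[OF assms(1)] that])
qed

text \<open>With \<psi>(s) = k (z - x) f x at x = c + s (z - c), these are the integrals over [0, 1]
  of \<psi>' and of (s \<psi>)'. The first yields integration by parts, the second the derivative
  with respect to z.\<close>

lemma seg_int_boundary:
  assumes z: "z \<in> U"
  shows "((\<lambda>s::real. - ((z - c) * deriv k (z - (c + of_real s * (z - c))) * f (c + of_real s * (z - c)))
      + (z - c) * k (z - (c + of_real s * (z - c))) * f' (c + of_real s * (z - c))) has_integral
      k 0 * f z - k (z - c) * f c) {0..1}"
    and "((\<lambda>s::real. k (z - (c + of_real s * (z - c))) * f (c + of_real s * (z - c))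
      + of_real s * (- ((z - c) * deriv k (z - (c + of_real s * (z - c))) * f (c + of_real s * (z - c)))
      + (z - c) * k (z - (c + of_real s * (z - c))) * f' (c + of_real s * (z - c)))) has_integral
      k 0 * f z) {0..1}"
proof -
  define \<psi> where "\<psi> = (\<lambda>s::complex. k (z - (c + s * (z - c))) * f (c + s * (z - c)))"
  have zD: "z \<in> D" using z U by blast
  have cont: "continuous_on {0..1} (\<lambda>s::real. \<psi> (of_real s))"
    unfolding \<psi>_def
  proof (rule continuous_on_mult)
    show "continuous_on {0..1} (\<lambda>s::real. k (z - (c + of_real s * (z - c))))"
      by (rule continuous_on_compose2[OF holomorphic_on_imp_continuous_on[OF k]])
         (use exp_slit_scale[OF E[OF z]] in \<open>auto intro!: continuous_intros\<close>)
    show "continuous_on {0..1} (\<lambda>s::real. f (c + of_real s * (z - c)))"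
      by (rule continuous_on_compose2[OF f(1)])
         (use segment_in_convex[OF D zD] in \<open>auto intro!: continuous_intros\<close>)
  qed
  have d: "(\<psi> has_field_derivative - ((z - c) * deriv k (z - (c + of_real s * (z - c))) * f (c + of_real s * (z - c)))
      + (z - c) * k (z - (c + of_real s * (z - c))) * f' (c + of_real s * (z - c))) (at (of_real s))"
    if s: "s \<in> {0<..<1}" for s :: real
  proof -
    have 1: "((\<lambda>s. c + s * (z - c)) has_field_derivative (z - c)) (at (of_real s))"
      and 2: "((\<lambda>s. z - (c + s * (z - c))) has_field_derivative - (z - c)) (at (of_real s))"
      by (auto intro!: derivative_eq_intros)
    have "c + of_real s * (z - c) \<in> U" using ray[OF z] s by auto
    note 3 = DERIV_chain2[OF f(3)[OF this] 1]
    have "z - (c + of_real s * (z - c)) \<in> exp_slit" using exp_slit_scale[OF E[OF z]] s by auto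
    note 4 = DERIV_chain2[OF kernel_deriv(1)[OF this] 2]
    show ?thesis using DERIV_mult[OF 4 3] unfolding \<psi>_def by (simp add: algebra_simps)
  qed
  have "((\<lambda>s::real. - ((z - c) * deriv k (z - (c + of_real s * (z - c))) * f (c + of_real s * (z - c)))
      + (z - c) * k (z - (c + of_real s * (z - c))) * f' (c + of_real s * (z - c))) has_integral
      \<psi> (of_real 1) - \<psi> (of_real 0)) {0..1}"
    by (rule fundamental_theorem_of_calculus_interior[OF _ cont])
       (use has_vector_derivative_real_field[OF d] in auto)
  then show "((\<lambda>s::real. - ((z - c) * deriv k (z - (c + of_real s * (z - c))) * f (c + of_real s * (z - c)))
      + (z - c) * k (z - (c + of_real s * (z - c))) * f' (c + of_real s * (z - c))) has_integral
      k 0 * f z - k (z - c) * f c) {0..1}"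
    by (simp add: \<psi>_def)
  have cont': "continuous_on {0..1} (\<lambda>s::real. of_real s * \<psi> (of_real s))"
    by (intro continuous_on_mult cont continuous_intros)
  have "((\<lambda>s::real. \<psi> (of_real s) + of_real s * (- ((z - c) * deriv k (z - (c + of_real s * (z - c))) * f (c + of_real s * (z - c)))
      + (z - c) * k (z - (c + of_real s * (z - c))) * f' (c + of_real s * (z - c)))) has_integral
      of_real 1 * \<psi> (of_real 1) - of_real 0 * \<psi> (of_real 0)) {0..1}"
  proof (rule fundamental_theorem_of_calculus_interior[OF _ cont'])
    fix s :: real assume s: "s \<in> {0<..<1}"
    have "((\<lambda>s. s * \<psi> s) has_field_derivative (\<psi> (of_real s) + of_real s * (- ((z - c) * deriv k (z - (c + of_real s * (z - c))) * f (c + of_real s * (z - c)))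
      + (z - c) * k (z - (c + of_real s * (z - c))) * f' (c + of_real s * (z - c))))) (at (of_real s))"
      using DERIV_mult[OF DERIV_ident d[OF s]] by (simp add: add.commute mult.commute)
    then show "((\<lambda>s::real. of_real s * \<psi> (of_real s)) has_vector_derivative (\<psi> (of_real s) + of_real s * (- ((z - c) * deriv k (z - (c + of_real s * (z - c))) * f (c + of_real s * (z - c)))
      + (z - c) * k (z - (c + of_real s * (z - c))) * f' (c + of_real s * (z - c))))) (at s)"
      by (rule has_vector_derivative_real_field)
  qed simp
  then show "((\<lambda>s::real. k (z - (c + of_real s * (z - c))) * f (c + of_real s * (z - c))
      + of_real s * (- ((z - c) * deriv k (z - (c + of_real s * (z - c))) * f (c + of_real s * (z - c)))
      + (z - c) * k (z - (c + of_real s * (z - c))) * f' (c + of_real s * (z - c)))) has_integral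
      k 0 * f z) {0..1}"
    by (simp add: \<psi>_def)
qed

lemma seg_int_by_parts:
  assumes z: "z \<in> U"
  shows "seg_int c z k f' z = k 0 * f z - k (z - c) * f c + seg_int c z (deriv k) f z"
proof -
  have i: "((\<lambda>s::real. (z - c) * deriv k (z - (c + of_real s * (z - c))) * f (c + of_real s * (z - c)))
      has_integral seg_int c z (deriv k) f z) {0..1}"
    unfolding seg_int_def
    by (rule integrable_integral[OF integrable_continuous_real[OF seg_int_integrable[OF z]]]) auto
  from has_integral_add[OF seg_int_boundary(1)[OF z] i]
  have "((\<lambda>s::real. (z - c) * k (z - (c + of_real s * (z - c))) * f' (c + of_real s * (z - c))) has_integral
      k 0 * f z - k (z - c) * f c + seg_int c z (deriv k) f z) {0..1}"
    by (rule has_integral_eq[rotated]) simp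
  then show ?thesis unfolding seg_int_def[of _ _ _ f'] by (rule integral_unique)
qed

text \<open>On the fixed parameter interval both k and f depend on z. The z-derivative of the
  integrand is the s-derivative of s \<psi>(s) plus the integrand with k' in place of k.\<close>

lemma seg_int_has_derivative:
  assumes z: "z \<in> U"
  shows "((\<lambda>z. seg_int c z k f z) has_field_derivative k 0 * f z + seg_int c z (deriv k) f z) (at z)"
proof -
  define F where "F = (\<lambda>(z::complex) (s::real). (z - c) * k (z - (c + of_real s * (z - c))) * f (c + of_real s * (z - c)))"
  define F' where "F' = (\<lambda>(z::complex) (s::real). k (z - (c + of_real s * (z - c))) * f (c + of_real s * (z - c))
      + (z - c) * ((1 - of_real s) * deriv k (z - (c + of_real s * (z - c)))) * f (c + of_real s * (z - c))
      + (z - c) * k (z - (c + of_real s * (z - c))) * (of_real s * f' (c + of_real s * (z - c))))"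
  have "((\<lambda>z. integral (cbox 0 1) (F z)) has_field_derivative integral (cbox 0 1) (F' z)) (at z within U)"
  proof (rule leibniz_rule_field_derivative)
    fix x and s :: real assume x: "x \<in> U" and "s \<in> cbox 0 1"
    then have s: "s \<in> {0..1}" by simp
    have 1: "((\<lambda>z. c + of_real s * (z - c)) has_field_derivative of_real s) (at x)"
      and 2: "((\<lambda>z. z - (c + of_real s * (z - c))) has_field_derivative 1 - of_real s) (at x)"
      by (auto intro!: derivative_eq_intros)
    have 3: "((\<lambda>z. f (c + of_real s * (z - c))) has_field_derivative of_real s * f' (c + of_real s * (x - c))) (at x)"
    proof (cases "s = 0")
      case False
      then have "c + of_real s * (x - c) \<in> U" using ray[OF x] s by auto
      from DERIV_chain2[OF f(3)[OF this] 1] show ?thesis by (simp only: mult.commute)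
    qed simp
    have "x - (c + of_real s * (x - c)) \<in> exp_slit" using exp_slit_scale[OF E[OF x] s] .
    note 4 = DERIV_chain2[OF kernel_deriv(1)[OF this] 2]
    have 5: "((\<lambda>z. z - c) has_field_derivative 1) (at x)" by (auto intro!: derivative_eq_intros)
    have "((\<lambda>z. F z s) has_field_derivative F' x s) (at x)"
      using DERIV_mult[OF DERIV_mult[OF 5 4] 3] unfolding F_def F'_def by (simp add: algebra_simps)
    then show "((\<lambda>z. F z s) has_field_derivative F' x s) (at x within U)" by (rule has_field_derivative_at_within)
  next
    fix x assume x: "x \<in> U"
    show "F x integrable_on cbox 0 1"
      using integrable_continuous_real[OF seg_int_integrable[OF x, of k f]] by (simp add: F_def)
  next
    have ck: "continuous_on (U \<times> cbox 0 1) (\<lambda>p. kk (fst p - (c + of_real (snd p) * (fst p - c))))"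
      if "kk holomorphic_on exp_slit" for kk
      by (rule continuous_on_compose2[OF holomorphic_on_imp_continuous_on[OF that]])
         (use exp_slit_scale[OF E] in \<open>auto intro!: continuous_intros\<close>)
    have cf: "continuous_on (U \<times> cbox 0 1) (\<lambda>p. ff (c + of_real (snd p) * (fst p - c)))"
      if "continuous_on D ff" for ff :: "complex \<Rightarrow> complex"
      by (rule continuous_on_compose2[OF that])
         (use segment_in_convex[OF D] U(3) in \<open>auto intro!: continuous_intros\<close>)
    show "continuous_on (U \<times> cbox 0 1) (\<lambda>(x, s). F' x s)"
      unfolding F'_def case_prod_beta
      by (intro continuous_on_add continuous_on_mult ck cf k kernel_deriv(2) f) (intro continuous_intros)+
  qed (use z U in auto)
  then have d: "((\<lambda>z. seg_int c z k f z) has_field_derivative integral {0..1} (F' z)) (at z)"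
    using at_within_open[OF z U(1)] by (simp add: seg_int_def F_def)
  have i: "((\<lambda>s::real. (z - c) * deriv k (z - (c + of_real s * (z - c))) * f (c + of_real s * (z - c)))
      has_integral seg_int c z (deriv k) f z) {0..1}"
    unfolding seg_int_def
    by (rule integrable_integral[OF integrable_continuous_real[OF seg_int_integrable[OF z]]]) auto
  from has_integral_add[OF seg_int_boundary(2)[OF z] i]
  have "(F' z has_integral k 0 * f z + seg_int c z (deriv k) f z) {0..1}"
    by (rule has_integral_eq[rotated]) (simp add: F'_def algebra_simps)
  from integral_unique[OF this] d show ?thesis by simp
qed

end

text \<open>The integrand has a primitive on the convex set D even though f is merely continuous at
  c: one exceptional point does no harm to Cauchy's theorem. All three integrals are then
  differences of values of that primitive.\<close>

lemma seg_int_split: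
  assumes D: "convex D" "c \<in> D" "d \<in> D" "z \<in> D" and f: "continuous_on D f" "f holomorphic_on interior D - {c}"
    and k: "k holomorphic_on exp_slit" and E: "\<And>x. x \<in> D \<Longrightarrow> z - x \<in> exp_slit"
  shows "seg_int c z k f z = seg_int c d k f z + seg_int d z k f z"
proof -
  have kc: "continuous_on D (\<lambda>x. k (z - x))"
    by (rule continuous_on_compose2[OF holomorphic_on_imp_continuous_on[OF k]])
       (use E in \<open>auto intro!: continuous_intros\<close>)
  have "(k \<circ> (\<lambda>x. z - x)) holomorphic_on interior D - {c}"
    by (rule holomorphic_on_compose_gen[OF _ k]) (use E interior_subset in \<open>auto intro!: holomorphic_intros\<close>)
  then have hol: "(\<lambda>x. k (z - x) * f x) holomorphic_on interior D - {c}"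
    unfolding o_def by (intro holomorphic_on_mult f)
  obtain g where g: "\<And>x. x \<in> D \<Longrightarrow> (g has_field_derivative k (z - x) * f x) (at x within D)"
  proof (rule holomorphic_convex_primitive[OF D(1), of "{c}" "\<lambda>x. k (z - x) * f x"])
    show "continuous_on D (\<lambda>x. k (z - x) * f x)" by (intro continuous_on_mult kc f)
    show "(\<lambda>x. k (z - x) * f x) field_differentiable at x" if "x \<in> interior D - {c}" for x
      by (rule holomorphic_on_imp_differentiable_at[OF hol _ that]) auto
  qed auto
  have eq: "seg_int u v k f z = g v - g u" if uv: "u \<in> D" "v \<in> D" for u v
  proof -
    have "((\<lambda>s::real. (v - u) * k (z - (u + of_real s * (v - u))) * f (u + of_real s * (v - u)))
       has_integral g (u + of_real 1 * (v - u)) - g (u + of_real 0 * (v - u))) {0..1}"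
    proof (rule fundamental_theorem_of_calculus)
      fix s :: real assume s: "s \<in> {0..1}"
      have *: "(\<lambda>s::real. u + of_real s * (v - u)) ` {0..1} \<subseteq> D"
        using segment_in_convex[OF D(1) uv] by auto
      have 1: "((\<lambda>s::real. u + of_real s * (v - u)) has_vector_derivative (v - u)) (at s within {0..1})"
        by (rule has_vector_derivative_eq_rhs, (rule derivative_intros)+) auto
      have "(g has_field_derivative k (z - (u + of_real s * (v - u))) * f (u + of_real s * (v - u)))
         (at (u + of_real s * (v - u)) within (\<lambda>s::real. u + of_real s * (v - u)) ` {0..1})"
        by (rule DERIV_subset[OF g[OF segment_in_convex[OF D(1) uv s]] *])
      from field_vector_diff_chain_within[OF 1 this]
      show "((\<lambda>s::real. g (u + of_real s * (v - u))) has_vector_derivative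
          (v - u) * k (z - (u + of_real s * (v - u))) * f (u + of_real s * (v - u))) (at s within {0..1})"
        by (simp add: o_def mult.assoc)
    qed simp
    from integral_unique[OF this] show ?thesis by (simp add: seg_int_def)
  qed
  show ?thesis using D by (simp add: eq)
qed

lemma seg_int_holomorphic:
  assumes U: "open U" "convex U" and D: "convex D" "c \<in> D" "d \<in> D" and f: "continuous_on D f"
    and k: "k holomorphic_on exp_slit" and E: "\<And>z x. z \<in> U \<Longrightarrow> x \<in> closed_segment c d \<Longrightarrow> z - x \<in> exp_slit"
  shows "seg_int c d k f holomorphic_on U"
proof -
  define F where "F = (\<lambda>(z::complex) (s::real). (d - c) * k (z - (c + of_real s * (d - c))) * f (c + of_real s * (d - c)))"
  define F' where "F' = (\<lambda>(z::complex) (s::real). (d - c) * deriv k (z - (c + of_real s * (d - c))) * f (c + of_real s * (d - c)))"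
  have seg: "c + of_real s * (d - c) \<in> closed_segment c d" if "s \<in> {0..1}" for s
    by (rule segment_in_convex) (use that in auto)
  have k': "z \<in> exp_slit \<Longrightarrow> (k has_field_derivative deriv k z) (at z)" "deriv k holomorphic_on exp_slit" for z
    using k exp_slit_props holomorphic_derivI holomorphic_deriv by blast+
  have "(\<lambda>z. integral (cbox 0 1) (F z)) holomorphic_on U"
  proof (rule leibniz_rule_holomorphic)
    fix x and s :: real assume x: "x \<in> U" and "s \<in> cbox 0 1"
    then have s: "s \<in> {0..1}" by simp
    have 2: "((\<lambda>z. z - (c + of_real s * (d - c))) has_field_derivative 1) (at x)"
      by (auto intro!: derivative_eq_intros)
    note 4 = DERIV_chain2[OF k'(1)[OF E[OF x seg[OF s]]] 2]
    have "((\<lambda>z. F z s) has_field_derivative F' x s) (at x)"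
      unfolding F_def F'_def using DERIV_cmult_right[OF DERIV_cmult[OF 4]] by simp
    then show "((\<lambda>z. F z s) has_field_derivative F' x s) (at x within U)" by (rule has_field_derivative_at_within)
  next
    fix x assume x: "x \<in> U"
    show "F x integrable_on cbox 0 1"
      using integrable_continuous_real[OF seg_int_integrand_continuous[OF k D f E[OF x seg]]] by (simp add: F_def)
  next
    have ck: "continuous_on (U \<times> cbox 0 1) (\<lambda>p. deriv k (fst p - (c + of_real (snd p) * (d - c))))"
      by (rule continuous_on_compose2[OF holomorphic_on_imp_continuous_on[OF k'(2)]])
         (use E[OF _ seg] in \<open>auto intro!: continuous_intros\<close>)
    have cf: "continuous_on (U \<times> cbox 0 1) (\<lambda>p. f (c + of_real (snd p) * (d - c)))"
      by (rule continuous_on_compose2[OF f])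
         (use segment_in_convex[OF D] in \<open>auto intro!: continuous_intros\<close>)
    show "continuous_on (U \<times> cbox 0 1) (\<lambda>(x, s). F' x s)"
      unfolding F'_def case_prod_beta by (intro continuous_on_mult continuous_on_const ck cf)
  qed (rule U(2))
  then show ?thesis by (simp add: seg_int_def[abs_def] F_def)
qed

lemma volterra_cong:
  assumes A: "edge_point a b A" and z: "z \<in> strip a b" and fg: "\<And>x. x \<in> strip a b \<Longrightarrow> f x = g x"
    and kl: "\<And>x. x \<in> exp_slit \<Longrightarrow> k x = l x"
  shows "volterra A k f z = volterra A l g z"
  unfolding volterra_def seg_int_def
proof (rule integral_cong)
  fix s :: real assume s: "s \<in> {0..1}"
  have "k (z - (A + of_real s * (z - A))) = l (z - (A + of_real s * (z - A)))"
    by (rule kl[OF exp_slit_scale[OF edge_point_exp_slit[OF A z] s]])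
  moreover have "(f(A := 0)) (A + of_real s * (z - A)) = (g(A := 0)) (A + of_real s * (z - A))"
  proof (cases "s = 0")
    case False
    then have "A + of_real s * (z - A) \<in> strip a b" using edge_point_ray[OF A z] s by auto
    then show ?thesis using fg by simp
  qed simp
  ultimately show "(z - A) * k (z - (A + of_real s * (z - A))) * (f(A := 0)) (A + of_real s * (z - A))
     = (z - A) * l (z - (A + of_real s * (z - A))) * (g(A := 0)) (A + of_real s * (z - A))" by simp
qed

lemma volterra_integrand:
  assumes A: "edge_point a b A" and z: "z \<in> strip a b" and f: "f holomorphic_on strip a b" "branch_at A (strip a b) e f L" "Re e > 0"
    and k: "k holomorphic_on exp_slit"
  shows "(\<lambda>s::real. (z - A) * k (z - (A + of_real s * (z - A))) * (f(A := 0)) (A + of_real s * (z - A))) integrable_on {0..1}"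
  by (rule integrable_continuous_real[OF seg_int_integrand_continuous[OF k edge_point_convex[OF A] _ _ branch_at_continuous[OF A f]
       exp_slit_scale[OF edge_point_exp_slit[OF A z]]]]) (use z in auto)

lemma volterra_add:
  assumes A: "edge_point a b A" and z: "z \<in> strip a b" and k: "k holomorphic_on exp_slit"
    and f: "f holomorphic_on strip a b" "branch_at A (strip a b) e f L" "Re e > 0"
    and g: "g holomorphic_on strip a b" "branch_at A (strip a b) e' g L'" "Re e' > 0"
  shows "volterra A k (\<lambda>x. f x + g x) z = volterra A k f z + volterra A k g z"
  unfolding volterra_def seg_int_def
  by (subst integral_add[symmetric, OF volterra_integrand[OF A z f k] volterra_integrand[OF A z g k]])
     (rule integral_cong, auto simp: algebra_simps)

lemma volterra_cmult: "volterra A k (\<lambda>x. c * f x) z = c * volterra A k f z"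
proof -
  have "(\<lambda>x. c * f x)(A := 0) = (\<lambda>x. c * (f(A := 0)) x)" by auto
  then show ?thesis unfolding volterra_def seg_int_def
    by (subst integral_mult_right[symmetric]) (simp only: mult_ac)
qed

lemma volterra_sum:
  assumes A: "edge_point a b A" and z: "z \<in> strip a b" and k: "k holomorphic_on exp_slit"
    and f: "\<And>i. i \<in> I \<Longrightarrow> f i holomorphic_on strip a b" "\<And>i. i \<in> I \<Longrightarrow> branch_at A (strip a b) e (f i) (L i)" "Re e > 0"
  shows "volterra A k (\<lambda>x. \<Sum>i\<in>I. f i x) z = (\<Sum>i\<in>I. volterra A k (f i) z)"
  using f(1,2)
proof (induction I rule: infinite_finite_induct)
  case (insert i I)
  have "volterra A k (\<lambda>x. f i x + (\<Sum>i\<in>I. f i x)) z = volterra A k (f i) z + volterra A k (\<lambda>x. \<Sum>i\<in>I. f i x) z"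
    using insert.prems f(3)
    by (intro volterra_add[OF A z k]) (auto intro!: holomorphic_intros branch_at_sum)
  with insert show ?case by simp
qed (simp_all add: volterra_def seg_int_def fun_upd_def)

lemma volterra_kernel_add:
  assumes A: "edge_point a b A" and z: "z \<in> strip a b" and k: "k holomorphic_on exp_slit" "l holomorphic_on exp_slit"
    and f: "f holomorphic_on strip a b" "branch_at A (strip a b) e f L" "Re e > 0"
  shows "volterra A (\<lambda>x. k x + l x) f z = volterra A k f z + volterra A l f z"
  unfolding volterra_def seg_int_def
  by (subst integral_add[symmetric, OF volterra_integrand[OF A z f k(1)] volterra_integrand[OF A z f k(2)]])
     (rule integral_cong, auto simp: algebra_simps)

lemma volterra_kernel_cmult: "volterra A (\<lambda>x. c * k x) f z = c * volterra A k f z"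
  unfolding volterra_def seg_int_def
  by (subst integral_mult_right[symmetric]) (simp only: mult_ac)

text \<open>Since e^{z-s} e^s = e^z, multiplication by e^z can be moved through the convolution at
  the price of a factor e^z in the kernel. For this reason two kernels occur side by side, k and e^z
  k.\<close>

lemma volterra_exp:
  "volterra A (\<lambda>x. exp x * k x) (\<lambda>x. exp x * f x) z = exp z * volterra A k f z"
proof -
  have upd: "(\<lambda>x. exp x * f x)(A := 0) = (\<lambda>x. exp x * (f(A := 0)) x)" by auto
  have "(z - A) * (exp (z - x) * k (z - x)) * (exp x * y) = exp z * ((z - A) * k (z - x) * y)" for x y
  proof -
    have "(z - A) * (exp (z - x) * k (z - x)) * (exp x * y) = (exp (z - x) * exp x) * ((z - A) * k (z - x) * y)"
      by (simp only: mult_ac)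
    then show ?thesis by (simp only: exp_add[symmetric] diff_add_cancel)
  qed
  then show ?thesis unfolding volterra_def seg_int_def upd
    by (subst integral_mult_right[symmetric]) (rule integral_cong)
qed

text \<open>Re e > 1 is one more than convergence asks for: the derivative of f, which has exponent
  e - 1, is to vanish at A too.\<close>

context
  fixes a b :: real and A e L :: complex and k f :: "complex \<Rightarrow> complex"
  assumes A: "edge_point a b A" and k: "k holomorphic_on exp_slit"
    and f: "f holomorphic_on strip a b" "branch_at A (strip a b) e f L" "Re e > 1"
begin

lemma volterra_setup:
  "continuous_on (insert A (strip a b)) (f(A := 0))"
  "continuous_on (insert A (strip a b)) ((deriv f)(A := 0))"
  "\<And>z. z \<in> strip a b \<Longrightarrow> (f(A := 0) has_field_derivative ((deriv f)(A := 0)) z) (at z)"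
proof -
  show "continuous_on (insert A (strip a b)) (f(A := 0))"
    by (rule branch_at_continuous[OF A f(1,2)]) (use f(3) in auto)
  show "continuous_on (insert A (strip a b)) ((deriv f)(A := 0))"
    by (rule branch_at_continuous[OF A holomorphic_deriv[OF f(1) strip_open] branch_at_deriv[OF A f(2)]]) (use f(3) in auto)
  fix z assume z: "z \<in> strip a b"
  have zA: "x \<noteq> A" if "x \<in> strip a b" for x using edge_point_notin[OF A] that by blast
  have "(f has_field_derivative deriv f z) (at z)" by (rule holomorphic_derivI[OF f(1) strip_open z])
  then have "(f(A := 0) has_field_derivative deriv f z) (at z)"
    by (rule has_field_derivative_transform_within_open[OF _ strip_open z]) (simp add: zA)
  then show "(f(A := 0) has_field_derivative ((deriv f)(A := 0)) z) (at z)" by (simp add: zA[OF z])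
qed

lemma volterra_has_derivative:
  assumes z: "z \<in> strip a b"
  shows "(volterra A k f has_field_derivative k 0 * f z + volterra A (deriv k) f z) (at z)"
proof -
  have "((\<lambda>z. seg_int A z k (f(A := 0)) z) has_field_derivative k 0 * (f(A := 0)) z + seg_int A z (deriv k) (f(A := 0)) z) (at z)"
    by (rule seg_int_has_derivative[OF strip_open strip_convex _ edge_point_convex[OF A] _ edge_point_ray[OF A]
         edge_point_exp_slit[OF A] k volterra_setup z]) auto
  moreover have "z \<noteq> A" using edge_point_notin[OF A] z by blast
  ultimately show ?thesis by (simp add: volterra_def[abs_def])
qed

lemma volterra_by_parts:
  assumes z: "z \<in> strip a b"
  shows "volterra A k (deriv f) z = k 0 * f z + volterra A (deriv k) f z"
proof -
  have "seg_int A z k ((deriv f)(A := 0)) z = k 0 * (f(A := 0)) z - k (z - A) * (f(A := 0)) A + seg_int A z (deriv k) (f(A := 0)) z"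
    by (rule seg_int_by_parts[OF strip_open strip_convex _ edge_point_convex[OF A] _ edge_point_ray[OF A]
         edge_point_exp_slit[OF A] k volterra_setup z]) auto
  moreover have "z \<noteq> A" using edge_point_notin[OF A] z by blast
  ultimately show ?thesis by (simp add: volterra_def)
qed

lemma volterra_holomorphic: "volterra A k f holomorphic_on strip a b"
  unfolding holomorphic_on_open[OF strip_open] using volterra_has_derivative by blast

text \<open>Along the ray to z the power factors as s^e (z - A)^e, because s is a nonnegative real.
  What is left is the integral of k((1 - s)(z - A)) s^e G(A + s(z - A)) over [0, 1], which is
  holomorphic in z on a full disc about A; the differential of the path supplies the extra factor z
  - A.\<close>

lemma volterra_branch_exists: "\<exists>L'. branch_at A (strip a b) (e + 1) (volterra A k f) L'"
proof -
  obtain \<epsilon>0 G where G: "\<epsilon>0 > 0" "G holomorphic_on ball A \<epsilon>0" "G A = L" "\<And>z. z \<in> strip a b \<inter> ball A \<epsilon>0 \<Longrightarrow> f z = (z - A) powr e * G z"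
    using f(2) unfolding branch_at_def by blast
  define \<epsilon> where "\<epsilon> = min \<epsilon>0 1"
  have \<epsilon>: "\<epsilon> > 0" "ball A \<epsilon> \<subseteq> ball A \<epsilon>0" using G by (auto simp: \<epsilon>_def)
  have slit: "z - A \<in> exp_slit" if "z \<in> ball A \<epsilon>" for z
  proof -
    have "\<bar>Im (z - A)\<bar> \<le> cmod (z - A)" by (rule abs_Im_le_cmod)
    also have "\<dots> < 1" using that by (simp add: \<epsilon>_def dist_norm norm_minus_commute)
    finally show ?thesis using pi_gt3 by (simp add: exp_slit_def)
  qed
  have Gh: "G holomorphic_on ball A \<epsilon>" by (rule holomorphic_on_subset[OF G(2) \<epsilon>(2)])
  have G'h: "deriv G holomorphic_on ball A \<epsilon>" by (rule holomorphic_deriv[OF Gh open_ball])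
  have k': "z \<in> exp_slit \<Longrightarrow> (k has_field_derivative deriv k z) (at z)" "deriv k holomorphic_on exp_slit" for z
    using k exp_slit_props holomorphic_derivI holomorphic_deriv by blast+
  have seg: "A + of_real s * (z - A) \<in> ball A \<epsilon>" if "z \<in> ball A \<epsilon>" "s \<in> {0..1}" for z s
    by (rule segment_in_convex) (use that \<epsilon> in auto)
  define F where "F = (\<lambda>(z::complex) (s::real). k (z - (A + of_real s * (z - A))) * (of_real s powr e * G (A + of_real s * (z - A))))"
  define F' where "F' = (\<lambda>(z::complex) (s::real). (deriv k (z - (A + of_real s * (z - A))) * (1 - of_real s)) * (of_real s powr e * G (A + of_real s * (z - A)))
     + k (z - (A + of_real s * (z - A))) * (of_real s powr e * (deriv G (A + of_real s * (z - A)) * of_real s)))"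
  \<comment> \<open>Re e > 0 makes s^e continuous at s = 0 as well, where \<open>powr\<close> takes
    the value 0.\<close>
  have cp: "continuous_on {0..1} (\<lambda>s::real. complex_of_real s powr e)"
    unfolding continuous_on_def
  proof
    fix s :: real assume s: "s \<in> {0..1}"
    show "((\<lambda>s::real. complex_of_real s powr e) \<longlongrightarrow> complex_of_real s powr e) (at s within {0..1})"
    proof (cases "s = 0")
      case True
      have "((\<lambda>s::real. complex_of_real s powr e) \<longlongrightarrow> 0) (at s within {0..1})"
        by (rule tendsto_powr_complex_0) (use True f(3) in \<open>auto intro!: tendsto_eq_intros\<close>)
      then show ?thesis using True by simp
    next
      case False
      then show ?thesis
        by (intro tendsto_powr_complex) (use s in \<open>auto intro!: tendsto_eq_intros simp: complex_nonpos_Reals_iff\<close>)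
    qed
  qed
  have ck: "continuous_on (ball A \<epsilon> \<times> {0..1}) (\<lambda>p. kk (fst p - (A + of_real (snd p) * (fst p - A))))"
    if "kk holomorphic_on exp_slit" for kk
    by (rule continuous_on_compose2[OF holomorphic_on_imp_continuous_on[OF that]])
       (use exp_slit_scale[OF slit] in \<open>auto intro!: continuous_intros\<close>)
  have cf: "continuous_on (ball A \<epsilon> \<times> {0..1}) (\<lambda>p. ff (A + of_real (snd p) * (fst p - A)))"
    if "ff holomorphic_on ball A \<epsilon>" for ff :: "complex \<Rightarrow> complex"
    by (rule continuous_on_compose2[OF holomorphic_on_imp_continuous_on[OF that]])
       (use seg in \<open>auto intro!: continuous_intros\<close>)
  have cp2: "continuous_on (ball A \<epsilon> \<times> {0..1}) (\<lambda>p. complex_of_real (snd p) powr e)"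
    by (rule continuous_on_compose2[OF cp]) (auto intro!: continuous_intros)
  have "(\<lambda>z. integral (cbox 0 1) (F z)) holomorphic_on ball A \<epsilon>"
  proof (rule leibniz_rule_holomorphic)
    fix x and s :: real assume x: "x \<in> ball A \<epsilon>" and "s \<in> cbox 0 1"
    then have s: "s \<in> {0..1}" by simp
    have 1: "((\<lambda>z. A + of_real s * (z - A)) has_field_derivative of_real s) (at x)"
      and 2: "((\<lambda>z. z - (A + of_real s * (z - A))) has_field_derivative 1 - of_real s) (at x)"
      by (auto intro!: derivative_eq_intros)
    note 3 = DERIV_chain2[OF holomorphic_derivI[OF Gh open_ball seg[OF x s]] 1]
    note 4 = DERIV_chain2[OF k'(1)[OF exp_slit_scale[OF slit[OF x] s]] 2]
    have "((\<lambda>z. F z s) has_field_derivative F' x s) (at x)"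
      unfolding F_def
      by (rule DERIV_cong[OF DERIV_mult[OF 4 DERIV_cmult[OF 3, of "of_real s powr e"]]]) (simp add: F'_def mult_ac)
    then show "((\<lambda>z. F z s) has_field_derivative F' x s) (at x within ball A \<epsilon>)" by (rule has_field_derivative_at_within)
  next
    fix x assume x: "x \<in> ball A \<epsilon>"
    have "continuous_on {0..1} (\<lambda>s. (\<lambda>p. F (fst p) (snd p)) (x, s))"
      by (rule continuous_on_compose2[of "ball A \<epsilon> \<times> {0..1}"])
         (use x in \<open>auto simp: F_def intro!: continuous_on_mult ck cf cp2 k Gh continuous_intros\<close>)
    then show "F x integrable_on cbox 0 1" by (simp add: integrable_continuous_real)
  next
    show "continuous_on (ball A \<epsilon> \<times> cbox 0 1) (\<lambda>(x, s). F' x s)"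
      unfolding F'_def case_prod_beta box_real
      by (intro continuous_on_add continuous_on_mult ck cf cp2 k k'(2) Gh G'h) (intro continuous_intros)+
  qed auto
  then have H: "(\<lambda>z. integral {0..1} (F z)) holomorphic_on ball A \<epsilon>" by simp
  have "volterra A k f z = (z - A) powr (e + 1) * integral {0..1} (F z)" if z: "z \<in> strip a b \<inter> ball A \<epsilon>" for z
  proof -
    have zs: "z \<in> strip a b" "z \<in> ball A \<epsilon>" using z by auto
    have "(z - A) * k (z - (A + of_real s * (z - A))) * (f(A := 0)) (A + of_real s * (z - A))
       = (z - A) powr (e + 1) * F z s" if s: "s \<in> {0..1}" for s :: real
    proof (cases "s = 0")
      case False
      then have 1: "A + of_real s * (z - A) \<in> strip a b" using edge_point_ray[OF A zs(1)] s by auto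
      then have 2: "A + of_real s * (z - A) \<noteq> A" using edge_point_notin[OF A] by auto
      have "f (A + of_real s * (z - A)) = (of_real s * (z - A)) powr e * G (A + of_real s * (z - A))"
        using G(4)[of "A + of_real s * (z - A)"] 1 seg[OF zs(2) s] \<epsilon> by auto
      moreover have "(of_real s * (z - A)) powr e = of_real s powr e * (z - A) powr e"
        by (rule powr_times_real_left) (use s in auto)
      moreover have "(z - A) powr (e + 1) = (z - A) powr e * (z - A)"
        using edge_point_neq[OF A zs(1)] by (simp add: powr_add)
      ultimately show ?thesis using 2 by (simp add: F_def)
    qed (simp add: F_def)
    then have "volterra A k f z = integral {0..1} (\<lambda>s. (z - A) powr (e + 1) * F z s)"
      unfolding volterra_def seg_int_def by (intro integral_cong)
    then show ?thesis by simp
  qed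
  then show ?thesis unfolding branch_at_def using \<epsilon>(1) H by blast
qed

end

text \<open>The coefficient is found by differentiating instead of evaluating a Beta integral: in
  the derivative the term with kernel k' has exponent e + 1, so the coefficient at exponent e is
  that of k(0) f alone.\<close>

lemma volterra_branch:
  assumes A: "edge_point a b A" and k: "k holomorphic_on exp_slit"
    and f: "f holomorphic_on strip a b" "branch_at A (strip a b) e f L" "Re e > 1"
  shows "branch_at A (strip a b) (e + 1) (volterra A k f) (k 0 * L / (e + 1))"
proof -
  note An = edge_point_notin[OF A]
  have k': "deriv k holomorphic_on exp_slit" by (rule holomorphic_deriv[OF k exp_slit_props(1)])
  obtain L1 where L1: "branch_at A (strip a b) (e + 1) (volterra A k f) L1"
    using volterra_branch_exists[OF A k f] by blast
  obtain L2 where L2: "branch_at A (strip a b) (e + 1) (volterra A (deriv k) f) L2"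
    using volterra_branch_exists[OF A k' f] by blast
  have "branch_at A (strip a b) e (\<lambda>z. k 0 * f z + volterra A (deriv k) f z) (k 0 * L + 0)"
    using branch_at_lower[OF L2 An] by (intro branch_at_add branch_at_cmult f An) simp
  then have "branch_at A (strip a b) e (deriv (volterra A k f)) (k 0 * L + 0)"
    by (rule branch_at_cong) (rule DERIV_imp_deriv[OF volterra_has_derivative[OF A k f], symmetric])
  moreover have "branch_at A (strip a b) e (deriv (volterra A k f)) ((e + 1) * L1)"
    using branch_at_deriv[OF A L1] by simp
  ultimately have "k 0 * L + 0 = (e + 1) * L1" by (rule branch_at_unique[OF A])
  moreover have "e + 1 \<noteq> 0" using f(3) by (auto simp: complex_eq_iff)
  ultimately have "L1 = k 0 * L / (e + 1)" by (simp add: field_simps)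
  then show ?thesis using L1 by simp
qed

section \<open>Change of the base point of a convolution\<close>

lemma seg_int_cong:
  assumes "\<And>x. x \<in> closed_segment c d \<Longrightarrow> f x = g x"
  shows "seg_int c d k f z = seg_int c d k g z"
  unfolding seg_int_def
proof (rule integral_cong)
  fix s :: real assume s: "s \<in> {0..1}"
  have "c + of_real s * (d - c) \<in> closed_segment c d"
    by (rule segment_in_convex) (use s in auto)
  then show "(d - c) * k (z - (c + of_real s * (d - c))) * f (c + of_real s * (d - c))
      = (d - c) * k (z - (c + of_real s * (d - c))) * g (c + of_real s * (d - c))" by (simp add: assms)
qed

lemma seg_int_add_sum:
  fixes f :: "complex \<Rightarrow> complex" and g :: "'i \<Rightarrow> complex \<Rightarrow> complex"
  assumes k: "k holomorphic_on exp_slit" and D: "convex D" "c \<in> D" "d \<in> D" and f: "continuous_on D f"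
    and g: "\<And>i. i \<in> I \<Longrightarrow> continuous_on D (g i)" and I: "finite I"
    and E: "\<And>s. s \<in> {0..1} \<Longrightarrow> z - (c + of_real s * (d - c)) \<in> exp_slit"
  shows "seg_int c d k (\<lambda>x. f x + (\<Sum>i\<in>I. C i * g i x)) z = seg_int c d k f z + (\<Sum>i\<in>I. C i * seg_int c d k (g i) z)"
proof -
  let ?q = "\<lambda>h s. (d - c) * k (z - (c + of_real s * (d - c))) * h (c + of_real s * (d - c))"
  have i1: "?q f integrable_on {0..1}"
    by (rule integrable_continuous_real[OF seg_int_integrand_continuous[OF k D f E]])
  have i2: "(\<lambda>s. C i * ?q (g i) s) integrable_on {0..1}" if "i \<in> I" for i
    by (rule integrable_on_mult_right)
       (rule integrable_continuous_real[OF seg_int_integrand_continuous[OF k D g[OF that] E]])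
  have i3: "(\<lambda>s. \<Sum>i\<in>I. C i * ?q (g i) s) integrable_on {0..1}" by (rule integrable_sum[OF I i2])
  have "seg_int c d k (\<lambda>x. f x + (\<Sum>i\<in>I. C i * g i x)) z
      = integral {0..1} (\<lambda>s. ?q f s + (\<Sum>i\<in>I. C i * ?q (g i) s))"
    unfolding seg_int_def by (intro integral_cong) (simp add: distrib_left sum_distrib_left mult_ac)
  also have "\<dots> = integral {0..1} (?q f) + (\<Sum>i\<in>I. integral {0..1} (\<lambda>s. C i * ?q (g i) s))"
    by (simp only: integral_add[OF i1 i3] integral_sum[OF I i2])
  also have "\<dots> = seg_int c d k f z + (\<Sum>i\<in>I. C i * seg_int c d k (g i) z)"
    by (simp only: seg_int_def integral_mult_right)
  finally show ?thesis .
qed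

text \<open>The kernel is holomorphic on the diagonal, so that moving the base point of the integral from
  \<open>A\<close> to \<open>B\<close> changes it by a function holomorphic at \<open>B\<close>.\<close>

lemma volterra_connection:
  assumes A: "edge_point a b A" and B: "edge_point a b B" and k: "k holomorphic_on exp_slit"
    and f: "f holomorphic_on strip a b" "branch_at A (strip a b) e f L" "Re e > 0"
    and g: "\<And>i. i \<in> I \<Longrightarrow> g i holomorphic_on strip a b" "\<And>i. i \<in> I \<Longrightarrow> branch_at B (strip a b) (e' i) (g i) (L' i)"
       "\<And>i. i \<in> I \<Longrightarrow> Re (e' i) > 0" and I: "finite I"
    and reg: "branch_at B (strip a b) 0 (\<lambda>z. f z - (\<Sum>i\<in>I. C i * g i z)) L0"
  shows "\<exists>L1. branch_at B (strip a b) 0 (\<lambda>z. volterra A k f z - (\<Sum>i\<in>I. C i * volterra B k (g i) z)) L1"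
proof -
  let ?S = "strip a b"
  obtain \<epsilon>0 H where H: "\<epsilon>0 > 0" "H holomorphic_on ball B \<epsilon>0"
      "\<And>z. z \<in> ?S \<inter> ball B \<epsilon>0 \<Longrightarrow> f z - (\<Sum>i\<in>I. C i * g i z) = (z - B) powr 0 * H z"
    using reg unfolding branch_at_def by blast
  \<comment> \<open>A point z of the ball may lie outside the strip. The bound 2\<pi> - (b - a)
    still keeps z - x in \<open>exp_slit\<close> for all x in the closed strip.\<close>
  define \<epsilon> where "\<epsilon> = min \<epsilon>0 (min 1 (2 * pi - (b - a)))"
  have ab: "a < b" "b - a < 2 * pi" using A by (auto simp: edge_point_def)
  have \<epsilon>: "\<epsilon> > 0" "ball B \<epsilon> \<subseteq> ball B \<epsilon>0" "\<epsilon> \<le> 2 * pi - (b - a)" "\<epsilon> \<le> 1" using H(1) ab by (auto simp: \<epsilon>_def)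
  have slit: "z - x \<in> exp_slit" if "z \<in> ball B \<epsilon>" "a \<le> Im x" "Im x \<le> b" for z x
  proof -
    have "\<bar>Im (z - B)\<bar> \<le> cmod (z - B)" by (rule abs_Im_le_cmod)
    also have "\<dots> < \<epsilon>" using that(1) by (simp add: dist_norm norm_minus_commute)
    finally have "\<bar>Im z - Im B\<bar> < \<epsilon>" by simp
    moreover have "Im B = a \<or> Im B = b" using B by (simp add: edge_point_def)
    ultimately have "\<bar>Im z - Im x\<bar> < 2 * pi" using that(2,3) ab \<epsilon>(3) by linarith
    then show ?thesis by (simp add: exp_slit_def)
  qed
  have Im_edge: "a \<le> Im x" "Im x \<le> b" if "x \<in> insert E ?S" "edge_point a b E" for x E
    using that ab by (auto simp: edge_point_def strip_def)
  obtain c0 where c0: "c0 \<in> ?S" "c0 \<in> ball B \<epsilon>" using edge_point_strip_ball[OF B \<epsilon>(1)] by blast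
  define fA where "fA = f(A := 0)"
  define gB where "gB = (\<lambda>i. (g i)(B := 0))"
  have fAc: "continuous_on (insert A ?S) fA" unfolding fA_def by (rule branch_at_continuous[OF A f])
  have gBc: "continuous_on (insert B ?S) (gB i)" if "i \<in> I" for i
    unfolding gB_def by (rule branch_at_continuous[OF B g(1)[OF that] g(2)[OF that] g(3)[OF that]])
  have hol_upd: "h(E := 0) holomorphic_on interior (insert E ?S) - {E}" if "h holomorphic_on ?S" for h E
  proof -
    have "h holomorphic_on interior (insert E ?S) - {E}"
      by (rule holomorphic_on_subset[OF that]) (use interior_subset in blast)
    then show ?thesis by (rule holomorphic_transform) auto
  qed
  have HS: "fA x = H x + (\<Sum>i\<in>I. C i * gB i x)" if "x \<in> ?S \<inter> ball B \<epsilon>" for x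
  proof -
    have "x \<noteq> A" "x \<noteq> B" using that edge_point_notin[OF A] edge_point_notin[OF B] by auto
    moreover have "f x - (\<Sum>i\<in>I. C i * g i x) = H x"
      using H(3)[of x] that \<epsilon>(2) \<open>x \<noteq> B\<close> by auto
    ultimately show ?thesis by (simp add: fA_def gB_def algebra_simps)
  qed
  \<comment> \<open>The candidate for the remainder. The paths from A and from B to c0 do not depend
    on z, and the path from c0 to z carries only H, which is holomorphic on the whole ball; so each
    term is holomorphic at B.\<close>
  define R where "R = (\<lambda>z. seg_int A c0 k fA z + seg_int c0 z k H z - (\<Sum>i\<in>I. C i * seg_int B c0 k (gB i) z))"
  have Hh: "H holomorphic_on ball B \<epsilon>" by (rule holomorphic_on_subset[OF H(2) \<epsilon>(2)])
  have seg_edge: "a \<le> Im x \<and> Im x \<le> b" if "x \<in> closed_segment E c0" "edge_point a b E" for x E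
  proof -
    have "closed_segment E c0 \<subseteq> insert E ?S"
      by (rule closed_segment_subset[OF _ _ edge_point_convex[OF that(2)]]) (use c0 in auto)
    then show ?thesis using Im_edge that by blast
  qed
  have R1: "seg_int A c0 k fA holomorphic_on ball B \<epsilon>"
    by (rule seg_int_holomorphic[OF open_ball convex_ball edge_point_convex[OF A] _ _ fAc k])
       (use c0 slit seg_edge[OF _ A] in auto)
  have R3: "seg_int B c0 k (gB i) holomorphic_on ball B \<epsilon>" if "i \<in> I" for i
    by (rule seg_int_holomorphic[OF open_ball convex_ball edge_point_convex[OF B] _ _ gBc[OF that] k])
       (use c0 slit seg_edge[OF _ B] in auto)
  have slit2: "z - c0 \<in> exp_slit" if "z \<in> ball B \<epsilon>" for z
    by (rule slit[OF that]) (use c0 in \<open>auto simp: strip_def\<close>)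
  have R2: "(\<lambda>z. seg_int c0 z k H z) holomorphic_on ball B \<epsilon>"
    unfolding holomorphic_on_open[OF open_ball]
  proof
    fix z assume z: "z \<in> ball B \<epsilon>"
    have "((\<lambda>z. seg_int c0 z k H z) has_field_derivative k 0 * H z + seg_int c0 z (deriv k) H z) (at z)"
    proof (rule seg_int_has_derivative[OF open_ball convex_ball order_refl convex_ball c0(2) _ slit2 k])
      show "c0 + of_real s * (z - c0) \<in> ball B \<epsilon>" if "z \<in> ball B \<epsilon>" "0 < s" "s \<le> 1" for z s
        by (rule segment_in_convex[OF convex_ball c0(2) that(1)]) (use that in auto)
      show "continuous_on (ball B \<epsilon>) H" "continuous_on (ball B \<epsilon>) (deriv H)"
        using Hh holomorphic_deriv[OF Hh open_ball] by (auto intro: holomorphic_on_imp_continuous_on)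
      show "(H has_field_derivative deriv H z) (at z)" if "z \<in> ball B \<epsilon>" for z
        by (rule holomorphic_derivI[OF Hh open_ball that])
    qed (assumption | rule z)+
    then show "\<exists>f'. ((\<lambda>z. seg_int c0 z k H z) has_field_derivative f') (at z)" by blast
  qed
  have Rh: "R holomorphic_on ball B \<epsilon>"
    unfolding R_def by (intro holomorphic_intros R1 R2 R3)
  have "volterra A k f z - (\<Sum>i\<in>I. C i * volterra B k (g i) z) = (z - B) powr 0 * R z" if z: "z \<in> ?S \<inter> ball B \<epsilon>" for z
  proof -
    have zS: "z \<in> ?S" "z \<in> ball B \<epsilon>" "z \<noteq> B" using z edge_point_notin[OF B] by auto
    have vA: "volterra A k f z = seg_int A c0 k fA z + seg_int c0 z k fA z"
      unfolding volterra_def fA_def[symmetric]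
      by (rule seg_int_split[OF edge_point_convex[OF A] _ _ _ fAc _ k])
         (use zS c0 slit[OF zS(2)] Im_edge[OF _ A] hol_upd[OF f(1)] in \<open>auto simp: fA_def\<close>)
    have vB: "volterra B k (g i) z = seg_int B c0 k (gB i) z + seg_int c0 z k (gB i) z" if "i \<in> I" for i
    proof -
      have "seg_int B z k (gB i) z = seg_int B c0 k (gB i) z + seg_int c0 z k (gB i) z"
        by (rule seg_int_split[OF edge_point_convex[OF B] _ _ _ gBc[OF that] _ k])
           (use zS c0 slit[OF zS(2)] Im_edge[OF _ B] hol_upd[OF g(1)[OF that]] in \<open>auto simp: gB_def\<close>)
      then show ?thesis by (simp add: volterra_def gB_def)
    qed
    have cv: "convex (?S \<inter> ball B \<epsilon>)" by (intro convex_Int strip_convex convex_ball)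
    \<comment> \<open>Between c0 and z the path stays in the part of the strip near B, where f is H
      plus the given combination of the g i. The branching contributions along it cancel in the
      difference.\<close>
    have "seg_int c0 z k fA z = seg_int c0 z k (\<lambda>x. H x + (\<Sum>i\<in>I. C i * gB i x)) z"
      by (rule seg_int_cong, rule HS) (use closed_segment_subset[OF _ _ cv, of c0 z] c0 zS in blast)
    also have "\<dots> = seg_int c0 z k H z + (\<Sum>i\<in>I. C i * seg_int c0 z k (gB i) z)"
    proof (rule seg_int_add_sum[OF k cv _ _ _ _ I])
      show "continuous_on (?S \<inter> ball B \<epsilon>) H"
        by (rule continuous_on_subset[OF holomorphic_on_imp_continuous_on[OF Hh]]) auto
      show "continuous_on (?S \<inter> ball B \<epsilon>) (gB i)" if "i \<in> I" for i
        by (rule continuous_on_subset[OF gBc[OF that]]) auto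
      show "z - (c0 + of_real s * (z - c0)) \<in> exp_slit" if "s \<in> {0..1}" for s
        by (rule exp_slit_scale[OF slit2[OF zS(2)] that])
    qed (use c0 zS in auto)
    finally have eq: "seg_int c0 z k fA z = seg_int c0 z k H z + (\<Sum>i\<in>I. C i * seg_int c0 z k (gB i) z)" .
    have "(\<Sum>i\<in>I. C i * volterra B k (g i) z)
        = (\<Sum>i\<in>I. C i * seg_int B c0 k (gB i) z) + (\<Sum>i\<in>I. C i * seg_int c0 z k (gB i) z)"
      by (simp add: vB distrib_left sum.distrib)
    then show ?thesis using zS(3) by (simp add: vA eq R_def)
  qed
  then show ?thesis unfolding branch_at_def using \<epsilon>(1) Rh by blast
qed

section \<open>Uniqueness of solutions with given leading coefficients\<close>

lemma branch_at_flat_zero: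
  assumes A: "edge_point a b A" and f: "f holomorphic_on strip a b"
    and br: "\<And>m::nat. branch_at A (strip a b) (e + of_nat m) f 0" and z: "z \<in> strip a b"
  shows "f z = 0"
proof -
  have "branch_at A (strip a b) e f 0" using br[of 0] by simp
  then obtain \<epsilon> G where G: "\<epsilon> > 0" "G holomorphic_on ball A \<epsilon>" "G A = 0" "\<And>z. z \<in> strip a b \<inter> ball A \<epsilon> \<Longrightarrow> f z = (z - A) powr e * G z"
    unfolding branch_at_def by blast
  \<comment> \<open>A nonconstant G has a zero of finite order n at A. The representation with
    exponent e + n and coefficient 0 then makes the cofactor g vanish at A, although g has no
    zeros.\<close>
  have "G constant_on ball A \<epsilon>"
  proof (rule ccontr)
    assume nc: "\<not> G constant_on ball A \<epsilon>"
    obtain g r n where g: "0 < n" "0 < r" "ball A r \<subseteq> ball A \<epsilon>" "g holomorphic_on ball A r"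
      "\<And>w. w \<in> ball A r \<Longrightarrow> G w = (w - A) ^ n * g w" "\<And>w. w \<in> ball A r \<Longrightarrow> g w \<noteq> 0"
    proof (rule holomorphic_factor_zero_nonconstant[OF G(2) open_ball connected_ball _ G(3) nc])
      show "A \<in> ball A \<epsilon>" using G(1) by simp
    qed blast
    obtain \<epsilon>' H where H: "\<epsilon>' > 0" "H holomorphic_on ball A \<epsilon>'" "H A = 0"
      "\<And>z. z \<in> strip a b \<inter> ball A \<epsilon>' \<Longrightarrow> f z = (z - A) powr (e + of_nat n) * H z"
      using br[of n] unfolding branch_at_def by blast
    define d where "d = min r \<epsilon>'"
    have d: "d > 0" "ball A d \<subseteq> ball A r" "ball A d \<subseteq> ball A \<epsilon>'" using g H by (auto simp: d_def)
    have "g w = H w" if w: "w \<in> strip a b \<inter> ball A d" for w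
    proof -
      have nz: "w - A \<noteq> 0" using edge_point_neq[OF A] w by blast
      have w1: "w \<in> strip a b \<inter> ball A \<epsilon>'" "w \<in> strip a b \<inter> ball A \<epsilon>" "w \<in> ball A r" using w d g(3) by blast+
      have "(w - A) powr e * ((w - A) ^ n * g w) = (w - A) powr (e + of_nat n) * H w"
        using G(4)[OF w1(2)] H(4)[OF w1(1)] g(5)[OF w1(3)] by simp
      also have "(w - A) powr (e + of_nat n) = (w - A) powr e * (w - A) ^ n"
        using nz by (simp add: powr_add powr_nat')
      finally have "((w - A) powr e * (w - A) ^ n) * g w = ((w - A) powr e * (w - A) ^ n) * H w"
        by (simp only: mult.assoc)
      moreover have "(w - A) powr e * (w - A) ^ n \<noteq> 0" using nz by (simp add: powr_def)
      ultimately show ?thesis by (simp only: mult_cancel_left simp_thms)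
    qed
    then have "g A = H A"
      by (rule strip_ball_identity[OF A d(1) holomorphic_on_subset[OF g(4) d(2)] holomorphic_on_subset[OF H(2) d(3)]])
         (use d(1) in simp_all)
    then show False using H(3) g(2,6) by simp
  qed
  then obtain v where v: "\<And>w. w \<in> ball A \<epsilon> \<Longrightarrow> G w = v" unfolding constant_on_def by blast
  have "v = 0" using v[of A] G(1,3) by simp
  obtain w where w: "w \<in> strip a b \<inter> ball A \<epsilon>" using edge_point_strip_ball[OF A G(1)] by blast
  have "f z = (\<lambda>_. 0) z"
  proof (rule analytic_continuation_open[of "strip a b \<inter> ball A \<epsilon>" "strip a b" f])
    show "f w = 0" if "w \<in> strip a b \<inter> ball A \<epsilon>" for w
      using G(4)[OF that] v[of w] that \<open>v = 0\<close> by simp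
    show "connected (strip a b)" by (intro convex_connected strip_convex)
  qed (use w f z strip_open in auto)
  then show ?thesis by simp
qed

text \<open>The equation \<open>(D + \<rho>\<^sub>1)(D + \<rho>\<^sub>2) u = (D + \<sigma> - M) \<tau> e\<^sup>z D u\<close>, expanded.\<close>

definition extension_equation ::
  "nat \<Rightarrow> (nat \<Rightarrow> nat \<Rightarrow> complex) \<Rightarrow> (nat \<Rightarrow> complex) \<Rightarrow> complex \<Rightarrow> complex \<Rightarrow> complex set \<Rightarrow> (nat \<Rightarrow> complex \<Rightarrow> complex) \<Rightarrow> bool" where
  "extension_equation N M \<tau> \<rho>1 \<rho>2 S u \<longleftrightarrow> (\<forall>i<N. u i holomorphic_on S \<and> (\<forall>z\<in>S.
     deriv (deriv (u i)) z + (\<rho>1 + \<rho>2) * deriv (u i) z + \<rho>1 * \<rho>2 * u i z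
       = \<tau> i * exp z * (deriv (deriv (u i)) z + (1 + \<rho>1 + \<rho>2) * deriv (u i) z)
         - (\<Sum>j<N. M i j * (\<tau> j * exp z * deriv (u j) z))))"

text \<open>Frobenius recursion for (1 - \<tau>_i e^z) u_i'' + (lower order) = 0. In a row with
  \<tau>_i e^A \<noteq> 1 the lowest order c - 2 gives c (c - 1) L_i = 0. In a row with \<tau>_i e^A
  = 1 the factor 1 - \<tau>_i e^z vanishes simply at A, and order c - 1 gives c (M_ii - c) L_i = 0.
  So all coefficients vanish at every exponent e + m, and the solution is flat at A.\<close>

lemma extension_equation_unique:
  assumes A: "edge_point a b A" and eq: "extension_equation N M \<tau> \<rho>1 \<rho>2 (strip a b) u"
    and br: "\<And>i. i < N \<Longrightarrow> branch_at A (strip a b) e (u i) 0"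
    and e: "e \<notin> \<int>"
    and diag: "\<And>i j. i < N \<Longrightarrow> j < N \<Longrightarrow> \<tau> i * exp A = 1 \<Longrightarrow> \<tau> j * exp A = 1 \<Longrightarrow> i \<noteq> j \<Longrightarrow> M i j = 0"
    and nonres: "\<And>i m. i < N \<Longrightarrow> \<tau> i * exp A = 1 \<Longrightarrow> m \<ge> 1 \<Longrightarrow> e + of_nat m \<noteq> M i i"
    and i: "i < N" and z: "z \<in> strip a b"
  shows "u i z = 0"
proof -
  let ?S = "strip a b"
  note An = edge_point_notin[OF A]
  have step: "\<forall>i<N. L i = 0"
    if br: "\<And>i. i < N \<Longrightarrow> branch_at A ?S (e + of_nat m) (u i) (L i)" and m: "m \<ge> 1" for m L
  proof -
    define c where "c = e + of_nat m"
    \<comment> \<open>c (c - 1) is the factor produced by two differentiations; as c is no integer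
      it cannot vanish.\<close>
    have c: "c \<noteq> 0" "c - 1 \<noteq> 0"
    proof -
      have "e \<noteq> of_int (- int m)" "e \<noteq> of_int (1 - int m)" using e Ints_of_int by metis+
      then show "c \<noteq> 0" "c - 1 \<noteq> 0" by (auto simp: c_def algebra_simps eq_neg_iff_add_eq_0)
    qed
    have b0: "branch_at A ?S c (u i) (L i)" if "i < N" for i using br[OF that] by (simp add: c_def)
    have b1: "branch_at A ?S (c - 1) (deriv (u i)) (c * L i)" if "i < N" for i
      by (rule branch_at_deriv[OF A b0[OF that]])
    have b2: "branch_at A ?S (c - 2) (deriv (deriv (u i))) ((c - 1) * (c * L i))" if "i < N" for i
      using branch_at_deriv[OF A b1[OF that]] by simp
    have b0': "branch_at A ?S (c - 1) (u i) 0" if "i < N" for i by (rule branch_at_lower[OF b0[OF that] An])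
    have ex: "branch_at A ?S 0 exp (exp A)"
      by (rule branch_at_holomorphic[of _ _ 1]) (auto intro!: holomorphic_intros An)
    have lower: "branch_at A ?S (c - 1) (\<lambda>z. (\<rho>1 + \<rho>2) * deriv (u i) z + \<rho>1 * \<rho>2 * u i z
        - \<tau> i * (exp z * ((1 + \<rho>1 + \<rho>2) * deriv (u i) z)) + (\<Sum>j<N. (M i j * \<tau> j) * (exp z * deriv (u j) z)))
        ((\<rho>1 + \<rho>2) * (c * L i) + \<rho>1 * \<rho>2 * 0 - \<tau> i * (exp A * ((1 + \<rho>1 + \<rho>2) * (c * L i)))
          + (\<Sum>j<N. (M i j * \<tau> j) * (exp A * (c * L j))))" if i: "i < N" for i
    proof (intro branch_at_add branch_at_diff branch_at_sum branch_at_cmult b1 b0' An i)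
      have m1: "branch_at A ?S (c - 1) (\<lambda>z. exp z * g z) (exp A * v)" if "branch_at A ?S (c - 1) g v" for g v
        using branch_at_mult[OF ex that] by simp
      show "branch_at A ?S (c - 1) (\<lambda>z. exp z * ((1 + \<rho>1 + \<rho>2) * deriv (u i) z)) (exp A * ((1 + \<rho>1 + \<rho>2) * (c * L i)))"
        by (intro m1 branch_at_cmult b1 i An)
      show "branch_at A ?S (c - 1) (\<lambda>z. exp z * deriv (u j) z) (exp A * (c * L j))" if "j \<in> {..<N}" for j
        by (intro m1 b1) (use that in simp)
    qed
    have total: "(1 - \<tau> i * exp z) * deriv (deriv (u i)) z + ((\<rho>1 + \<rho>2) * deriv (u i) z + \<rho>1 * \<rho>2 * u i z
        - \<tau> i * (exp z * ((1 + \<rho>1 + \<rho>2) * deriv (u i) z)) + (\<Sum>j<N. (M i j * \<tau> j) * (exp z * deriv (u j) z))) = 0"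
      if i: "i < N" and z: "z \<in> ?S" for i z
    proof -
      have "deriv (deriv (u i)) z + (\<rho>1 + \<rho>2) * deriv (u i) z + \<rho>1 * \<rho>2 * u i z
       = \<tau> i * exp z * (deriv (deriv (u i)) z + (1 + \<rho>1 + \<rho>2) * deriv (u i) z)
         - (\<Sum>j<N. M i j * (\<tau> j * exp z * deriv (u j) z))"
        using eq i z unfolding extension_equation_def by blast
      then show ?thesis by (simp add: algebra_simps)
    qed
    have nonI: "L i = 0" if i: "i < N" and ne: "\<tau> i * exp A \<noteq> 1" for i
    proof -
      have bf: "branch_at A ?S 0 (\<lambda>z. 1 - \<tau> i * exp z) (1 - \<tau> i * exp A)"
        by (rule branch_at_holomorphic[of _ _ 1]) (auto intro!: holomorphic_intros An)
      have "branch_at A ?S (c - 1 - 1) (\<lambda>z. (1 - \<tau> i * exp z) * deriv (deriv (u i)) z + ((\<rho>1 + \<rho>2) * deriv (u i) z + \<rho>1 * \<rho>2 * u i z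
        - \<tau> i * (exp z * ((1 + \<rho>1 + \<rho>2) * deriv (u i) z)) + (\<Sum>j<N. (M i j * \<tau> j) * (exp z * deriv (u j) z))))
        ((1 - \<tau> i * exp A) * ((c - 1) * (c * L i)) + 0)"
        using branch_at_mult[OF bf b2[OF i]] by (intro branch_at_add branch_at_lower[OF lower[OF i] An]) simp
      then have "branch_at A ?S (c - 1 - 1) (\<lambda>_. 0) ((1 - \<tau> i * exp A) * ((c - 1) * (c * L i)) + 0)"
        by (rule branch_at_cong) (rule total[OF i])
      from branch_at_unique[OF A this branch_at_zero] show ?thesis using c ne by simp
    qed
    have "L i = 0" if i: "i < N" and eI: "\<tau> i * exp A = 1" for i
    proof -
      have bf: "branch_at A ?S 0 (\<lambda>z. 1 - \<tau> i * exp z) 0"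
      proof -
        have "(\<lambda>z. 1 - \<tau> i * exp z) holomorphic_on ball A 1" by (intro holomorphic_intros)
        from branch_at_holomorphic[OF this _ An] show ?thesis by (simp add: eI)
      qed
      obtain v where v: "branch_at A ?S 1 (\<lambda>z. 1 - \<tau> i * exp z) v" using branch_at_lift[OF bf An] by auto
      have d: "deriv (\<lambda>z. 1 - \<tau> i * exp z) z = - \<tau> i * exp z" for z
        by (rule DERIV_imp_deriv) (auto intro!: derivative_eq_intros)
      have "branch_at A ?S 0 (\<lambda>z. - \<tau> i * exp z) v" using branch_at_deriv[OF A v] by (simp add: d[abs_def])
      moreover have "branch_at A ?S 0 (\<lambda>z. - \<tau> i * exp z) (- \<tau> i * exp A)"
        by (rule branch_at_holomorphic[of _ _ 1]) (auto intro!: holomorphic_intros An)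
      ultimately have "v = - 1" using branch_at_unique[OF A] eI by fastforce
      then have "branch_at A ?S (1 + (c - 2)) (\<lambda>z. (1 - \<tau> i * exp z) * deriv (deriv (u i)) z) ((- 1) * ((c - 1) * (c * L i)))"
        using branch_at_mult[OF v b2[OF i]] by simp
      moreover have "1 + (c - 2) = c - 1" by simp
      ultimately have q: "branch_at A ?S (c - 1) (\<lambda>z. (1 - \<tau> i * exp z) * deriv (deriv (u i)) z) ((- 1) * ((c - 1) * (c * L i)))"
        by metis
      have "branch_at A ?S (c - 1) (\<lambda>_. 0) ((- 1) * ((c - 1) * (c * L i)) + ((\<rho>1 + \<rho>2) * (c * L i) + \<rho>1 * \<rho>2 * 0
          - \<tau> i * (exp A * ((1 + \<rho>1 + \<rho>2) * (c * L i))) + (\<Sum>j<N. (M i j * \<tau> j) * (exp A * (c * L j)))))"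
        by (rule branch_at_cong[OF branch_at_add[OF q lower[OF i]]]) (rule total[OF i])
      from branch_at_unique[OF A this branch_at_zero]
      have 0: "(- 1) * ((c - 1) * (c * L i)) + ((\<rho>1 + \<rho>2) * (c * L i)
          - (\<tau> i * exp A) * ((1 + \<rho>1 + \<rho>2) * (c * L i)) + (\<Sum>j<N. (M i j * \<tau> j) * (exp A * (c * L j)))) = 0"
        by (simp add: mult.assoc)
      \<comment> \<open>Rows j with \<tau>_j e^A \<noteq> 1 drop out because L_j = 0 has just been
        shown for them, and among the singular rows M is diagonal.\<close>
      have s_eq: "(\<Sum>j<N. (M i j * \<tau> j) * (exp A * (c * L j))) = (\<Sum>j<N. if j = i then M i i * (c * L i) else 0)"
      proof (rule sum.cong[OF refl])
        fix j assume "j \<in> {..<N}"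
        then have j: "j < N" by simp
        show "(M i j * \<tau> j) * (exp A * (c * L j)) = (if j = i then M i i * (c * L i) else 0)"
        proof (cases "\<tau> j * exp A = 1")
          case True
          have "(M i j * \<tau> j) * (exp A * (c * L j)) = M i j * (\<tau> j * exp A) * (c * L j)" by (simp only: mult_ac)
          then have "(M i j * \<tau> j) * (exp A * (c * L j)) = M i j * (c * L j)" by (simp only: True mult_1_right)
          then show ?thesis using diag[OF i j eI True] by (cases "j = i") auto
        next
          case False
          then show ?thesis using nonI[OF j False] eI by auto
        qed
      qed
      have s_eq': "(\<Sum>j<N. if j = i then M i i * (c * L i) else 0) = M i i * (c * L i)" using i by simp
      \<comment> \<open>The coefficients -(c - 1) + \<sigma> - (1 + \<sigma>) + M_ii add up to M_ii
        - c, the indicial polynomial at the singular row.\<close>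
      from 0[unfolded s_eq s_eq' eI] have "c * L i * (M i i - c) = 0" by (simp only: algebra_simps) simp
      moreover have "M i i - c \<noteq> 0" using nonres[OF i eI m] by (auto simp: c_def)
      ultimately show ?thesis using c by simp
    qed
    then show ?thesis using nonI by blast
  qed
  have all: "\<forall>i<N. branch_at A ?S (e + of_nat m) (u i) 0" for m
  proof (induction m)
    case 0
    then show ?case using br by simp
  next
    case (Suc m)
    then have "\<forall>i. \<exists>L. i < N \<longrightarrow> branch_at A ?S (e + of_nat m + 1) (u i) L"
      using branch_at_lift[OF _ An] by blast
    then obtain L where L: "\<And>i. i < N \<Longrightarrow> branch_at A ?S (e + of_nat m + 1) (u i) (L i)" by metis
    then have L': "\<And>i. i < N \<Longrightarrow> branch_at A ?S (e + of_nat (Suc m)) (u i) (L i)" by (simp add: add_ac)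
    from step[OF L'] have "\<forall>i<N. L i = 0" by simp
    then show ?case using L' by simp
  qed
  show ?thesis
    by (rule branch_at_flat_zero[OF A _ _ z, of _ e]) (use all i eq in \<open>auto simp: extension_equation_def\<close>)
qed

section \<open>From the underlying system to the extended one\<close>

text \<open>This is (\<zeta> - t'_i) dw_i/d\<zeta> = ((c + M) w)_i at \<zeta> = \<eta>0 + e^z with 1
  / \<tau>_i = t'_i - \<eta>0, multiplied by \<tau>_i e^z. The level c is the parameter that one
  integration raises by 1.\<close>

definition okubo_level ::
  "nat \<Rightarrow> (nat \<Rightarrow> nat \<Rightarrow> complex) \<Rightarrow> (nat \<Rightarrow> complex) \<Rightarrow> complex \<Rightarrow> complex set \<Rightarrow> (nat \<Rightarrow> complex \<Rightarrow> complex) \<Rightarrow> bool" where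
  "okubo_level N M \<tau> c S w \<longleftrightarrow> (\<forall>i<N. w i holomorphic_on S \<and> (\<forall>z\<in>S.
     deriv (w i) z = \<tau> i * exp z * (deriv (w i) z - (\<Sum>j<N. M i j * w j z) - c * w i z)))"

text \<open>R is the two-sided inverse of c + M. It is expressed through its action on vectors, the
  form in which it meets sums over solution components.\<close>

definition shifted_inverse :: "nat \<Rightarrow> (nat \<Rightarrow> nat \<Rightarrow> complex) \<Rightarrow> complex \<Rightarrow> (nat \<Rightarrow> nat \<Rightarrow> complex) \<Rightarrow> bool" where
  "shifted_inverse N M c R \<longleftrightarrow> (\<forall>i<N. \<forall>v.
     (\<Sum>j<N. R i j * ((\<Sum>l<N. M j l * v l) + c * v j)) = v i \<and>
     (\<Sum>j<N. M i j * (\<Sum>l<N. R j l * v l)) + c * (\<Sum>l<N. R i l * v l) = (v i :: complex))"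

lemma shifted_inverseD:
  assumes "shifted_inverse N M c R" "i < N"
  shows "(\<Sum>j<N. R i j * ((\<Sum>l<N. M j l * v l) + c * v j)) = v i"
    "(\<Sum>j<N. M i j * (\<Sum>l<N. R j l * v l)) + c * (\<Sum>l<N. R i l * v l) = v i"
  using assms unfolding shifted_inverse_def by simp_all

definition raise :: "nat \<Rightarrow> (nat \<Rightarrow> complex) \<Rightarrow> (nat \<Rightarrow> nat \<Rightarrow> complex) \<Rightarrow> (nat \<Rightarrow> complex \<Rightarrow> complex) \<Rightarrow> nat \<Rightarrow> complex \<Rightarrow> complex" where
  "raise N \<tau> R w i z = (\<Sum>j<N. R i j * ((exp z - 1 / \<tau> j) * w j z))"

text \<open>Integrating a solution of \<open>(\<zeta> - T') dw/d\<zeta> = (c + A) w\<close> is a matrix operation: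
  \<open>(c + 1 + A)\<^sup>-\<^sup>1 (\<zeta> - T') w\<close> is an antiderivative that solves the same system with \<open>c + 1\<close>. It is used to
  raise the exponents until all integrals converge.\<close>

lemma raise_properties:
  assumes w: "okubo_level N M \<tau> c (strip a b) w" and R: "shifted_inverse N M (c + 1) R"
    and \<tau>: "\<And>i. i < N \<Longrightarrow> \<tau> i \<noteq> 0"
  shows "okubo_level N M \<tau> (c + 1) (strip a b) (raise N \<tau> R w)"
    and "\<And>i z. i < N \<Longrightarrow> z \<in> strip a b \<Longrightarrow> deriv (raise N \<tau> R w i) z = exp z * w i z"
proof -
  let ?S = "strip a b"
  have wh: "w i holomorphic_on ?S" if "i < N" for i using w that by (simp add: okubo_level_def)
  have rh: "raise N \<tau> R w i holomorphic_on ?S" for i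
    unfolding raise_def[abs_def] by (intro holomorphic_intros wh) auto
  have dv: "((\<lambda>z. (exp z - 1 / \<tau> i) * w i z) has_field_derivative exp z * ((\<Sum>j<N. M i j * w j z) + (c + 1) * w i z)) (at z)"
    if i: "i < N" and z: "z \<in> ?S" for i z
  proof -
    have d: "(w i has_field_derivative deriv (w i) z) (at z)" by (rule holomorphic_derivI[OF wh[OF i] strip_open z])
    have e: "deriv (w i) z = \<tau> i * exp z * (deriv (w i) z - (\<Sum>j<N. M i j * w j z) - c * w i z)"
      using w i z unfolding okubo_level_def by blast
    have "(1 / \<tau> i) * deriv (w i) z = exp z * (deriv (w i) z - (\<Sum>j<N. M i j * w j z) - c * w i z)"
      using \<tau>[OF i] by (subst e) simp
    then have "(exp z - 1 / \<tau> i) * deriv (w i) z = exp z * ((\<Sum>j<N. M i j * w j z) + c * w i z)"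
      by (simp only: left_diff_distrib) (simp add: algebra_simps)
    moreover have "((\<lambda>z. (exp z - 1 / \<tau> i) * w i z) has_field_derivative exp z * w i z + (exp z - 1 / \<tau> i) * deriv (w i) z) (at z)"
      by (rule derivative_eq_intros d refl | simp)+
    ultimately show ?thesis by (simp add: algebra_simps)
  qed
  show dr: "deriv (raise N \<tau> R w i) z = exp z * w i z" if i: "i < N" and z: "z \<in> ?S" for i z
  proof -
    have "(raise N \<tau> R w i has_field_derivative (\<Sum>j<N. R i j * (exp z * ((\<Sum>l<N. M j l * w l z) + (c + 1) * w j z)))) (at z)"
      unfolding raise_def[abs_def] by (intro DERIV_sum DERIV_cmult dv z) auto
    moreover have "(\<Sum>j<N. R i j * (exp z * ((\<Sum>l<N. M j l * w l z) + (c + 1) * w j z)))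
        = exp z * (\<Sum>j<N. R i j * ((\<Sum>l<N. M j l * w l z) + (c + 1) * w j z))"
      by (simp add: sum_distrib_left mult.left_commute)
    moreover have "(\<Sum>j<N. R i j * ((\<Sum>l<N. M j l * w l z) + (c + 1) * w j z)) = w i z"
      by (rule shifted_inverseD(1)[OF R i, of "\<lambda>j. w j z"])
    ultimately show ?thesis by (simp only: DERIV_imp_deriv)
  qed
  show "okubo_level N M \<tau> (c + 1) ?S (raise N \<tau> R w)"
    unfolding okubo_level_def
  proof (intro allI impI conjI ballI rh)
    fix i z assume i: "i < N" and z: "z \<in> ?S"
    have "(\<Sum>j<N. M i j * (\<Sum>l<N. R j l * ((exp z - 1 / \<tau> l) * w l z))) + (c + 1) * (\<Sum>l<N. R i l * ((exp z - 1 / \<tau> l) * w l z))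
        = (exp z - 1 / \<tau> i) * w i z"
      by (rule shifted_inverseD(2)[OF R i, of "\<lambda>l. (exp z - 1 / \<tau> l) * w l z"])
    then have e: "(\<Sum>j<N. M i j * raise N \<tau> R w j z) + (c + 1) * raise N \<tau> R w i z = (exp z - 1 / \<tau> i) * w i z"
      by (simp add: raise_def)
    have "\<tau> i * exp z * (deriv (raise N \<tau> R w i) z - (\<Sum>j<N. M i j * raise N \<tau> R w j z) - (c + 1) * raise N \<tau> R w i z)
        = \<tau> i * exp z * (exp z * w i z - (exp z - 1 / \<tau> i) * w i z)"
      by (simp only: dr[OF i z] diff_diff_eq e)
    also have "\<dots> = exp z * w i z" using \<tau>[OF i] by (simp add: field_simps)
    finally show "deriv (raise N \<tau> R w i) z = \<tau> i * exp z * (deriv (raise N \<tau> R w i) z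
        - (\<Sum>j<N. M i j * raise N \<tau> R w j z) - (c + 1) * raise N \<tau> R w i z)"
      by (simp only: dr[OF i z])
  qed
qed

lemma branch_at_exp: "A \<notin> S \<Longrightarrow> branch_at A S 0 (\<lambda>z. exp (c * z)) (exp (c * A))"
  by (rule branch_at_holomorphic[of _ _ 1]) (auto intro!: holomorphic_intros)

text \<open>A priori the exponent is only e, with unknown coefficient v. The derivative e^z w has
  exponent e, so comparison at e - 1 gives e v = 0 and the exponent lifts to e + 1; comparison at e
  then determines the new coefficient.\<close>

lemma raise_branch:
  assumes A: "edge_point a b A" and w: "okubo_level N M \<tau> c (strip a b) w" and R: "shifted_inverse N M (c + 1) R"
    and \<tau>: "\<And>i. i < N \<Longrightarrow> \<tau> i \<noteq> 0" and br: "\<And>i. i < N \<Longrightarrow> branch_at A (strip a b) e (w i) (L i)"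
    and e: "e \<noteq> 0" "e + 1 \<noteq> 0" and i: "i < N"
  shows "branch_at A (strip a b) (e + 1) (raise N \<tau> R w i) (exp A * L i / (e + 1))"
proof -
  let ?S = "strip a b"
  note An = edge_point_notin[OF A]
  have ex: "branch_at A ?S 0 exp (exp A)" using branch_at_exp[OF An, of 1] by simp
  have "branch_at A ?S 0 (\<lambda>z. exp z - 1 / \<tau> j) (exp A - 1 / \<tau> j)" for j
    by (rule branch_at_holomorphic[of _ _ 1]) (auto intro!: holomorphic_intros An)
  from branch_at_mult[OF this br]
  have "branch_at A ?S e (raise N \<tau> R w i) (\<Sum>j<N. R i j * ((exp A - 1 / \<tau> j) * L j))"
    unfolding raise_def[abs_def] by (intro branch_at_sum branch_at_cmult An) simp
  then obtain v where v: "branch_at A ?S e (raise N \<tau> R w i) v" by blast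
  have dr: "exp z * w i z = deriv (raise N \<tau> R w i) z" if "z \<in> ?S" for z
    using raise_properties(2)[OF w R \<tau> i that] by simp
  have q: "branch_at A ?S e (deriv (raise N \<tau> R w i)) (exp A * L i)"
    by (rule branch_at_cong[OF _ dr]) (use branch_at_mult[OF ex br[OF i]] in simp_all)
  have "e * v = 0"
    by (rule branch_at_unique[OF A branch_at_deriv[OF A v] branch_at_lower[OF q An]])
  then have "v = 0" using e by simp
  then obtain v' where v': "branch_at A ?S (e + 1) (raise N \<tau> R w i) v'"
    using branch_at_lift[of A ?S e "raise N \<tau> R w i"] v An by blast
  have "(e + 1) * v' = exp A * L i"
    using branch_at_unique[OF A _ q] branch_at_deriv[OF A v'] by simp
  then have "v' = exp A * L i / (e + 1)" using e by (simp add: field_simps)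
  then show ?thesis using v' by simp
qed

primrec iterated_raise :: "nat \<Rightarrow> (nat \<Rightarrow> complex) \<Rightarrow> (nat \<Rightarrow> nat \<Rightarrow> nat \<Rightarrow> complex) \<Rightarrow> (nat \<Rightarrow> complex \<Rightarrow> complex) \<Rightarrow> nat \<Rightarrow> nat \<Rightarrow> complex \<Rightarrow> complex" where
  "iterated_raise N \<tau> R w 0 = w"
| "iterated_raise N \<tau> R w (Suc m) = raise N \<tau> (R m) (iterated_raise N \<tau> R w m)"

text \<open>Each step divides the leading coefficient by the new exponent. The resulting Pochhammer
  symbol is cancelled later by the derivatives in e^z.\<close>

lemma iterated_raise_properties:
  assumes A: "edge_point a b A" and w: "okubo_level N M \<tau> 0 (strip a b) w"
    and R: "\<And>m. shifted_inverse N M (of_nat (Suc m)) (R m)"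
    and \<tau>: "\<And>i. i < N \<Longrightarrow> \<tau> i \<noteq> 0" and br: "\<And>i. i < N \<Longrightarrow> branch_at A (strip a b) e (w i) (L i)"
    and e: "e \<notin> \<int>"
  shows "okubo_level N M \<tau> (of_nat m) (strip a b) (iterated_raise N \<tau> R w m)"
    "\<And>i. i < N \<Longrightarrow> branch_at A (strip a b) (e + of_nat m) (iterated_raise N \<tau> R w m i) (exp (of_nat m * A) * L i / pochhammer (e + 1) m)"
proof (induction m)
  case 0
  { case 1 show ?case using w by simp }
  { case 2 then show ?case using br by simp }
next
  case (Suc m)
  have ne: "e + of_nat n \<noteq> 0" for n
  proof
    assume "e + of_nat n = 0"
    then have "e = of_int (- int n)" by (simp add: eq_neg_iff_add_eq_0)
    then show False using e by simp
  qed
  have R': "shifted_inverse N M (of_nat m + 1) (R m)" using R[of m] by (simp add: add.commute)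
  { case 1 show ?case using raise_properties(1)[OF Suc.IH(1) R' \<tau>] by (simp add: add.commute) }
  { case (2 i)
    have "branch_at A (strip a b) (e + of_nat m + 1) (raise N \<tau> (R m) (iterated_raise N \<tau> R w m) i)
       (exp A * (exp (of_nat m * A) * L i / pochhammer (e + 1) m) / (e + of_nat m + 1))"
      using ne[of m] ne[of "Suc m"]
      by (intro raise_branch[OF A Suc.IH(1) R' \<tau> Suc.IH(2) _ _ 2]) (auto simp: add_ac)
    moreover have "exp (of_nat (Suc m) * A) = exp A * exp (of_nat m * A)"
      by (simp add: distrib_right exp_add)
    ultimately show ?case
      by (simp add: pochhammer_Suc add_ac mult_ac del: of_nat_Suc) (simp add: add_ac) }
qed

section \<open>Undoing the raised exponents by derivatives in e^z\<close>

text \<open>The derivative with respect to \<open>e\<^sup>z\<close>.\<close>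

definition zeta_deriv :: "(complex \<Rightarrow> complex) \<Rightarrow> complex \<Rightarrow> complex" where
  "zeta_deriv f z = exp (- z) * deriv f z"

lemma zeta_deriv_holomorphic: "f holomorphic_on S \<Longrightarrow> open S \<Longrightarrow> zeta_deriv f holomorphic_on S"
  unfolding zeta_deriv_def[abs_def] by (intro holomorphic_intros holomorphic_deriv)

lemma zeta_deriv_branch:
  assumes A: "edge_point a b A" and "branch_at A (strip a b) e f L"
  shows "branch_at A (strip a b) (e - 1) (zeta_deriv f) (exp (- A) * (e * L))"
  using branch_at_mult[OF branch_at_exp[OF edge_point_notin[OF A], of "-1"] branch_at_deriv[OF assms]]
  by (simp add: zeta_deriv_def[abs_def])

text \<open>For exponent 0 differentiation gives exponent -1 with coefficient 0, which lifts back to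
  exponent 0.\<close>

lemma zeta_deriv_regular:
  assumes A: "edge_point a b A" and "branch_at A (strip a b) 0 f L"
  shows "\<exists>L'. branch_at A (strip a b) 0 (zeta_deriv f) L'"
  using branch_at_lift[of A "strip a b" "-1" "zeta_deriv f"] zeta_deriv_branch[OF assms] edge_point_notin[OF A] by auto

lemma iterated_zeta_deriv_holomorphic: "f holomorphic_on S \<Longrightarrow> open S \<Longrightarrow> (zeta_deriv ^^ n) f holomorphic_on S"
  by (induction n) (auto intro: zeta_deriv_holomorphic)

lemma iterated_zeta_deriv_branch:
  assumes A: "edge_point a b A"
  shows "branch_at A (strip a b) (e + of_nat n) f L \<Longrightarrow>
    branch_at A (strip a b) e ((zeta_deriv ^^ n) f) (exp (- of_nat n * A) * (pochhammer (e + 1) n * L))"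
proof (induction n arbitrary: f L)
  case (Suc n)
  have "branch_at A (strip a b) (e + of_nat n) (zeta_deriv f) (exp (- A) * ((e + of_nat (Suc n)) * L))"
    using zeta_deriv_branch[OF A Suc.prems] by simp
  from Suc.IH[OF this] show ?case
    by (simp add: funpow_swap1 pochhammer_Suc exp_diff exp_minus exp_add divide_inverse algebra_simps)
qed simp

lemma zeta_deriv_diff_sum:
  assumes S: "open S" and f: "f holomorphic_on S" and g: "\<And>i. i \<in> I \<Longrightarrow> g i holomorphic_on S" and z: "z \<in> S"
  shows "zeta_deriv (\<lambda>z. f z - (\<Sum>i\<in>I. C i * g i z)) z = zeta_deriv f z - (\<Sum>i\<in>I. C i * zeta_deriv (g i) z)"
proof -
  have "((\<lambda>z. f z - (\<Sum>i\<in>I. C i * g i z)) has_field_derivative deriv f z - (\<Sum>i\<in>I. C i * deriv (g i) z)) (at z)"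
    by (intro DERIV_diff DERIV_sum DERIV_cmult holomorphic_derivI[OF _ S z] f g)
  then have "deriv (\<lambda>z. f z - (\<Sum>i\<in>I. C i * g i z)) z = deriv f z - (\<Sum>i\<in>I. C i * deriv (g i) z)" by (rule DERIV_imp_deriv)
  then show ?thesis by (simp add: zeta_deriv_def right_diff_distrib sum_distrib_left mult_ac)
qed

lemma iterated_zeta_deriv_connection:
  assumes B: "edge_point a b B" and f: "f holomorphic_on strip a b" and g: "\<And>i. i \<in> I \<Longrightarrow> g i holomorphic_on strip a b"
    and reg: "branch_at B (strip a b) 0 (\<lambda>z. f z - (\<Sum>i\<in>I. C i * g i z)) L"
  shows "\<exists>L'. branch_at B (strip a b) 0 (\<lambda>z. (zeta_deriv ^^ n) f z - (\<Sum>i\<in>I. C i * (zeta_deriv ^^ n) (g i) z)) L'"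
proof (induction n)
  case 0
  then show ?case using reg by auto
next
  case (Suc n)
  then obtain v where v: "branch_at B (strip a b) 0 (\<lambda>z. (zeta_deriv ^^ n) f z - (\<Sum>i\<in>I. C i * (zeta_deriv ^^ n) (g i) z)) v" by blast
  obtain v' where v': "branch_at B (strip a b) 0 (zeta_deriv (\<lambda>z. (zeta_deriv ^^ n) f z - (\<Sum>i\<in>I. C i * (zeta_deriv ^^ n) (g i) z))) v'"
    using zeta_deriv_regular[OF B v] by blast
  have "branch_at B (strip a b) 0 (\<lambda>z. (zeta_deriv ^^ Suc n) f z - (\<Sum>i\<in>I. C i * (zeta_deriv ^^ Suc n) (g i) z)) v'"
    by (rule branch_at_cong[OF v'])
       (simp add: zeta_deriv_diff_sum[OF strip_open iterated_zeta_deriv_holomorphic[OF f strip_open] iterated_zeta_deriv_holomorphic[OF g strip_open]])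
  then show ?case by blast
qed

section \<open>Differential relations for the convolutions\<close>

text \<open>The relations between the convolutions \<open>X\<close> and \<open>Y\<close> of a solution with the kernels \<open>e\<^bsup>cz\<^esup> \<kappa>\<close> and
  \<open>e\<^bsup>(c+1)z\<^esup> \<kappa>\<close>. Differentiation with respect to \<open>e\<^sup>z\<close> lowers \<open>c\<close> by 1; at \<open>c = 0\<close> the elimination of \<open>Y\<close>
  gives the equation for \<open>e\<^bsup>\<sigma>z\<^esup> \<tau> u\<close>.\<close>

definition kernel_pair ::
  "nat \<Rightarrow> (nat \<Rightarrow> nat \<Rightarrow> complex) \<Rightarrow> (nat \<Rightarrow> complex) \<Rightarrow> complex \<Rightarrow> complex \<Rightarrow> complex \<Rightarrow> complex set \<Rightarrow>
   (nat \<Rightarrow> complex \<Rightarrow> complex) \<Rightarrow> (nat \<Rightarrow> complex \<Rightarrow> complex) \<Rightarrow> bool" where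
  "kernel_pair N M \<tau> \<rho>1 \<rho>2 c S X Y \<longleftrightarrow> (\<forall>i<N. X i holomorphic_on S \<and> Y i holomorphic_on S \<and> (\<forall>z\<in>S.
     deriv (Y i) z = \<tau> i * exp z * (deriv (X i) z - (c - 1) * X i z - (\<Sum>j<N. M i j * X j z)) \<and>
     deriv (deriv (X i)) z - (2 * c + \<rho>1 + \<rho>2) * deriv (X i) z + (c + \<rho>1) * (c + \<rho>2) * X i z
       = deriv (deriv (Y i)) z - (2 * c + 1 + \<rho>1 + \<rho>2) * deriv (Y i) z + c * (c + 1 + \<rho>1 + \<rho>2) * Y i z))"

lemma zeta_deriv_derivs:
  assumes S: "open S" and f: "f holomorphic_on S" and z: "z \<in> S"
  shows "deriv f z = exp z * zeta_deriv f z"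
    "deriv (deriv f) z = exp z * (deriv (zeta_deriv f) z + zeta_deriv f z)"
    "deriv (deriv (deriv f)) z = exp z * (deriv (deriv (zeta_deriv f)) z + 2 * deriv (zeta_deriv f) z + zeta_deriv f z)"
proof -
  let ?g = "zeta_deriv f"
  have g: "?g holomorphic_on S" by (rule zeta_deriv_holomorphic[OF f S])
  have g': "deriv ?g holomorphic_on S" by (rule holomorphic_deriv[OF g S])
  have 1: "deriv f x = exp x * ?g x" for x by (simp add: zeta_deriv_def exp_minus)
  show "deriv f z = exp z * ?g z" by (rule 1)
  have 2: "deriv (deriv f) x = exp x * (deriv ?g x + ?g x)" if x: "x \<in> S" for x
  proof -
    have d: "(?g has_field_derivative deriv ?g x) (at x)" by (rule holomorphic_derivI[OF g S x])
    have "((\<lambda>x. exp x * ?g x) has_field_derivative exp x * (deriv ?g x + ?g x)) (at x)"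
      by (rule derivative_eq_intros d refl | simp)+ (simp add: algebra_simps)
    then show ?thesis unfolding 1[abs_def] by (rule DERIV_imp_deriv)
  qed
  show "deriv (deriv f) z = exp z * (deriv ?g z + ?g z)" by (rule 2[OF z])
  have d: "(?g has_field_derivative deriv ?g z) (at z)" "(deriv ?g has_field_derivative deriv (deriv ?g) z) (at z)"
    by (rule holomorphic_derivI[OF g S z], rule holomorphic_derivI[OF g' S z])
  have "((\<lambda>x. exp x * (deriv ?g x + ?g x)) has_field_derivative exp z * (deriv (deriv ?g) z + 2 * deriv ?g z + ?g z)) (at z)"
    by (rule derivative_eq_intros d refl | simp)+ (simp add: algebra_simps)
  then have "(deriv (deriv f) has_field_derivative exp z * (deriv (deriv ?g) z + 2 * deriv ?g z + ?g z)) (at z)"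
    by (rule has_field_derivative_transform_within_open[OF _ S z]) (simp add: 2)
  then show "deriv (deriv (deriv f)) z = exp z * (deriv (deriv ?g) z + 2 * deriv ?g z + ?g z)" by (rule DERIV_imp_deriv)
qed

text \<open>The second relation is (D - c - \<rho>1)(D - c - \<rho>2) X = (D - c)(D - c - 1 -
  \<sigma>) Y. Since D X = e^z times the new X and D e^z = e^z (D + 1), applying D replaces each D -
  c by D - (c - 1). In the first relation e^z is divided out before differentiating.\<close>

lemma kernel_pair_step:
  assumes S: "open S" and p: "kernel_pair N M \<tau> \<rho>1 \<rho>2 c S X Y"
  shows "kernel_pair N M \<tau> \<rho>1 \<rho>2 (c - 1) S (\<lambda>i. zeta_deriv (X i)) (\<lambda>i. zeta_deriv (Y i))"
  unfolding kernel_pair_def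
proof (intro allI impI conjI ballI)
  fix i assume i: "i < N"
  have X: "X j holomorphic_on S" if "j < N" for j using p that by (simp add: kernel_pair_def)
  have Y: "Y i holomorphic_on S" using p i by (simp add: kernel_pair_def)
  show "zeta_deriv (X i) holomorphic_on S" "zeta_deriv (Y i) holomorphic_on S" by (intro zeta_deriv_holomorphic X Y S i)+
  fix z assume z: "z \<in> S"
  have E1: "deriv (Y i) x = \<tau> i * exp x * (deriv (X i) x - (c - 1) * X i x - (\<Sum>j<N. M i j * X j x))" if "x \<in> S" for x
    using p i that unfolding kernel_pair_def by blast
  have E2: "deriv (deriv (X i)) x - (2 * c + \<rho>1 + \<rho>2) * deriv (X i) x + (c + \<rho>1) * (c + \<rho>2) * X i x
       = deriv (deriv (Y i)) x - (2 * c + 1 + \<rho>1 + \<rho>2) * deriv (Y i) x + c * (c + 1 + \<rho>1 + \<rho>2) * Y i x" if "x \<in> S" for x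
    using p i that unfolding kernel_pair_def by blast
  have dX: "(X j has_field_derivative deriv (X j) z) (at z)" if "j < N" for j by (rule holomorphic_derivI[OF X[OF that] S z])
  have dX2: "(deriv (X i) has_field_derivative deriv (deriv (X i)) z) (at z)"
    by (rule holomorphic_derivI[OF holomorphic_deriv[OF X[OF i] S] S z])
  have dX3: "(deriv (deriv (X i)) has_field_derivative deriv (deriv (deriv (X i))) z) (at z)"
    by (rule holomorphic_derivI[OF holomorphic_deriv[OF holomorphic_deriv[OF X[OF i] S] S] S z])
  have dY: "(Y i has_field_derivative deriv (Y i) z) (at z)" by (rule holomorphic_derivI[OF Y S z])
  have dY2: "(deriv (Y i) has_field_derivative deriv (deriv (Y i)) z) (at z)"
    by (rule holomorphic_derivI[OF holomorphic_deriv[OF Y S] S z])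
  have dY3: "(deriv (deriv (Y i)) has_field_derivative deriv (deriv (deriv (Y i))) z) (at z)"
    by (rule holomorphic_derivI[OF holomorphic_deriv[OF holomorphic_deriv[OF Y S] S] S z])
  show "deriv (zeta_deriv (Y i)) z = \<tau> i * exp z * (deriv (zeta_deriv (X i)) z - (c - 1 - 1) * zeta_deriv (X i) z - (\<Sum>j<N. M i j * zeta_deriv (X j) z))"
  proof -
    have e: "zeta_deriv (Y i) x = \<tau> i * (deriv (X i) x - (c - 1) * X i x - (\<Sum>j<N. M i j * X j x))" if "x \<in> S" for x
      using E1[OF that] by (simp add: zeta_deriv_def exp_minus)
    have "((\<lambda>x. \<tau> i * (deriv (X i) x - (c - 1) * X i x - (\<Sum>j<N. M i j * X j x))) has_field_derivative
        \<tau> i * (deriv (deriv (X i)) z - (c - 1) * deriv (X i) z - (\<Sum>j<N. M i j * deriv (X j) z))) (at z)"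
      by (intro DERIV_cmult DERIV_diff DERIV_sum dX dX2 i) simp
    then have "(zeta_deriv (Y i) has_field_derivative
        \<tau> i * (deriv (deriv (X i)) z - (c - 1) * deriv (X i) z - (\<Sum>j<N. M i j * deriv (X j) z))) (at z)"
      by (rule has_field_derivative_transform_within_open[OF _ S z]) (simp add: e)
    then have "deriv (zeta_deriv (Y i)) z = \<tau> i * (deriv (deriv (X i)) z - (c - 1) * deriv (X i) z - (\<Sum>j<N. M i j * deriv (X j) z))"
      by (rule DERIV_imp_deriv)
    moreover have "(\<Sum>j<N. M i j * deriv (X j) z) = exp z * (\<Sum>j<N. M i j * zeta_deriv (X j) z)"
      by (simp add: sum_distrib_left zeta_deriv_derivs(1)[OF S X z] mult_ac)
    ultimately show ?thesis
      by (simp only: zeta_deriv_derivs(1,2)[OF S X[OF i] z]) (simp add: algebra_simps)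
  qed
  have "((\<lambda>x. deriv (deriv (X i)) x - (2 * c + \<rho>1 + \<rho>2) * deriv (X i) x + (c + \<rho>1) * (c + \<rho>2) * X i x) has_field_derivative
      deriv (deriv (deriv (X i))) z - (2 * c + \<rho>1 + \<rho>2) * deriv (deriv (X i)) z + (c + \<rho>1) * (c + \<rho>2) * deriv (X i) z) (at z)"
    by (intro DERIV_add DERIV_diff DERIV_cmult dX dX2 dX3 i)
  then have l: "((\<lambda>x. deriv (deriv (Y i)) x - (2 * c + 1 + \<rho>1 + \<rho>2) * deriv (Y i) x + c * (c + 1 + \<rho>1 + \<rho>2) * Y i x) has_field_derivative
      deriv (deriv (deriv (X i))) z - (2 * c + \<rho>1 + \<rho>2) * deriv (deriv (X i)) z + (c + \<rho>1) * (c + \<rho>2) * deriv (X i) z) (at z)"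
    by (rule has_field_derivative_transform_within_open[OF _ S z]) (rule E2)
  have r: "((\<lambda>x. deriv (deriv (Y i)) x - (2 * c + 1 + \<rho>1 + \<rho>2) * deriv (Y i) x + c * (c + 1 + \<rho>1 + \<rho>2) * Y i x) has_field_derivative
      deriv (deriv (deriv (Y i))) z - (2 * c + 1 + \<rho>1 + \<rho>2) * deriv (deriv (Y i)) z + c * (c + 1 + \<rho>1 + \<rho>2) * deriv (Y i) z) (at z)"
    by (intro DERIV_add DERIV_diff DERIV_cmult dY dY2 dY3)
  from DERIV_unique[OF l r]
  have "exp z * (deriv (deriv (zeta_deriv (X i))) z - (2 * (c - 1) + \<rho>1 + \<rho>2) * deriv (zeta_deriv (X i)) z + (c - 1 + \<rho>1) * (c - 1 + \<rho>2) * zeta_deriv (X i) z)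
     = exp z * (deriv (deriv (zeta_deriv (Y i))) z - (2 * (c - 1) + 1 + \<rho>1 + \<rho>2) * deriv (zeta_deriv (Y i)) z + (c - 1) * (c - 1 + 1 + \<rho>1 + \<rho>2) * zeta_deriv (Y i) z)"
    unfolding zeta_deriv_derivs[OF S X[OF i] z] zeta_deriv_derivs[OF S Y z]
  proof -
    have ring: "E * (v2 - (2 * (c - 1) + \<rho>1 + \<rho>2) * v1 + (c - 1 + \<rho>1) * (c - 1 + \<rho>2) * v0)
       = E * (v2 + 2 * v1 + v0) - (2 * c + \<rho>1 + \<rho>2) * (E * (v1 + v0)) + (c + \<rho>1) * (c + \<rho>2) * (E * v0)"
      "E * (v2 - (2 * (c - 1) + 1 + \<rho>1 + \<rho>2) * v1 + (c - 1) * (c - 1 + 1 + \<rho>1 + \<rho>2) * v0)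
       = E * (v2 + 2 * v1 + v0) - (2 * c + 1 + \<rho>1 + \<rho>2) * (E * (v1 + v0)) + c * (c + 1 + \<rho>1 + \<rho>2) * (E * v0)"
      for E v0 v1 v2 :: complex by (simp_all add: algebra_simps)
    assume "exp z * (deriv (deriv (zeta_deriv (X i))) z + 2 * deriv (zeta_deriv (X i)) z + zeta_deriv (X i) z)
        - (2 * c + \<rho>1 + \<rho>2) * (exp z * (deriv (zeta_deriv (X i)) z + zeta_deriv (X i) z)) + (c + \<rho>1) * (c + \<rho>2) * (exp z * zeta_deriv (X i) z)
      = exp z * (deriv (deriv (zeta_deriv (Y i))) z + 2 * deriv (zeta_deriv (Y i)) z + zeta_deriv (Y i) z)
        - (2 * c + 1 + \<rho>1 + \<rho>2) * (exp z * (deriv (zeta_deriv (Y i)) z + zeta_deriv (Y i) z)) + c * (c + 1 + \<rho>1 + \<rho>2) * (exp z * zeta_deriv (Y i) z)"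
    then show ?thesis unfolding ring .
  qed
  then show "deriv (deriv (zeta_deriv (X i))) z - (2 * (c - 1) + \<rho>1 + \<rho>2) * deriv (zeta_deriv (X i)) z + (c - 1 + \<rho>1) * (c - 1 + \<rho>2) * zeta_deriv (X i) z
     = deriv (deriv (zeta_deriv (Y i))) z - (2 * (c - 1) + 1 + \<rho>1 + \<rho>2) * deriv (zeta_deriv (Y i)) z + (c - 1) * (c - 1 + 1 + \<rho>1 + \<rho>2) * zeta_deriv (Y i) z"
    by (simp only: mult_cancel_left exp_not_eq_zero simp_thms)
qed

lemma kernel_pair_iterate:
  assumes S: "open S"
  shows "kernel_pair N M \<tau> \<rho>1 \<rho>2 (of_nat n) S X Y \<Longrightarrow>
    kernel_pair N M \<tau> \<rho>1 \<rho>2 0 S (\<lambda>i. (zeta_deriv ^^ n) (X i)) (\<lambda>i. (zeta_deriv ^^ n) (Y i))"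
proof (induction n arbitrary: X Y)
  case (Suc n)
  have "kernel_pair N M \<tau> \<rho>1 \<rho>2 (of_nat n) S (\<lambda>i. zeta_deriv (X i)) (\<lambda>i. zeta_deriv (Y i))"
    using kernel_pair_step[OF S Suc.prems] by simp
  from Suc.IH[OF this] show ?case by (simp add: funpow_swap1)
qed simp

text \<open>At c = 0 the second relation contains Y only through D Y, which the first relation
  expresses by X. Putting X_i = \<tau>_i e^{\<sigma>z} u_i turns (D - \<rho>1)(D - \<rho>2) into (D
  + \<rho>2)(D + \<rho>1), because \<sigma> - \<rho>1 = \<rho>2.\<close>

lemma kernel_pair_extension_equation:
  assumes S: "open S" and p: "kernel_pair N M \<tau> \<rho>1 \<rho>2 0 S X Y" and \<tau>: "\<And>i. i < N \<Longrightarrow> \<tau> i \<noteq> 0"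
  shows "extension_equation N M \<tau> \<rho>1 \<rho>2 S (\<lambda>i z. exp (- (\<rho>1 + \<rho>2) * z) * X i z / \<tau> i)"
  unfolding extension_equation_def
proof (intro allI impI conjI ballI)
  fix i assume i: "i < N"
  define \<sigma> where "\<sigma> = \<rho>1 + \<rho>2"
  define u where "u = (\<lambda>i z. exp (- \<sigma> * z) * X i z / \<tau> i)"
  have X: "X j holomorphic_on S" if "j < N" for j using p that by (simp add: kernel_pair_def)
  have Y: "Y i holomorphic_on S" using p i by (simp add: kernel_pair_def)
  have u: "u j holomorphic_on S" if "j < N" for j
    unfolding u_def using \<tau>[OF that] by (intro holomorphic_intros X that)
  show "(\<lambda>z. exp (- (\<rho>1 + \<rho>2) * z) * X i z / \<tau> i) holomorphic_on S" using u[OF i] by (simp add: u_def \<sigma>_def)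
  fix z assume z: "z \<in> S"
  have Xu: "X j x = \<tau> j * (exp (\<sigma> * x) * u j x)" if "j < N" for j x
    using \<tau>[OF that] by (simp add: u_def exp_minus)
  have du: "(u j has_field_derivative deriv (u j) x) (at x)" if "j < N" "x \<in> S" for j x
    by (rule holomorphic_derivI[OF u[OF that(1)] S that(2)])
  have du2: "(deriv (u j) has_field_derivative deriv (deriv (u j)) x) (at x)" if "j < N" "x \<in> S" for j x
    by (rule holomorphic_derivI[OF holomorphic_deriv[OF u[OF that(1)] S] S that(2)])
  have X1: "deriv (X j) x = \<tau> j * (exp (\<sigma> * x) * (deriv (u j) x + \<sigma> * u j x))" if "j < N" "x \<in> S" for j x
  proof -
    have "((\<lambda>x. \<tau> j * (exp (\<sigma> * x) * u j x)) has_field_derivative \<tau> j * (exp (\<sigma> * x) * (deriv (u j) x + \<sigma> * u j x))) (at x)"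
      by (rule derivative_eq_intros du[OF that] refl | simp)+ (simp add: algebra_simps)
    then show ?thesis unfolding Xu[OF that(1), abs_def] by (rule DERIV_imp_deriv)
  qed
  have X2: "deriv (deriv (X j)) x = \<tau> j * (exp (\<sigma> * x) * (deriv (deriv (u j)) x + 2 * \<sigma> * deriv (u j) x + \<sigma>\<^sup>2 * u j x))" if "j < N" "x \<in> S" for j x
  proof -
    have "((\<lambda>x. \<tau> j * (exp (\<sigma> * x) * (deriv (u j) x + \<sigma> * u j x))) has_field_derivative
       \<tau> j * (exp (\<sigma> * x) * (deriv (deriv (u j)) x + 2 * \<sigma> * deriv (u j) x + \<sigma>\<^sup>2 * u j x))) (at x)"
      by (rule derivative_eq_intros du[OF that] du2[OF that] refl | simp)+ (simp add: algebra_simps power2_eq_square)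
    then have "(deriv (X j) has_field_derivative
       \<tau> j * (exp (\<sigma> * x) * (deriv (deriv (u j)) x + 2 * \<sigma> * deriv (u j) x + \<sigma>\<^sup>2 * u j x))) (at x)"
      by (rule has_field_derivative_transform_within_open[OF _ S that(2)]) (simp add: X1[OF that(1)])
    then show ?thesis by (rule DERIV_imp_deriv)
  qed
  define Q where "Q = (\<lambda>x. deriv (X i) x + X i x - (\<Sum>j<N. M i j * X j x))"
  have E1: "deriv (Y i) x = \<tau> i * (exp x * Q x)" if "x \<in> S" for x
    using p i that unfolding kernel_pair_def Q_def by (simp add: mult.assoc)
  have E2: "deriv (deriv (X i)) z - \<sigma> * deriv (X i) z + \<rho>1 * \<rho>2 * X i z = deriv (deriv (Y i)) z - (1 + \<sigma>) * deriv (Y i) z"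
    using p i z unfolding kernel_pair_def \<sigma>_def by (simp add: add.assoc)
  have dX: "(X j has_field_derivative deriv (X j) z) (at z)" if "j < N" for j by (rule holomorphic_derivI[OF X[OF that] S z])
  have dX2: "(deriv (X i) has_field_derivative deriv (deriv (X i)) z) (at z)"
    by (rule holomorphic_derivI[OF holomorphic_deriv[OF X[OF i] S] S z])
  define Q' where "Q' = deriv (deriv (X i)) z + deriv (X i) z - (\<Sum>j<N. M i j * deriv (X j) z)"
  have dQ: "(Q has_field_derivative Q') (at z)"
    unfolding Q_def Q'_def by (intro DERIV_diff DERIV_add DERIV_sum DERIV_cmult dX dX2 i) simp
  have "((\<lambda>x. \<tau> i * (exp x * Q x)) has_field_derivative \<tau> i * (exp z * (Q z + Q'))) (at z)"
    by (rule derivative_eq_intros dQ refl | simp)+ (simp add: algebra_simps)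
  then have "(deriv (Y i) has_field_derivative \<tau> i * (exp z * (Q z + Q'))) (at z)"
    by (rule has_field_derivative_transform_within_open[OF _ S z]) (simp add: E1)
  then have "deriv (deriv (Y i)) z = \<tau> i * (exp z * (Q z + Q'))" by (rule DERIV_imp_deriv)
  with E2 E1[OF z] have main: "deriv (deriv (X i)) z - \<sigma> * deriv (X i) z + \<rho>1 * \<rho>2 * X i z = \<tau> i * (exp z * (Q' - \<sigma> * Q z))"
    by (simp add: algebra_simps)
  define s0 s1 where "s0 = (\<Sum>j<N. M i j * (\<tau> j * u j z))" and "s1 = (\<Sum>j<N. M i j * (\<tau> j * deriv (u j) z))"
  have S0: "(\<Sum>j<N. M i j * X j z) = exp (\<sigma> * z) * s0" by (simp add: Xu s0_def sum_distrib_left mult_ac)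
  have S1: "(\<Sum>j<N. M i j * deriv (X j) z) = exp (\<sigma> * z) * (s1 + \<sigma> * s0)"
    by (simp add: X1 z s0_def s1_def sum_distrib_left distrib_left sum.distrib mult_ac)
  have "(\<tau> i * exp (\<sigma> * z)) * (deriv (deriv (u i)) z + \<sigma> * deriv (u i) z + \<rho>1 * \<rho>2 * u i z)
      = (\<tau> i * exp (\<sigma> * z)) * (\<tau> i * exp z * (deriv (deriv (u i)) z + (1 + \<sigma>) * deriv (u i) z) - exp z * s1)"
  proof -
    \<comment> \<open>A polynomial identity with T, E, Z standing for \<tau>_i, e^{\<sigma>z}, e^z
      and s0, s1 for the sums over M. It expresses the defect of the equation for u through the
      defect of \<open>main\<close>.\<close>
    have ring: "(T * E) * (u2 + \<sigma> * u1 + r * u0) - (T * E) * (T * Z * (u2 + (1 + \<sigma>) * u1) - Z * s1)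
      = (T * (E * (u2 + 2 * \<sigma> * u1 + \<sigma>\<^sup>2 * u0)) - \<sigma> * (T * (E * (u1 + \<sigma> * u0))) + r * (T * (E * u0)))
        - T * (Z * ((T * (E * (u2 + 2 * \<sigma> * u1 + \<sigma>\<^sup>2 * u0)) + T * (E * (u1 + \<sigma> * u0)) - E * (s1 + \<sigma> * s0))
            - \<sigma> * (T * (E * (u1 + \<sigma> * u0)) + T * (E * u0) - E * s0)))" for T E Z r u0 u1 u2 :: complex
      by (simp add: algebra_simps power2_eq_square)
    show ?thesis
      using main unfolding Q'_def Q_def S0 S1 unfolding X1[OF i z] X2[OF i z] Xu[OF i, of z]
      by (subst eq_iff_diff_eq_0, subst ring) simp
  qed
  moreover have "\<tau> i * exp (\<sigma> * z) \<noteq> 0" using \<tau>[OF i] by simp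
  ultimately have "deriv (deriv (u i)) z + \<sigma> * deriv (u i) z + \<rho>1 * \<rho>2 * u i z
      = \<tau> i * exp z * (deriv (deriv (u i)) z + (1 + \<sigma>) * deriv (u i) z) - exp z * s1"
    by (simp only: mult_cancel_left simp_thms)
  then have "deriv (deriv (u i)) z + \<sigma> * deriv (u i) z + \<rho>1 * \<rho>2 * u i z
      = \<tau> i * exp z * (deriv (deriv (u i)) z + (1 + \<sigma>) * deriv (u i) z) - (\<Sum>j<N. M i j * (\<tau> j * exp z * deriv (u j) z))"
    by (simp add: s1_def sum_distrib_left mult_ac)
  then show "deriv (deriv (\<lambda>z. exp (- (\<rho>1 + \<rho>2) * z) * X i z / \<tau> i)) z + (\<rho>1 + \<rho>2) * deriv (\<lambda>z. exp (- (\<rho>1 + \<rho>2) * z) * X i z / \<tau> i) z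
      + \<rho>1 * \<rho>2 * (exp (- (\<rho>1 + \<rho>2) * z) * X i z / \<tau> i)
      = \<tau> i * exp z * (deriv (deriv (\<lambda>z. exp (- (\<rho>1 + \<rho>2) * z) * X i z / \<tau> i)) z + (1 + \<rho>1 + \<rho>2) * deriv (\<lambda>z. exp (- (\<rho>1 + \<rho>2) * z) * X i z / \<tau> i) z)
        - (\<Sum>j<N. M i j * (\<tau> j * exp z * deriv (\<lambda>z. exp (- (\<rho>1 + \<rho>2) * z) * X j z / \<tau> j) z))"
    unfolding u_def \<sigma>_def by (simp only: add.assoc)
qed

text \<open>Multiplication by e^{cz} replaces D by D - c. The kernel equation thereby becomes the
  second relation of \<open>kernel_pair\<close>, with k for X and l for Y.\<close>

lemma shifted_kernel:
  fixes \<kappa> :: "complex \<Rightarrow> complex" and c \<rho>1 \<rho>2 :: complex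
  assumes k: "\<kappa> holomorphic_on exp_slit"
    "\<And>z. z \<in> exp_slit \<Longrightarrow> deriv (deriv \<kappa>) z - (\<rho>1 + \<rho>2) * deriv \<kappa> z + \<rho>1 * \<rho>2 * \<kappa> z
       = exp z * (deriv (deriv \<kappa>) z + (1 - (\<rho>1 + \<rho>2)) * deriv \<kappa> z - (\<rho>1 + \<rho>2) * \<kappa> z)"
    and k_def: "k = (\<lambda>z. exp (c * z) * \<kappa> z)" and l_def: "l = (\<lambda>z. exp z * k z)"
    and z: "z \<in> exp_slit"
  shows "deriv k z = exp (c * z) * (c * \<kappa> z + deriv \<kappa> z)"
    "deriv l z = exp z * (k z + deriv k z)"
    "deriv (deriv k) z + (- (2 * c + \<rho>1 + \<rho>2) * deriv k z + (c + \<rho>1) * (c + \<rho>2) * k z)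
      = deriv (deriv l) z + (- (2 * c + 1 + \<rho>1 + \<rho>2) * deriv l z + c * (c + 1 + \<rho>1 + \<rho>2) * l z)"
proof -
  note S = exp_slit_props(1)
  have d0: "(\<kappa> has_field_derivative deriv \<kappa> x) (at x)" if "x \<in> exp_slit" for x
    by (rule holomorphic_derivI[OF k(1) S that])
  have d1: "(deriv \<kappa> has_field_derivative deriv (deriv \<kappa>) x) (at x)" if "x \<in> exp_slit" for x
    by (rule holomorphic_derivI[OF holomorphic_deriv[OF k(1) S] S that])
  have k1: "(k has_field_derivative exp (c * x) * (c * \<kappa> x + deriv \<kappa> x)) (at x)" if "x \<in> exp_slit" for x
    unfolding k_def by (rule derivative_eq_intros d0[OF that] refl | simp)+ (simp add: algebra_simps)
  have l1: "(l has_field_derivative exp x * (exp (c * x) * (c * \<kappa> x + deriv \<kappa> x + \<kappa> x))) (at x)" if "x \<in> exp_slit" for x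
    unfolding l_def by (rule derivative_eq_intros k1[OF that] refl | simp)+ (simp add: k_def algebra_simps)
  have k2: "(deriv k has_field_derivative exp (c * z) * (c\<^sup>2 * \<kappa> z + 2 * c * deriv \<kappa> z + deriv (deriv \<kappa>) z)) (at z)"
  proof -
    have "((\<lambda>x. exp (c * x) * (c * \<kappa> x + deriv \<kappa> x)) has_field_derivative
        exp (c * z) * (c\<^sup>2 * \<kappa> z + 2 * c * deriv \<kappa> z + deriv (deriv \<kappa>) z)) (at z)"
      by (rule derivative_eq_intros d0[OF z] d1[OF z] refl | simp)+ (simp add: algebra_simps power2_eq_square)
    then show ?thesis
      by (rule has_field_derivative_transform_within_open[OF _ S z]) (simp add: DERIV_imp_deriv[OF k1])
  qed
  have l2: "(deriv l has_field_derivative exp z * (exp (c * z) * ((c + 1)\<^sup>2 * \<kappa> z + 2 * (c + 1) * deriv \<kappa> z + deriv (deriv \<kappa>) z))) (at z)"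
  proof -
    have "((\<lambda>x. exp x * (exp (c * x) * (c * \<kappa> x + deriv \<kappa> x + \<kappa> x))) has_field_derivative
        exp z * (exp (c * z) * ((c + 1)\<^sup>2 * \<kappa> z + 2 * (c + 1) * deriv \<kappa> z + deriv (deriv \<kappa>) z))) (at z)"
      by (rule derivative_eq_intros d0[OF z] d1[OF z] refl | simp)+ (simp add: algebra_simps power2_eq_square)
    then show ?thesis
      by (rule has_field_derivative_transform_within_open[OF _ S z]) (simp add: DERIV_imp_deriv[OF l1])
  qed
  show "deriv k z = exp (c * z) * (c * \<kappa> z + deriv \<kappa> z)" by (rule DERIV_imp_deriv[OF k1[OF z]])
  show "deriv l z = exp z * (k z + deriv k z)"
    unfolding DERIV_imp_deriv[OF k1[OF z]] DERIV_imp_deriv[OF l1[OF z]] unfolding k_def by (simp add: algebra_simps)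
  have ring1: "E * (c\<^sup>2 * x + 2 * c * y + w) + (- (2 * c + \<rho>1 + \<rho>2) * (E * (c * x + y)) + (c + \<rho>1) * (c + \<rho>2) * (E * x))
      = E * (w - (\<rho>1 + \<rho>2) * y + \<rho>1 * \<rho>2 * x)" for E x y w :: complex
    by (simp add: algebra_simps power2_eq_square)
  have ring2: "F * (E * ((c + 1)\<^sup>2 * x + 2 * (c + 1) * y + w)) + (- (2 * c + 1 + \<rho>1 + \<rho>2) * (F * (E * (c * x + y + x))) + c * (c + 1 + \<rho>1 + \<rho>2) * (F * (E * x)))
      = E * (F * (w + (1 - (\<rho>1 + \<rho>2)) * y - (\<rho>1 + \<rho>2) * x))" for E F x y w :: complex
    by (simp add: algebra_simps power2_eq_square)
  have "deriv (deriv k) z + (- (2 * c + \<rho>1 + \<rho>2) * deriv k z + (c + \<rho>1) * (c + \<rho>2) * k z)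
      = exp (c * z) * (deriv (deriv \<kappa>) z - (\<rho>1 + \<rho>2) * deriv \<kappa> z + \<rho>1 * \<rho>2 * \<kappa> z)"
    unfolding DERIV_imp_deriv[OF k2] DERIV_imp_deriv[OF k1[OF z]] unfolding k_def ring1 by (rule refl)
  also have "\<dots> = exp (c * z) * (exp z * (deriv (deriv \<kappa>) z + (1 - (\<rho>1 + \<rho>2)) * deriv \<kappa> z - (\<rho>1 + \<rho>2) * \<kappa> z))"
    by (simp only: k(2)[OF z])
  also have "\<dots> = deriv (deriv l) z + (- (2 * c + 1 + \<rho>1 + \<rho>2) * deriv l z + c * (c + 1 + \<rho>1 + \<rho>2) * l z)"
    unfolding DERIV_imp_deriv[OF l2] DERIV_imp_deriv[OF l1[OF z]] unfolding l_def k_def ring2 by (rule refl)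
  finally show "deriv (deriv k) z + (- (2 * c + \<rho>1 + \<rho>2) * deriv k z + (c + \<rho>1) * (c + \<rho>2) * k z)
      = deriv (deriv l) z + (- (2 * c + 1 + \<rho>1 + \<rho>2) * deriv l z + c * (c + 1 + \<rho>1 + \<rho>2) * l z)" .
qed

lemma volterra_second_deriv:
  assumes A: "edge_point a b A" and k: "k holomorphic_on exp_slit"
    and f: "f holomorphic_on strip a b" "branch_at A (strip a b) e f L" "Re e > 1" and z: "z \<in> strip a b"
  shows "deriv (volterra A k f) z = k 0 * f z + volterra A (deriv k) f z"
    "deriv (deriv (volterra A k f)) z = k 0 * deriv f z + deriv k 0 * f z + volterra A (deriv (deriv k)) f z"
proof -
  have k': "deriv k holomorphic_on exp_slit" by (rule holomorphic_deriv[OF k exp_slit_props(1)])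
  have d: "deriv (volterra A k f) x = k 0 * f x + volterra A (deriv k) f x" if "x \<in> strip a b" for x
    by (rule DERIV_imp_deriv[OF volterra_has_derivative[OF A k f that]])
  show "deriv (volterra A k f) z = k 0 * f z + volterra A (deriv k) f z" by (rule d[OF z])
  have "((\<lambda>x. k 0 * f x + volterra A (deriv k) f x) has_field_derivative
      k 0 * deriv f z + (deriv k 0 * f z + volterra A (deriv (deriv k)) f z)) (at z)"
    by (intro DERIV_add DERIV_cmult holomorphic_derivI[OF f(1) strip_open z] volterra_has_derivative[OF A k' f z])
  then have "(deriv (volterra A k f) has_field_derivative
      k 0 * deriv f z + (deriv k 0 * f z + volterra A (deriv (deriv k)) f z)) (at z)"
    by (rule has_field_derivative_transform_within_open[OF _ strip_open z]) (simp add: d)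
  then show "deriv (deriv (volterra A k f)) z = k 0 * deriv f z + deriv k 0 * f z + volterra A (deriv (deriv k)) f z"
    by (simp add: DERIV_imp_deriv add.assoc)
qed

text \<open>As W vanishes at A, differentiation passes from the convolution to W. For the first
  relation the equation of W at level c - 1 is inserted and its factor e^z is moved out of the
  integral by \<open>volterra_exp\<close>. For the second the derivatives fall on the kernels, where
  \<open>shifted_kernel\<close> applies, and boundary terms at s = z remain.\<close>

lemma kernel_pair_volterra:
  assumes A: "edge_point a b A"
    and \<kappa>: "\<kappa> holomorphic_on exp_slit" "\<kappa> 0 = 1"
    "\<And>z. z \<in> exp_slit \<Longrightarrow> deriv (deriv \<kappa>) z - (\<rho>1 + \<rho>2) * deriv \<kappa> z + \<rho>1 * \<rho>2 * \<kappa> z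
       = exp z * (deriv (deriv \<kappa>) z + (1 - (\<rho>1 + \<rho>2)) * deriv \<kappa> z - (\<rho>1 + \<rho>2) * \<kappa> z)"
    and W: "okubo_level N M \<tau> (c - 1) (strip a b) W"
    and br: "\<And>i. i < N \<Longrightarrow> branch_at A (strip a b) e (W i) (L i)" and e: "Re e > 2"
  shows "kernel_pair N M \<tau> \<rho>1 \<rho>2 c (strip a b) (\<lambda>i. volterra A (\<lambda>z. exp (c * z) * \<kappa> z) (W i))
     (\<lambda>i. volterra A (\<lambda>z. exp z * (exp (c * z) * \<kappa> z)) (W i))"
  unfolding kernel_pair_def
proof (intro allI impI conjI ballI)
  let ?S = "strip a b"
  define k where "k = (\<lambda>z. exp (c * z) * \<kappa> z)"
  define l where "l = (\<lambda>z. exp z * k z)"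
  note An = edge_point_notin[OF A]
  have kh: "k holomorphic_on exp_slit" "l holomorphic_on exp_slit"
    unfolding l_def k_def by (intro holomorphic_intros \<kappa>)+
  note kh' = holomorphic_deriv[OF kh(1) exp_slit_props(1)] holomorphic_deriv[OF kh(2) exp_slit_props(1)]
  note kh'' = holomorphic_deriv[OF kh'(1) exp_slit_props(1)] holomorphic_deriv[OF kh'(2) exp_slit_props(1)]
  have k0: "k 0 = 1" "l 0 = 1" using \<kappa>(2) by (simp_all add: k_def l_def)
  have sk: "deriv l x = exp x * (k x + deriv k x)"
    "deriv (deriv k) x + (- (2 * c + \<rho>1 + \<rho>2) * deriv k x + (c + \<rho>1) * (c + \<rho>2) * k x)
      = deriv (deriv l) x + (- (2 * c + 1 + \<rho>1 + \<rho>2) * deriv l x + c * (c + 1 + \<rho>1 + \<rho>2) * l x)"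
    if "x \<in> exp_slit" for x
    using shifted_kernel(2,3)[OF \<kappa>(1) _ k_def l_def that] \<kappa>(3) by auto
  \<comment> \<open>In the boundary terms the additional 1 in l'(0) is compensated by the difference
    between the coefficients 2c + \<sigma> and 2c + 1 + \<sigma> of the first derivatives.\<close>
  have l0': "deriv l 0 = 1 + deriv k 0" using sk(1)[OF exp_slit_props(3)] k0 by simp
  fix i assume i: "i < N"
  have e1: "Re e > 1" "Re e > 0" "Re (e - 1) > 0" using e by auto
  have Wh: "W j holomorphic_on ?S" if "j < N" for j using W that by (simp add: okubo_level_def)
  have Wd: "deriv (W j) holomorphic_on ?S" if "j < N" for j by (rule holomorphic_deriv[OF Wh[OF that] strip_open])
  have brd: "branch_at A ?S (e - 1) (deriv (W j)) (e * L j)" if "j < N" for j by (rule branch_at_deriv[OF A br[OF that]])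
  show "volterra A (\<lambda>z. exp (c * z) * \<kappa> z) (W i) holomorphic_on ?S"
    "volterra A (\<lambda>z. exp z * (exp (c * z) * \<kappa> z)) (W i) holomorphic_on ?S"
    using volterra_holomorphic[OF A kh(1) Wh[OF i] br[OF i] e1(1)] volterra_holomorphic[OF A kh(2) Wh[OF i] br[OF i] e1(1)]
    by (simp_all add: l_def k_def)
  fix z assume z: "z \<in> ?S"
  have dk: "deriv (volterra A k (W j)) z = volterra A k (deriv (W j)) z" if "j < N" for j
    using volterra_by_parts[OF A kh(1) Wh[OF that] br[OF that] e1(1) z] volterra_second_deriv(1)[OF A kh(1) Wh[OF that] br[OF that] e1(1) z] by simp
  have dl: "deriv (volterra A l (W i)) z = volterra A l (deriv (W i)) z"
    using volterra_by_parts[OF A kh(2) Wh[OF i] br[OF i] e1(1) z] volterra_second_deriv(1)[OF A kh(2) Wh[OF i] br[OF i] e1(1) z] by simp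
  have sumh: "(\<lambda>z. \<Sum>j<N. M i j * W j z) holomorphic_on ?S" by (intro holomorphic_intros Wh) auto
  have sumb: "branch_at A ?S e (\<lambda>z. \<Sum>j<N. M i j * W j z) (\<Sum>j<N. M i j * L j)"
    by (intro branch_at_sum branch_at_cmult br An) simp
  have s1: "volterra A k (\<lambda>z. \<Sum>j<N. M i j * W j z) z = (\<Sum>j<N. M i j * volterra A k (W j) z)"
  proof -
    have "volterra A k (\<lambda>z. \<Sum>j<N. M i j * W j z) z = (\<Sum>j<N. volterra A k (\<lambda>z. M i j * W j z) z)"
      by (rule volterra_sum[OF A z kh(1) _ branch_at_cmult[OF br An] e1(2)]) (auto intro!: holomorphic_intros Wh)
    then show ?thesis by (simp add: volterra_cmult)
  qed
  have lowb: "branch_at A ?S e (\<lambda>z. (- 1) * (\<Sum>j<N. M i j * W j z) + (1 - c) * W i z) ((- 1) * (\<Sum>j<N. M i j * L j) + (1 - c) * L i)"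
    by (intro branch_at_add branch_at_cmult[OF sumb An] branch_at_cmult[OF br[OF i] An])
  have lowh: "(\<lambda>z. (- 1) * (\<Sum>j<N. M i j * W j z) + (1 - c) * W i z) holomorphic_on ?S"
    by (intro holomorphic_intros sumh Wh i)
  have s2: "volterra A k (\<lambda>z. (- 1) * (\<Sum>j<N. M i j * W j z) + (1 - c) * W i z) z
      = (- 1) * (\<Sum>j<N. M i j * volterra A k (W j) z) + (1 - c) * volterra A k (W i) z"
    by (subst volterra_add[OF A z kh(1) holomorphic_on_mult[OF holomorphic_on_const sumh] branch_at_cmult[OF sumb An] e1(2)
          holomorphic_on_mult[OF holomorphic_on_const Wh[OF i]] branch_at_cmult[OF br[OF i] An] e1(2)])
       (simp only: volterra_cmult s1)
  have s3: "volterra A k (\<lambda>z. deriv (W i) z + ((- 1) * (\<Sum>j<N. M i j * W j z) + (1 - c) * W i z)) z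
      = volterra A k (deriv (W i)) z + ((- 1) * (\<Sum>j<N. M i j * volterra A k (W j) z) + (1 - c) * volterra A k (W i) z)"
    by (subst volterra_add[OF A z kh(1) Wd[OF i] brd[OF i] e1(3) lowh lowb e1(2)]) (simp only: s2)
  have "volterra A l (deriv (W i)) z = volterra A (\<lambda>x. exp x * k x) (\<lambda>x. exp x * (\<tau> i * (deriv (W i) x + ((- 1) * (\<Sum>j<N. M i j * W j x) + (1 - c) * W i x)))) z"
  proof (rule volterra_cong[OF A z])
    fix x assume x: "x \<in> ?S"
    have "deriv (W i) x = \<tau> i * exp x * (deriv (W i) x - (\<Sum>j<N. M i j * W j x) - (c - 1) * W i x)"
      using W i x unfolding okubo_level_def by blast
    also have "\<dots> = exp x * (\<tau> i * (deriv (W i) x + ((- 1) * (\<Sum>j<N. M i j * W j x) + (1 - c) * W i x)))"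
      by (simp add: algebra_simps)
    finally show "deriv (W i) x = exp x * (\<tau> i * (deriv (W i) x + ((- 1) * (\<Sum>j<N. M i j * W j x) + (1 - c) * W i x)))" .
  qed (simp add: l_def)
  also have "\<dots> = \<tau> i * exp z * (volterra A k (deriv (W i)) z + ((- 1) * (\<Sum>j<N. M i j * volterra A k (W j) z) + (1 - c) * volterra A k (W i) z))"
    by (simp only: volterra_exp volterra_cmult s3 mult.left_commute mult.assoc)
  finally have "deriv (volterra A l (W i)) z = \<tau> i * exp z * (deriv (volterra A k (W i)) z - (c - 1) * volterra A k (W i) z - (\<Sum>j<N. M i j * volterra A k (W j) z))"
    by (simp add: dl dk[OF i] algebra_simps)
  then show "deriv (volterra A (\<lambda>z. exp z * (exp (c * z) * \<kappa> z)) (W i)) z = \<tau> i * exp z * (deriv (volterra A (\<lambda>z. exp (c * z) * \<kappa> z) (W i)) z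
      - (c - 1) * volterra A (\<lambda>z. exp (c * z) * \<kappa> z) (W i) z - (\<Sum>j<N. M i j * volterra A (\<lambda>z. exp (c * z) * \<kappa> z) (W j) z))"
    by (simp only: l_def k_def)
  have comb: "volterra A (\<lambda>x. deriv (deriv q) x + (v * deriv q x + y * q x)) (W i) z
      = volterra A (deriv (deriv q)) (W i) z + (v * volterra A (deriv q) (W i) z + y * volterra A q (W i) z)"
    if q: "q holomorphic_on exp_slit" for q v y
  proof -
    have q': "deriv q holomorphic_on exp_slit" by (rule holomorphic_deriv[OF q exp_slit_props(1)])
    have q'': "deriv (deriv q) holomorphic_on exp_slit" by (rule holomorphic_deriv[OF q' exp_slit_props(1)])
    have vq: "(\<lambda>x. v * deriv q x) holomorphic_on exp_slit" "(\<lambda>x. y * q x) holomorphic_on exp_slit" by (intro holomorphic_intros q q')+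
    show ?thesis
      by (simp only: volterra_kernel_add[OF A z q'' holomorphic_on_add[OF vq] Wh[OF i] br[OF i] e1(2)]
          volterra_kernel_add[OF A z vq Wh[OF i] br[OF i] e1(2)] volterra_kernel_cmult)
  qed
  have "volterra A (\<lambda>x. deriv (deriv k) x + (- (2 * c + \<rho>1 + \<rho>2) * deriv k x + (c + \<rho>1) * (c + \<rho>2) * k x)) (W i) z
      = volterra A (\<lambda>x. deriv (deriv l) x + (- (2 * c + 1 + \<rho>1 + \<rho>2) * deriv l x + c * (c + 1 + \<rho>1 + \<rho>2) * l x)) (W i) z"
    by (rule volterra_cong[OF A z refl sk(2)])
  then have "deriv (deriv (volterra A k (W i))) z - (2 * c + \<rho>1 + \<rho>2) * deriv (volterra A k (W i)) z + (c + \<rho>1) * (c + \<rho>2) * volterra A k (W i) z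
       = deriv (deriv (volterra A l (W i))) z - (2 * c + 1 + \<rho>1 + \<rho>2) * deriv (volterra A l (W i)) z + c * (c + 1 + \<rho>1 + \<rho>2) * volterra A l (W i) z"
    unfolding comb[OF kh(1)] comb[OF kh(2)] volterra_second_deriv[OF A kh(1) Wh[OF i] br[OF i] e1(1) z]
      volterra_second_deriv[OF A kh(2) Wh[OF i] br[OF i] e1(1) z] k0 l0' by (simp add: algebra_simps)
  then show "deriv (deriv (volterra A (\<lambda>z. exp (c * z) * \<kappa> z) (W i))) z - (2 * c + \<rho>1 + \<rho>2) * deriv (volterra A (\<lambda>z. exp (c * z) * \<kappa> z) (W i)) z
      + (c + \<rho>1) * (c + \<rho>2) * volterra A (\<lambda>z. exp (c * z) * \<kappa> z) (W i) z
      = deriv (deriv (volterra A (\<lambda>z. exp z * (exp (c * z) * \<kappa> z)) (W i))) z - (2 * c + 1 + \<rho>1 + \<rho>2) * deriv (volterra A (\<lambda>z. exp z * (exp (c * z) * \<kappa> z)) (W i)) z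
      + c * (c + 1 + \<rho>1 + \<rho>2) * volterra A (\<lambda>z. exp z * (exp (c * z) * \<kappa> z)) (W i) z"
    by (simp only: l_def k_def)
qed

text \<open>Formally this is e^{-\<sigma>z} m(D) \<omega>. Raising m times puts w at level m, so the
  kernel carries c = m + 1, and m + 1 derivatives in e^z bring c to 0. One derivative more than the
  number of raisings is taken since \<omega> is itself the derivative of w, up to the factor 1 /
  \<tau>.\<close>

definition extension_transform where
  "extension_transform N \<tau> R \<rho>1 \<rho>2 \<kappa> m A w i z = exp (- (\<rho>1 + \<rho>2) * z) *
     (zeta_deriv ^^ Suc m) (volterra A (\<lambda>z. exp (of_nat (Suc m) * z) * \<kappa> z) (iterated_raise N \<tau> R w m i)) z / \<tau> i"

context
  fixes a b :: real and N :: nat and M :: "nat \<Rightarrow> nat \<Rightarrow> complex" and \<tau> :: "nat \<Rightarrow> complex" and R :: "nat \<Rightarrow> nat \<Rightarrow> nat \<Rightarrow> complex"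
    and \<rho>1 \<rho>2 :: complex and \<kappa> :: "complex \<Rightarrow> complex"
  assumes \<kappa>: "\<kappa> holomorphic_on exp_slit" "\<kappa> 0 = 1"
    "\<And>z. z \<in> exp_slit \<Longrightarrow> deriv (deriv \<kappa>) z - (\<rho>1 + \<rho>2) * deriv \<kappa> z + \<rho>1 * \<rho>2 * \<kappa> z
       = exp z * (deriv (deriv \<kappa>) z + (1 - (\<rho>1 + \<rho>2)) * deriv \<kappa> z - (\<rho>1 + \<rho>2) * \<kappa> z)"
    and R: "\<And>m. shifted_inverse N M (of_nat (Suc m)) (R m)"
    and \<tau>: "\<And>i. i < N \<Longrightarrow> \<tau> i \<noteq> 0"
begin

lemma kernel_shift_holomorphic: "(\<lambda>z. exp (c * z) * \<kappa> z) holomorphic_on exp_slit"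
  by (intro holomorphic_intros \<kappa>)

text \<open>The raisings divide the leading coefficient by (e + 1) ... (e + m) and the convolution
  by e + m + 1; the m + 1 derivatives multiply by exactly these numbers. The exponentials e^{mA} and
  e^{-(m+1)A} leave e^{-A}.\<close>

lemma extension_transform_properties:
  assumes A: "edge_point a b A" and w: "okubo_level N M \<tau> 0 (strip a b) w"
    and br: "\<And>i. i < N \<Longrightarrow> branch_at A (strip a b) e (w i) (L i)"
    and e: "e \<notin> \<int>" "Re e + real m > 2"
  shows "extension_equation N M \<tau> \<rho>1 \<rho>2 (strip a b) (extension_transform N \<tau> R \<rho>1 \<rho>2 \<kappa> m A w)"
    and "\<And>i. i < N \<Longrightarrow> branch_at A (strip a b) e (extension_transform N \<tau> R \<rho>1 \<rho>2 \<kappa> m A w i)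
        (exp (- (\<rho>1 + \<rho>2) * A) * L i / (\<tau> i * exp A))"
proof -
  define W where "W = iterated_raise N \<tau> R w m"
  define k where "k = (\<lambda>z. exp (of_nat (Suc m) * z) * \<kappa> z)"
  have kh: "k holomorphic_on exp_slit" unfolding k_def by (rule kernel_shift_holomorphic)
  have W: "okubo_level N M \<tau> (of_nat m) (strip a b) W"
    unfolding W_def by (rule iterated_raise_properties(1)[OF A w R \<tau> br e(1)])
  have Wb: "branch_at A (strip a b) (e + of_nat m) (W i) (exp (of_nat m * A) * L i / pochhammer (e + 1) m)" if "i < N" for i
    unfolding W_def by (rule iterated_raise_properties(2)[OF A w R \<tau> br e(1) that])
  have Re2: "Re (e + of_nat m) > 2" using e(2) by simp
  have W': "okubo_level N M \<tau> (of_nat (Suc m) - 1) (strip a b) W" using W by simp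
  have "kernel_pair N M \<tau> \<rho>1 \<rho>2 (of_nat (Suc m)) (strip a b) (\<lambda>i. volterra A k (W i)) (\<lambda>i. volterra A (\<lambda>z. exp z * k z) (W i))"
    unfolding k_def by (rule kernel_pair_volterra[OF A \<kappa> W' Wb Re2])
  from kernel_pair_extension_equation[OF strip_open kernel_pair_iterate[OF strip_open this] \<tau>]
  show "extension_equation N M \<tau> \<rho>1 \<rho>2 (strip a b) (extension_transform N \<tau> R \<rho>1 \<rho>2 \<kappa> m A w)"
    by (simp only: extension_transform_def[abs_def] W_def k_def)
  fix i assume i: "i < N"
  have Wh: "W i holomorphic_on strip a b" using W i by (simp add: okubo_level_def)
  have "branch_at A (strip a b) (e + of_nat m + 1) (volterra A k (W i)) (k 0 * (exp (of_nat m * A) * L i / pochhammer (e + 1) m) / (e + of_nat m + 1))"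
    by (rule volterra_branch[OF A kh Wh Wb[OF i]]) (use Re2 in simp)
  then have "branch_at A (strip a b) (e + of_nat (Suc m)) (volterra A k (W i)) (exp (of_nat m * A) * L i / pochhammer (e + 1) (Suc m))"
    using \<kappa>(2) by (simp add: k_def pochhammer_Suc add_ac)
  from iterated_zeta_deriv_branch[OF A this]
  have br1: "branch_at A (strip a b) e ((zeta_deriv ^^ Suc m) (volterra A k (W i)))
      (exp (- of_nat (Suc m) * A) * (pochhammer (e + 1) (Suc m) * (exp (of_nat m * A) * L i / pochhammer (e + 1) (Suc m))))" .
  have "pochhammer (e + 1) (Suc m) \<noteq> 0"
  proof
    assume "pochhammer (e + 1) (Suc m) = 0"
    then obtain j where "e + 1 = - of_nat j" by (auto simp: pochhammer_eq_0_iff)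
    then have "e = - of_nat j - 1" by (simp only: eq_diff_eq)
    then have "e = of_int (- int j - 1)" by simp
    then show False using e(1) by simp
  qed
  then have "exp (- of_nat (Suc m) * A) * (pochhammer (e + 1) (Suc m) * (exp (of_nat m * A) * L i / pochhammer (e + 1) (Suc m)))
      = (exp (- of_nat (Suc m) * A) * exp (of_nat m * A)) * L i" by simp
  moreover have "exp (- of_nat (Suc m) * A) * exp (of_nat m * A) = exp (- A)"
    by (simp add: exp_add[symmetric] algebra_simps)
  ultimately have "branch_at A (strip a b) e ((zeta_deriv ^^ Suc m) (volterra A k (W i))) (exp (- A) * L i)"
    using br1 by (simp only:)
  from branch_at_mult[OF branch_at_exp[OF edge_point_notin[OF A], of "- (\<rho>1 + \<rho>2)"] this]
  have "branch_at A (strip a b) e (\<lambda>z. (1 / \<tau> i) * (exp (- (\<rho>1 + \<rho>2) * z) * (zeta_deriv ^^ Suc m) (volterra A k (W i)) z))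
     ((1 / \<tau> i) * (exp (- (\<rho>1 + \<rho>2) * A) * (exp (- A) * L i)))"
    by (intro branch_at_cmult[OF _ edge_point_notin[OF A]]) simp
  then show "branch_at A (strip a b) e (extension_transform N \<tau> R \<rho>1 \<rho>2 \<kappa> m A w i)
        (exp (- (\<rho>1 + \<rho>2) * A) * L i / (\<tau> i * exp A))"
    by (simp only: extension_transform_def[abs_def] W_def k_def times_divide_eq_left mult_1_left exp_minus[of A])
       (simp add: field_simps)
qed

end

lemma extension_equation_diff:
  assumes S: "open S" and u: "extension_equation N M \<tau> \<rho>1 \<rho>2 S u" and v: "extension_equation N M \<tau> \<rho>1 \<rho>2 S v"
  shows "extension_equation N M \<tau> \<rho>1 \<rho>2 S (\<lambda>i z. u i z - \<gamma> * v i z)"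
  unfolding extension_equation_def
proof (intro allI impI conjI ballI)
  have uh: "u i holomorphic_on S" and vh: "v i holomorphic_on S" if "i < N" for i
    using u v that by (simp_all add: extension_equation_def)
  have d1: "deriv (\<lambda>z. u i z - \<gamma> * v i z) z = deriv (u i) z - \<gamma> * deriv (v i) z" if "i < N" "z \<in> S" for i z
    by (rule DERIV_imp_deriv)
       (intro DERIV_diff DERIV_cmult holomorphic_derivI[OF uh[OF that(1)] S that(2)] holomorphic_derivI[OF vh[OF that(1)] S that(2)])
  have d2: "deriv (deriv (\<lambda>z. u i z - \<gamma> * v i z)) z = deriv (deriv (u i)) z - \<gamma> * deriv (deriv (v i)) z" if i: "i < N" and z: "z \<in> S" for i z
  proof -
    have "((\<lambda>z. deriv (u i) z - \<gamma> * deriv (v i) z) has_field_derivative deriv (deriv (u i)) z - \<gamma> * deriv (deriv (v i)) z) (at z)"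
      by (intro DERIV_diff DERIV_cmult holomorphic_derivI[OF holomorphic_deriv[OF uh[OF i] S] S z] holomorphic_derivI[OF holomorphic_deriv[OF vh[OF i] S] S z])
    then have "(deriv (\<lambda>z. u i z - \<gamma> * v i z) has_field_derivative deriv (deriv (u i)) z - \<gamma> * deriv (deriv (v i)) z) (at z)"
      by (rule has_field_derivative_transform_within_open[OF _ S z]) (simp add: d1[OF i])
    then show ?thesis by (rule DERIV_imp_deriv)
  qed
  fix i assume i: "i < N"
  show "(\<lambda>z. u i z - \<gamma> * v i z) holomorphic_on S" by (intro holomorphic_intros uh vh i)
  fix z assume z: "z \<in> S"
  have U: "deriv (deriv (u i)) z + (\<rho>1 + \<rho>2) * deriv (u i) z + \<rho>1 * \<rho>2 * u i z
       = \<tau> i * exp z * (deriv (deriv (u i)) z + (1 + \<rho>1 + \<rho>2) * deriv (u i) z)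
         - (\<Sum>j<N. M i j * (\<tau> j * exp z * deriv (u j) z))"
    using u i z unfolding extension_equation_def by blast
  have V: "deriv (deriv (v i)) z + (\<rho>1 + \<rho>2) * deriv (v i) z + \<rho>1 * \<rho>2 * v i z
       = \<tau> i * exp z * (deriv (deriv (v i)) z + (1 + \<rho>1 + \<rho>2) * deriv (v i) z)
         - (\<Sum>j<N. M i j * (\<tau> j * exp z * deriv (v j) z))"
    using v i z unfolding extension_equation_def by blast
  have s: "(\<Sum>j<N. M i j * (\<tau> j * exp z * deriv (\<lambda>z. u j z - \<gamma> * v j z) z))
     = (\<Sum>j<N. M i j * (\<tau> j * exp z * deriv (u j) z)) - \<gamma> * (\<Sum>j<N. M i j * (\<tau> j * exp z * deriv (v j) z))"
    by (simp add: d1[OF _ z] sum_distrib_left flip: sum_subtractf) (simp add: algebra_simps)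
  have ring: "(u2 - \<gamma> * v2) + s * (u1 - \<gamma> * v1) + p * (u0 - \<gamma> * v0)
     - (T * (u2 - \<gamma> * v2 + s' * (u1 - \<gamma> * v1)) - (X - \<gamma> * Y))
     = (u2 + s * u1 + p * u0 - (T * (u2 + s' * u1) - X)) - \<gamma> * (v2 + s * v1 + p * v0 - (T * (v2 + s' * v1) - Y))"
    for u0 u1 u2 v0 v1 v2 s s' p T X Y :: complex by (simp add: algebra_simps)
  show "deriv (deriv (\<lambda>z. u i z - \<gamma> * v i z)) z + (\<rho>1 + \<rho>2) * deriv (\<lambda>z. u i z - \<gamma> * v i z) z + \<rho>1 * \<rho>2 * (u i z - \<gamma> * v i z)
       = \<tau> i * exp z * (deriv (deriv (\<lambda>z. u i z - \<gamma> * v i z)) z + (1 + \<rho>1 + \<rho>2) * deriv (\<lambda>z. u i z - \<gamma> * v i z) z)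
         - (\<Sum>j<N. M i j * (\<tau> j * exp z * deriv (\<lambda>z. u j z - \<gamma> * v j z) z))"
    unfolding d1[OF i z] d2[OF i z] s
    by (subst eq_iff_diff_eq_0, subst ring) (use U V in simp)
qed

text \<open>\<open>raise\<close> is linear with coefficients that are entire in z, so the same
  connection coefficients survive each step.\<close>

lemma iterated_raise_connection:
  assumes B: "edge_point a b B" and I: "finite I"
    and reg: "\<And>i. i < N \<Longrightarrow> \<exists>L. branch_at B (strip a b) 0 (\<lambda>z. w i z - (\<Sum>q\<in>I. C q * v q i z)) L"
    and i: "i < N"
  shows "\<exists>L. branch_at B (strip a b) 0 (\<lambda>z. iterated_raise N \<tau> R w m i z - (\<Sum>q\<in>I. C q * iterated_raise N \<tau> R (v q) m i z)) L"
  using i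
proof (induction m arbitrary: i)
  case 0
  then show ?case using reg by simp
next
  case (Suc m)
  note Bn = edge_point_notin[OF B]
  let ?w = "iterated_raise N \<tau> R w m" and ?v = "\<lambda>q. iterated_raise N \<tau> R (v q) m"
  have "\<forall>j. \<exists>L. j < N \<longrightarrow> branch_at B (strip a b) 0 (\<lambda>z. ?w j z - (\<Sum>q\<in>I. C q * ?v q j z)) L"
    using Suc.IH by blast
  from choice[OF this] obtain L where
    L: "\<And>j. j < N \<Longrightarrow> branch_at B (strip a b) 0 (\<lambda>z. ?w j z - (\<Sum>q\<in>I. C q * ?v q j z)) (L j)" by blast
  have "branch_at B (strip a b) 0 (\<lambda>z. exp z - 1 / \<tau> j) (exp B - 1 / \<tau> j)" for j
    by (rule branch_at_holomorphic[of _ _ 1]) (auto intro!: holomorphic_intros Bn)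
  from branch_at_mult[OF this L]
  have 1: "branch_at B (strip a b) 0 (\<lambda>z. \<Sum>j<N. R m i j * ((exp z - 1 / \<tau> j) * (?w j z - (\<Sum>q\<in>I. C q * ?v q j z))))
      (\<Sum>j<N. R m i j * ((exp B - 1 / \<tau> j) * L j))"
    by (intro branch_at_sum branch_at_cmult[OF _ Bn]) simp
  have "(\<Sum>j<N. R m i j * ((exp z - 1 / \<tau> j) * (?w j z - (\<Sum>q\<in>I. C q * ?v q j z))))
      = raise N \<tau> (R m) ?w i z - (\<Sum>q\<in>I. C q * raise N \<tau> (R m) (?v q) i z)" for z
  proof -
    have "(\<Sum>q\<in>I. C q * raise N \<tau> (R m) (?v q) i z) = (\<Sum>j<N. \<Sum>q\<in>I. C q * (R m i j * ((exp z - 1 / \<tau> j) * ?v q j z)))"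
      unfolding raise_def by (simp only: sum_distrib_left) (rule sum.swap)
    also have "\<dots> = (\<Sum>j<N. R m i j * ((exp z - 1 / \<tau> j) * (\<Sum>q\<in>I. C q * ?v q j z)))"
      by (simp add: sum_distrib_left mult_ac)
    finally show ?thesis unfolding raise_def by (simp only: right_diff_distrib sum_subtractf)
  qed
  then show ?case using 1 by auto
qed

text \<open>By uniqueness u is a multiple of the transform of w based at A, and each u' q a multiple
  of the transform of w' q based at B. Raising, convolution and differentiation each preserve the
  relation modulo functions holomorphic at B, so only the ratio of the two multiples enters the new
  coefficients.\<close>

theorem strip_connection:
  fixes K :: "'k set" and N :: nat and w u :: "nat \<Rightarrow> complex \<Rightarrow> complex" and w' u' :: "'k \<Rightarrow> nat \<Rightarrow> complex \<Rightarrow> complex"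
  assumes A: "edge_point a b A" and B: "edge_point a b B" and K: "finite K"
    and R: "\<And>m. shifted_inverse N M (of_nat (Suc m)) (R m)" and \<tau>: "\<And>i. i < N \<Longrightarrow> \<tau> i \<noteq> 0"
    and w: "okubo_level N M \<tau> 0 (strip a b) w" "\<And>i. i < N \<Longrightarrow> branch_at A (strip a b) e (w i) (L i)"
    and e: "e \<notin> \<int>" and L: "\<And>i. i < N \<Longrightarrow> L i \<noteq> 0 \<Longrightarrow> \<tau> i * exp A = 1"
    and w': "\<And>q. q \<in> K \<Longrightarrow> okubo_level N M \<tau> 0 (strip a b) (w' q)"
      "\<And>q i. q \<in> K \<Longrightarrow> i < N \<Longrightarrow> branch_at B (strip a b) (e' q) (w' q i) (L' q i)"
    and e': "\<And>q. q \<in> K \<Longrightarrow> e' q \<notin> \<int>" and L': "\<And>q i. q \<in> K \<Longrightarrow> i < N \<Longrightarrow> L' q i \<noteq> 0 \<Longrightarrow> \<tau> i * exp B = 1"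
    and reg: "\<And>i. i < N \<Longrightarrow> \<exists>L0. branch_at B (strip a b) 0 (\<lambda>z. w i z - (\<Sum>q\<in>K. C q * w' q i z)) L0"
    and u: "extension_equation N M \<tau> \<rho>1 \<rho>2 (strip a b) u" "\<And>i. i < N \<Longrightarrow> branch_at A (strip a b) e (u i) (g * L i)"
    and u': "\<And>q. q \<in> K \<Longrightarrow> extension_equation N M \<tau> \<rho>1 \<rho>2 (strip a b) (u' q)"
      "\<And>q i. q \<in> K \<Longrightarrow> i < N \<Longrightarrow> branch_at B (strip a b) (e' q) (u' q i) (g' q * L' q i)"
      "\<And>q. q \<in> K \<Longrightarrow> g' q \<noteq> 0"
    and diagA: "\<And>i j. i < N \<Longrightarrow> j < N \<Longrightarrow> \<tau> i * exp A = 1 \<Longrightarrow> \<tau> j * exp A = 1 \<Longrightarrow> i \<noteq> j \<Longrightarrow> M i j = 0"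
    and diagB: "\<And>i j. i < N \<Longrightarrow> j < N \<Longrightarrow> \<tau> i * exp B = 1 \<Longrightarrow> \<tau> j * exp B = 1 \<Longrightarrow> i \<noteq> j \<Longrightarrow> M i j = 0"
    and nonresA: "\<And>i m. i < N \<Longrightarrow> \<tau> i * exp A = 1 \<Longrightarrow> m \<ge> 1 \<Longrightarrow> e + of_nat m \<noteq> M i i"
    and nonresB: "\<And>q i m. q \<in> K \<Longrightarrow> i < N \<Longrightarrow> \<tau> i * exp B = 1 \<Longrightarrow> m \<ge> 1 \<Longrightarrow> e' q + of_nat m \<noteq> M i i"
    and i: "i < N"
  shows "\<exists>L1. branch_at B (strip a b) 0 (\<lambda>z. u i z
     - (\<Sum>q\<in>K. (g * exp ((\<rho>1 + \<rho>2) * A) / (g' q * exp ((\<rho>1 + \<rho>2) * B)) * C q) * u' q i z)) L1"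
proof -
  let ?S = "strip a b"
  obtain \<kappa> where \<kappa>: "\<kappa> holomorphic_on exp_slit" "\<kappa> 0 = 1"
    "\<And>z. z \<in> exp_slit \<Longrightarrow> deriv (deriv \<kappa>) z - (\<rho>1 + \<rho>2) * deriv \<kappa> z + \<rho>1 * \<rho>2 * \<kappa> z
       = exp z * (deriv (deriv \<kappa>) z + (1 - (\<rho>1 + \<rho>2)) * deriv \<kappa> z - (\<rho>1 + \<rho>2) * \<kappa> z)"
    using kernel_exists[of "\<rho>1 + \<rho>2" "\<rho>1 * \<rho>2"] by blast
  \<comment> \<open>One m has to serve all exponents at once, because w and all w' q are convolved
    with the same kernel.\<close>
  obtain m :: nat where m: "real m > 2 + \<bar>Re e\<bar> + (\<Sum>q\<in>K. \<bar>Re (e' q)\<bar>)" using reals_Archimedean2 by blast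
  have "(\<Sum>q\<in>K. \<bar>Re (e' q)\<bar>) \<ge> 0" by (rule sum_nonneg) simp
  then have em: "Re e + real m > 2" using m by linarith
  have em': "Re (e' q) + real m > 2" if "q \<in> K" for q
  proof -
    have "\<bar>Re (e' q)\<bar> \<le> (\<Sum>q\<in>K. \<bar>Re (e' q)\<bar>)" by (rule member_le_sum[OF that]) (use K in auto)
    then show ?thesis using m by linarith
  qed
  define T where "T = extension_transform N \<tau> R \<rho>1 \<rho>2 \<kappa> m"
  \<comment> \<open>The factor is dictated by leading coefficients: the transform has e^{-\<sigma>E}
    LL_i / (\<tau>_i e^E), and \<tau>_i e^E = 1 wherever LL_i \<noteq> 0. The difference then has
    coefficient 0 in every row.\<close>
  have unique: "y i z = (gg * exp ((\<rho>1 + \<rho>2) * E)) * T E x i z"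
    if E: "edge_point a b E" and x: "okubo_level N M \<tau> 0 ?S x" "\<And>i. i < N \<Longrightarrow> branch_at E ?S ee (x i) (LL i)"
      and ee: "ee \<notin> \<int>" "Re ee + real m > 2" and LL: "\<And>i. i < N \<Longrightarrow> LL i \<noteq> 0 \<Longrightarrow> \<tau> i * exp E = 1"
      and y: "extension_equation N M \<tau> \<rho>1 \<rho>2 ?S y" "\<And>i. i < N \<Longrightarrow> branch_at E ?S ee (y i) (gg * LL i)"
      and dg: "\<And>i j. i < N \<Longrightarrow> j < N \<Longrightarrow> \<tau> i * exp E = 1 \<Longrightarrow> \<tau> j * exp E = 1 \<Longrightarrow> i \<noteq> j \<Longrightarrow> M i j = 0"
      and nr: "\<And>i m. i < N \<Longrightarrow> \<tau> i * exp E = 1 \<Longrightarrow> m \<ge> 1 \<Longrightarrow> ee + of_nat m \<noteq> M i i"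
      and i: "i < N" and z: "z \<in> ?S" for E x ee LL y gg i z
  proof -
    note En = edge_point_notin[OF E]
    have T1: "extension_equation N M \<tau> \<rho>1 \<rho>2 ?S (T E x)"
      unfolding T_def by (rule extension_transform_properties(1)[OF \<kappa> R \<tau> E x ee])
    have T2: "branch_at E ?S ee (T E x i) (exp (- (\<rho>1 + \<rho>2) * E) * LL i / (\<tau> i * exp E))" if "i < N" for i
      unfolding T_def by (rule extension_transform_properties(2)[OF \<kappa> R \<tau> E x ee that])
    define \<gamma> where "\<gamma> = gg * exp ((\<rho>1 + \<rho>2) * E)"
    have "y i z - \<gamma> * T E x i z = 0"
    proof (rule extension_equation_unique[OF E extension_equation_diff[OF strip_open y(1) T1] _ ee(1) dg nr i z])
      fix j assume j: "j < N"
      have "exp ((\<rho>1 + \<rho>2) * E) * exp (- (\<rho>1 + \<rho>2) * E) = 1" by (simp add: exp_add[symmetric] algebra_simps)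
      then have "\<gamma> * (exp (- (\<rho>1 + \<rho>2) * E) * LL j / (\<tau> j * exp E)) = gg * (LL j / (\<tau> j * exp E))"
        by (simp add: \<gamma>_def)
      also have "\<dots> = gg * LL j" using LL[OF j] by (cases "LL j = 0") auto
      finally have "gg * LL j - \<gamma> * (exp (- (\<rho>1 + \<rho>2) * E) * LL j / (\<tau> j * exp E)) = 0" by simp
      then show "branch_at E ?S ee (\<lambda>z. y j z - \<gamma> * T E x j z) 0"
        using branch_at_diff[OF y(2)[OF j] branch_at_cmult[OF T2[OF j] En, of \<gamma>] En] by simp
    qed
    then show ?thesis by (simp add: \<gamma>_def)
  qed
  define W where "W = (\<lambda>x. iterated_raise N \<tau> R x m)"
  define k where "k = (\<lambda>z. exp (of_nat (Suc m) * z) * \<kappa> z)"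
  have kh: "k holomorphic_on exp_slit" unfolding k_def by (intro holomorphic_intros \<kappa>)
  have Wh: "W w i holomorphic_on ?S"
    using iterated_raise_properties(1)[OF A w(1) R \<tau> w(2) e] i by (simp add: W_def okubo_level_def)
  have Wb: "branch_at A ?S (e + of_nat m) (W w i) (exp (of_nat m * A) * L i / pochhammer (e + 1) m)"
    unfolding W_def by (rule iterated_raise_properties(2)[OF A w(1) R \<tau> w(2) e i])
  have Wh': "W (w' q) i holomorphic_on ?S" if q: "q \<in> K" for q
    using iterated_raise_properties(1)[OF B w'(1)[OF q] R \<tau> w'(2)[OF q] e'[OF q]] i by (simp add: W_def okubo_level_def)
  have Wb': "branch_at B ?S (e' q + of_nat m) (W (w' q) i) (exp (of_nat m * B) * L' q i / pochhammer (e' q + 1) m)" if q: "q \<in> K" for q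
    unfolding W_def by (rule iterated_raise_properties(2)[OF B w'(1)[OF q] R \<tau> w'(2)[OF q] e'[OF q] i])
  obtain v0 where v0: "branch_at B ?S 0 (\<lambda>z. W w i z - (\<Sum>q\<in>K. C q * W (w' q) i z)) v0"
  proof -
    have "\<exists>v0. branch_at B ?S 0 (\<lambda>z. iterated_raise N \<tau> R w m i z - (\<Sum>q\<in>K. C q * iterated_raise N \<tau> R (w' q) m i z)) v0"
      by (rule iterated_raise_connection[OF B K _ i]) (rule reg)
    then show ?thesis using that unfolding W_def by blast
  qed
  have Re_m: "Re (e + of_nat m) > 1" "Re (e + of_nat m) > 0" using em by simp_all
  have Re_m': "Re (e' q + of_nat m) > 1" "Re (e' q + of_nat m) > 0" if "q \<in> K" for q using em'[OF that] by simp_all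
  obtain v1 where v1: "branch_at B ?S 0 (\<lambda>z. volterra A k (W w i) z - (\<Sum>q\<in>K. C q * volterra B k (W (w' q) i) z)) v1"
  proof -
    have "\<exists>v1. branch_at B ?S 0 (\<lambda>z. volterra A k (W w i) z - (\<Sum>q\<in>K. C q * volterra B k (W (w' q) i) z)) v1"
      by (rule volterra_connection[OF A B kh Wh Wb Re_m(2) Wh' Wb' Re_m'(2) K v0])
    then show ?thesis using that by blast
  qed
  obtain v2 where v2: "branch_at B ?S 0 (\<lambda>z. (zeta_deriv ^^ Suc m) (volterra A k (W w i)) z
      - (\<Sum>q\<in>K. C q * (zeta_deriv ^^ Suc m) (volterra B k (W (w' q) i)) z)) v2"
  proof -
    have "\<exists>v2. branch_at B ?S 0 (\<lambda>z. (zeta_deriv ^^ Suc m) (volterra A k (W w i)) z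
        - (\<Sum>q\<in>K. C q * (zeta_deriv ^^ Suc m) (volterra B k (W (w' q) i)) z)) v2"
      by (rule iterated_zeta_deriv_connection[OF B volterra_holomorphic[OF A kh Wh Wb Re_m(1)] volterra_holomorphic[OF B kh Wh' Wb' Re_m'(1)] v1])
    then show ?thesis using that by blast
  qed
  have Tx: "T E x i z = exp (- (\<rho>1 + \<rho>2) * z) * (zeta_deriv ^^ Suc m) (volterra E k (W x i)) z / \<tau> i" for E x z
    unfolding T_def extension_transform_def W_def k_def ..
  define \<gamma> where "\<gamma> = g * exp ((\<rho>1 + \<rho>2) * A)"
  define \<gamma>' where "\<gamma>' = (\<lambda>q. g' q * exp ((\<rho>1 + \<rho>2) * B))"
  have \<gamma>'nz: "\<gamma>' q \<noteq> 0" if "q \<in> K" for q using u'(3)[OF that] by (simp add: \<gamma>'_def)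
  note Bn = edge_point_notin[OF B]
  from branch_at_cmult[OF branch_at_mult[OF branch_at_exp[OF Bn, of "- (\<rho>1 + \<rho>2)"] v2] Bn, of "\<gamma> / \<tau> i"]
  have fin: "branch_at B ?S 0 (\<lambda>z. \<gamma> / \<tau> i * (exp (- (\<rho>1 + \<rho>2) * z) * ((zeta_deriv ^^ Suc m) (volterra A k (W w i)) z
      - (\<Sum>q\<in>K. C q * (zeta_deriv ^^ Suc m) (volterra B k (W (w' q) i)) z)))) (\<gamma> / \<tau> i * (exp (- (\<rho>1 + \<rho>2) * B) * v2))"
    by (simp only: add_0)
  have "\<gamma> / \<tau> i * (exp (- (\<rho>1 + \<rho>2) * z) * ((zeta_deriv ^^ Suc m) (volterra A k (W w i)) z
      - (\<Sum>q\<in>K. C q * (zeta_deriv ^^ Suc m) (volterra B k (W (w' q) i)) z)))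
      = u i z - (\<Sum>q\<in>K. (\<gamma> / \<gamma>' q * C q) * u' q i z)" if z: "z \<in> ?S" for z
  proof -
    have "u i z = \<gamma> * T A w i z"
      unfolding \<gamma>_def by (rule unique[OF A w e em L u diagA nonresA i z])
    moreover have "(\<Sum>q\<in>K. (\<gamma> / \<gamma>' q * C q) * u' q i z) = (\<Sum>q\<in>K. \<gamma> * C q * T B (w' q) i z)"
    proof (rule sum.cong[OF refl])
      fix q assume q: "q \<in> K"
      have "u' q i z = \<gamma>' q * T B (w' q) i z"
        unfolding \<gamma>'_def by (rule unique[OF B w'(1)[OF q] w'(2)[OF q] e'[OF q] em'[OF q] L'[OF q] u'(1)[OF q] u'(2)[OF q] diagB nonresB[OF q] i z])
      then show "(\<gamma> / \<gamma>' q * C q) * u' q i z = \<gamma> * C q * T B (w' q) i z" using \<gamma>'nz[OF q] by simp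
    qed
    moreover have "(\<Sum>q\<in>K. \<gamma> * C q * T B (w' q) i z)
        = \<gamma> / \<tau> i * (exp (- (\<rho>1 + \<rho>2) * z) * (\<Sum>q\<in>K. C q * (zeta_deriv ^^ Suc m) (volterra B k (W (w' q) i)) z))"
      unfolding sum_distrib_left by (rule sum.cong[OF refl]) (simp only: Tx divide_inverse mult_ac)
    moreover have "\<gamma> * T A w i z = \<gamma> / \<tau> i * (exp (- (\<rho>1 + \<rho>2) * z) * (zeta_deriv ^^ Suc m) (volterra A k (W w i)) z)"
      by (simp only: Tx divide_inverse mult_ac)
    ultimately show ?thesis by (simp only: right_diff_distrib)
  qed
  from branch_at_cong[OF fin this] show ?thesis unfolding \<gamma>_def \<gamma>'_def by blast
qed

section \<open>Return to the original systems\<close>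

lemma branch_ln_eqI:
  assumes "exp L = z" "\<alpha> - pi < Im L" "Im L \<le> \<alpha> + pi"
  shows "branch_ln \<alpha> z = L"
proof -
  have "Ln (z * cis (- \<alpha>)) = L - \<i> * of_real \<alpha>"
  proof (rule Ln_unique)
    have "cis (- \<alpha>) = exp (- (\<i> * of_real \<alpha>))" by (simp add: cis_conv_exp)
    then show "exp (L - \<i> * of_real \<alpha>) = z * cis (- \<alpha>)"
      using assms(1) by (simp add: exp_diff exp_minus divide_inverse)
  qed (use assms in auto)
  then show ?thesis by (simp add: branch_ln_def)
qed

lemma Im_exp_cis: "Im (exp L * cis (- \<beta>)) = exp (Re L) * sin (Im L - \<beta>)"
proof -
  have "exp L * cis (- \<beta>) = exp (L - \<i> * of_real \<beta>)"
    by (simp add: exp_diff cis_conv_exp exp_minus divide_inverse)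
  then show ?thesis by (simp add: Im_exp)
qed

text \<open>Near an edge point \<open>A\<close> the difference \<open>e\<^bsup>sz\<^esup> - e\<^bsup>sA\<^esup>\<close> (\<open>s = \<plusminus>1\<close>) is \<open>z - A\<close> times a function with
  logarithm \<open>l0\<close> at \<open>A\<close>. Since the strip maps to one side of the line through 0 and \<open>e\<^bsup>sA\<^esup>\<close>, its argument
  stays in an interval of length \<open>\<pi>\<close> with end point \<open>Im l0\<close>.\<close>

lemma branch_powr_exp_diff:
  assumes A: "edge_point a b A" and s: "s = 1 \<or> s = - 1" and l0: "exp l0 = s * exp (s * A)"
    and above: "Im A = a \<Longrightarrow> \<alpha> - pi \<le> Im l0 \<and> Im l0 \<le> \<alpha>"
    and below: "Im A = b \<Longrightarrow> \<alpha> \<le> Im l0 \<and> Im l0 \<le> \<alpha> + pi"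
  shows "branch_at A (strip a b) e (\<lambda>z. branch_powr \<alpha> (exp (s * z) - exp (s * A)) e) (exp (e * l0))"
proof -
  define g where "g = (\<lambda>z. exp (s * z) - exp (s * A))"
  have gh: "g holomorphic_on ball A 1" unfolding g_def by (intro holomorphic_intros)
  obtain q where q: "q holomorphic_on ball A 1" "\<And>z. z \<in> ball A 1 \<Longrightarrow> g z = (z - A) * q z"
    using divide_out_zero[OF gh] by (auto simp: g_def)
  have A1: "A \<in> ball A 1" by simp
  have dq: "(q has_field_derivative deriv q A) (at A)" by (rule holomorphic_derivI[OF q(1) open_ball A1])
  have "((\<lambda>z. (z - A) * q z) has_field_derivative q A) (at A)"
    by (rule derivative_eq_intros dq refl | simp)+
  then have "(g has_field_derivative q A) (at A)"
    by (rule has_field_derivative_transform_within_open[OF _ open_ball A1]) (simp add: q(2))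
  moreover have "(g has_field_derivative s * exp (s * A)) (at A)"
    unfolding g_def by (rule derivative_eq_intros refl | simp)+
  ultimately have qA: "q A = exp l0" using DERIV_unique l0 by metis
  have "isCont (\<lambda>z. q z * exp (- l0)) A"
    by (intro continuous_mult continuous_const) (use dq DERIV_isCont in blast)
  then have "((\<lambda>z. q z * exp (- l0)) \<longlongrightarrow> 1) (at A)"
    unfolding isCont_def by (simp add: qA exp_minus)
  then have "\<forall>\<^sub>F z in at A. dist (q z * exp (- l0)) 1 < 1" by (rule tendstoD) simp
  then obtain d where d: "d > 0" "\<And>z. z \<noteq> A \<Longrightarrow> dist z A < d \<Longrightarrow> dist (q z * exp (- l0)) 1 < 1"
    unfolding eventually_at by auto
  define \<epsilon> where "\<epsilon> = min d 1"
  have \<epsilon>: "\<epsilon> > 0" "ball A \<epsilon> \<subseteq> ball A 1" using d by (auto simp: \<epsilon>_def)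
  have Repos: "Re (q z * exp (- l0)) > 0" if z: "z \<in> ball A \<epsilon>" for z
  proof (cases "z = A")
    case False
    then have "cmod (q z * exp (- l0) - 1) < 1" using d(2)[of z] z by (auto simp: \<epsilon>_def dist_norm norm_minus_commute)
    moreover have "\<bar>Re (q z * exp (- l0) - 1)\<bar> \<le> cmod (q z * exp (- l0) - 1)" by (rule abs_Re_le_cmod)
    ultimately show ?thesis by simp
  qed (simp add: qA exp_minus)
  \<comment> \<open>Near A the quotient q e^{-l0} is close to 1, so ll is the holomorphic logarithm
    of q with value l0 at A.\<close>
  define ll where "ll = (\<lambda>z. l0 + Ln (q z * exp (- l0)))"
  have llh: "ll holomorphic_on ball A \<epsilon>"
    unfolding ll_def
  proof (intro holomorphic_intros holomorphic_on_subset[OF q(1) \<epsilon>(2)])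
    show "q z * exp (- l0) \<notin> \<real>\<^sub>\<le>\<^sub>0" if "z \<in> ball A \<epsilon>" for z
      using Repos[OF that] by (simp add: complex_nonpos_Reals_iff)
  qed
  have main: "branch_powr \<alpha> (g z) e = (z - A) powr e * exp (e * ll z)" if z: "z \<in> strip a b \<inter> ball A \<epsilon>" for z
  proof -
    have zs: "z \<in> strip a b" "z \<in> ball A \<epsilon>" "z \<in> ball A 1" using z \<epsilon> by auto
    have nz: "z - A \<noteq> 0" by (rule edge_point_neq[OF A zs(1)])
    have qnz: "q z * exp (- l0) \<noteq> 0" using Repos[OF zs(2)] by auto
    \<comment> \<open>A logarithm of g z with the wanted product form. It remains to show that its
      imaginary part lies in the window of \<open>branch_ln\<close>.\<close>
    define \<Lambda> where "\<Lambda> = Ln (z - A) + ll z"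
    have Im\<Lambda>: "Im \<Lambda> = Im (Ln (z - A)) + Im (ll z)" by (simp add: \<Lambda>_def)
    have "exp \<Lambda> = (z - A) * (exp l0 * (q z * exp (- l0)))"
      unfolding \<Lambda>_def ll_def by (simp only: exp_add exp_Ln[OF nz] exp_Ln[OF qnz])
    also have "exp l0 * (q z * exp (- l0)) = q z" by (simp add: exp_minus)
    finally have e\<Lambda>: "exp \<Lambda> = g z" using q(2)[OF zs(3)] by simp
    have small: "\<bar>Im (ll z) - Im l0\<bar> < pi / 2"
      using Re_Ln_pos_lt[OF qnz] Repos[OF zs(2)] by (simp add: ll_def)
    have "cmod (z - A) < 1" using zs(3) by (simp add: dist_norm norm_minus_commute)
    then have im1: "\<bar>Im (z - A)\<bar> < pi" using abs_Im_le_cmod[of "z - A"] pi_gt3 by linarith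
    \<comment> \<open>Rotating by l0 reduces g to a positive multiple of s (e^{s(z-A)} - 1). Its
      imaginary part has the sign of sin (Im (z - A)) for s = 1 and for s = -1.\<close>
    have "g z * cis (- Im l0) = of_real (exp (Re l0)) * (s * (exp (s * (z - A)) - 1))"
    proof -
      have "exp (s * z) = exp (s * A) * exp (s * (z - A))" by (simp add: exp_add[symmetric] algebra_simps)
      then have "g z = exp (s * A) * (exp (s * (z - A)) - 1)" by (simp add: g_def algebra_simps)
      moreover have "exp (s * A) = s * exp l0" using s l0 by auto
      ultimately have "g z * cis (- Im l0) = (exp l0 * cis (- Im l0)) * (s * (exp (s * (z - A)) - 1))"
        by (simp only: mult_ac)
      also have "exp l0 * cis (- Im l0) = of_real (exp (Re l0))"
        by (simp add: exp_eq_polar[of l0] cis_mult mult.assoc)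
      finally show ?thesis .
    qed
    moreover have "Im (s * (exp (s * y) - 1)) = exp (Re (s * y)) * sin (Im y)" for y
      using s by (auto simp: Im_exp)
    ultimately have Img: "Im (g z * cis (- Im l0)) = exp (Re l0) * (exp (Re (s * (z - A))) * sin (Im (z - A)))"
      by (simp only: times_complex.sel Re_complex_of_real Im_complex_of_real mult_zero_left add_0_right)
    have sn: "exp (Re \<Lambda>) * sin (Im \<Lambda> - Im l0) = exp (Re l0) * (exp (Re (s * (z - A))) * sin (Im (z - A)))"
      using Im_exp_cis[of \<Lambda> "Im l0"] unfolding e\<Lambda> Img by simp
    have rng: "\<alpha> - pi < Im \<Lambda> \<and> Im \<Lambda> \<le> \<alpha> + pi"
    proof (cases "Im A = a")
      case True
      then have pos: "Im (z - A) > 0" using zs(1) by (simp add: strip_def)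
      have "sin (Im (z - A)) > 0" by (rule sin_gt_zero) (use pos im1 in auto)
      then have "exp (Re \<Lambda>) * sin (Im \<Lambda> - Im l0) > 0" unfolding sn by simp
      then have sp: "sin (Im \<Lambda> - Im l0) > 0" by (simp add: zero_less_mult_iff)
      have L: "0 < Im (Ln (z - A))" "Im (Ln (z - A)) < pi" using Im_Ln_pos_lt_imp[OF pos] by auto
      \<comment> \<open>The argument of z - A together with the error below \<pi>/2 gives only the
        interval (-\<pi>/2, 3\<pi>/2). The sign of the sine then narrows it to (0, \<pi>).\<close>
      have r: "Im \<Lambda> - Im l0 > - pi / 2" "Im \<Lambda> - Im l0 < 3 * pi / 2"
        using L small unfolding Im\<Lambda> by linarith+
      have "0 < Im \<Lambda> - Im l0"
      proof (rule ccontr)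
        assume "\<not> ?thesis"
        then have "sin (- (Im \<Lambda> - Im l0)) \<ge> 0" using r by (intro sin_ge_zero) auto
        then show False using sp by (simp only: sin_minus)
      qed
      moreover have "Im \<Lambda> - Im l0 < pi"
      proof (rule ccontr)
        assume "\<not> ?thesis"
        then have "sin (Im \<Lambda> - Im l0 - pi) \<ge> 0" using r by (intro sin_ge_zero) auto
        then show False using sp by (simp add: sin_diff mult.commute)
      qed
      ultimately show ?thesis using above[OF True] by linarith
    next
      case False
      then have B: "Im A = b" using A by (simp add: edge_point_def)
      then have neg: "Im (z - A) < 0" using zs(1) by (simp add: strip_def)
      have "sin (- Im (z - A)) > 0" by (rule sin_gt_zero) (use neg im1 in auto)
      then have "sin (Im (z - A)) < 0" by (simp only: sin_minus)
      then have "exp (Re \<Lambda>) * sin (Im \<Lambda> - Im l0) < 0" unfolding sn by (simp add: mult_less_0_iff)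
      then have sp: "sin (Im \<Lambda> - Im l0) < 0" by (simp add: mult_less_0_iff)
      have L: "- pi < Im (Ln (z - A))" "Im (Ln (z - A)) < 0"
        using mpi_less_Im_Ln[OF nz] Im_Ln_pos_le[OF nz] Im_Ln_le_pi[OF nz] neg by auto
      have r: "Im \<Lambda> - Im l0 > - 3 * pi / 2" "Im \<Lambda> - Im l0 < pi / 2"
        using L small unfolding Im\<Lambda> by linarith+
      have "Im \<Lambda> - Im l0 < 0"
      proof (rule ccontr)
        assume "\<not> ?thesis"
        then have "sin (Im \<Lambda> - Im l0) \<ge> 0" using r by (intro sin_ge_zero) auto
        then show False using sp by simp
      qed
      moreover have "- pi < Im \<Lambda> - Im l0"
      proof (rule ccontr)
        assume "\<not> ?thesis"
        then have "sin (- (Im \<Lambda> - Im l0) - pi) \<ge> 0" using r by (intro sin_ge_zero) auto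
        then show False using sp by (simp add: sin_diff mult.commute)
      qed
      ultimately show ?thesis using below[OF B] by linarith
    qed
    have "branch_ln \<alpha> (g z) = \<Lambda>" using branch_ln_eqI[OF e\<Lambda>] rng by blast
    then show ?thesis using nz by (simp add: branch_powr_def \<Lambda>_def distrib_left exp_add powr_def)
  qed
  have l0A: "exp (e * ll A) = exp (e * l0)" by (simp add: ll_def qA exp_minus)
  have "(\<lambda>z. exp (e * ll z)) holomorphic_on ball A \<epsilon>" by (intro holomorphic_intros llh)
  then show "branch_at A (strip a b) e (\<lambda>z. branch_powr \<alpha> (exp (s * z) - exp (s * A)) e) (exp (e * l0))"
    unfolding branch_at_def using \<epsilon>(1) l0A main unfolding g_def
    by (intro exI[of _ \<epsilon>] conjI exI[of _ "\<lambda>z. exp (e * ll z)"]) auto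
qed

text \<open>Let y = P v. From M P = P \<mu> every \<mu> behind P becomes an M in front, so that D y
  = (M - \<rho>1)(M - \<rho>2) u - (\<sigma> - M) y. Inserting y = -(1 - \<tau>e^z) D u - M u
  cancels M^2 u, \<sigma> M u and M D u, and a second-order system with M only in the last sum
  remains.\<close>

lemma extension_equation_of_system:
  fixes P Q M :: "nat \<Rightarrow> nat \<Rightarrow> complex" and \<mu> \<tau> :: "nat \<Rightarrow> complex"
  assumes S: "open S" and u: "\<And>i. i < N \<Longrightarrow> u i holomorphic_on S" and v: "\<And>j. j < N \<Longrightarrow> v j holomorphic_on S"
    and E1: "\<And>i z. i < N \<Longrightarrow> z \<in> S \<Longrightarrow> - (1 - \<tau> i * exp z) * deriv (u i) z = (\<Sum>c<N. M i c * u c z) + (\<Sum>j<N. P i j * v j z)"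
    and E2: "\<And>j z. j < N \<Longrightarrow> z \<in> S \<Longrightarrow> - deriv (v j) z
        = - ((\<mu> j - \<rho>1) * (\<mu> j - \<rho>2)) * (\<Sum>c<N. Q j c * u c z) + (\<rho>1 + \<rho>2 - \<mu> j) * v j z"
    and MP: "\<And>i j. i < N \<Longrightarrow> j < N \<Longrightarrow> (\<Sum>c<N. M i c * P c j) = P i j * \<mu> j"
    and PQ: "\<And>i x. i < N \<Longrightarrow> (\<Sum>j<N. P i j * (\<Sum>c<N. Q j c * x c)) = (x i :: complex)"
  shows "extension_equation N M \<tau> \<rho>1 \<rho>2 S u"
  unfolding extension_equation_def
proof (intro allI impI conjI ballI u)
  fix i z assume i: "i < N" and z: "z \<in> S"
  have a: "(\<Sum>j<N. P i j * (\<mu> j * x j)) = (\<Sum>c<N. M i c * (\<Sum>j<N. P c j * x j))" if i: "i < N" for i x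
  proof -
    have "(\<Sum>c<N. M i c * (\<Sum>j<N. P c j * x j)) = (\<Sum>j<N. \<Sum>c<N. M i c * P c j * x j)"
      by (simp only: sum_distrib_left mult.assoc) (rule sum.swap)
    also have "\<dots> = (\<Sum>j<N. (\<Sum>c<N. M i c * P c j) * x j)" by (simp only: sum_distrib_right)
    also have "\<dots> = (\<Sum>j<N. P i j * (\<mu> j * x j))"
      by (rule sum.cong[OF refl]) (simp only: lessThan_iff MP[OF i] mult.assoc)
    finally show ?thesis by simp
  qed
  define Mu where "Mu x i = (\<Sum>c<N. M i c * x c)" for x :: "nat \<Rightarrow> complex" and i
  define Qx where "Qx = (\<lambda>j. \<Sum>c<N. Q j c * u c z)"
  have b1: "(\<Sum>j<N. P i j * Qx j) = u i z" if "i < N" for i unfolding Qx_def by (rule PQ[OF that])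
  have b2: "(\<Sum>j<N. P i j * (\<mu> j * Qx j)) = Mu (\<lambda>c. u c z) i" if "i < N" for i
    unfolding a[OF that] Mu_def by (rule sum.cong[OF refl]) (simp add: b1)
  have b3: "(\<Sum>j<N. P i j * (\<mu> j * (\<mu> j * Qx j))) = Mu (Mu (\<lambda>c. u c z)) i" if "i < N" for i
    unfolding a[OF that] Mu_def[of "Mu _"] by (rule sum.cong[OF refl]) (simp add: b2)
  define y where "y = (\<lambda>i z. \<Sum>j<N. P i j * v j z)"
  have y_eq: "y i z = - (1 - \<tau> i * exp z) * deriv (u i) z - (\<Sum>c<N. M i c * u c z)" if "i < N" "z \<in> S" for i z
    using E1[OF that] by (simp add: y_def)
  have du: "(u c has_field_derivative deriv (u c) z) (at z)" if "c < N" for c by (rule holomorphic_derivI[OF u[OF that] S z])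
  have du2: "(deriv (u i) has_field_derivative deriv (deriv (u i)) z) (at z)"
    by (rule holomorphic_derivI[OF holomorphic_deriv[OF u[OF i] S] S z])
  have "((\<lambda>z. - (1 - \<tau> i * exp z) * deriv (u i) z - (\<Sum>c<N. M i c * u c z)) has_field_derivative
      (\<tau> i * exp z * deriv (u i) z + - (1 - \<tau> i * exp z) * deriv (deriv (u i)) z) - (\<Sum>c<N. M i c * deriv (u c) z)) (at z)"
  proof (intro DERIV_diff DERIV_sum DERIV_cmult du)
    show "((\<lambda>z. - (1 - \<tau> i * exp z) * deriv (u i) z) has_field_derivative
       \<tau> i * exp z * deriv (u i) z + - (1 - \<tau> i * exp z) * deriv (deriv (u i)) z) (at z)"
      by (rule derivative_eq_intros du2 refl | simp)+
  qed simp
  then have "(y i has_field_derivative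
      (\<tau> i * exp z * deriv (u i) z + - (1 - \<tau> i * exp z) * deriv (deriv (u i)) z) - (\<Sum>c<N. M i c * deriv (u c) z)) (at z)"
    by (rule has_field_derivative_transform_within_open[OF _ S z]) (simp add: y_eq[OF i])
  moreover have "(y i has_field_derivative (\<Sum>j<N. P i j * deriv (v j) z)) (at z)"
    unfolding y_def by (intro DERIV_sum DERIV_cmult holomorphic_derivI[OF v S z]) simp
  ultimately have d: "(\<tau> i * exp z * deriv (u i) z + - (1 - \<tau> i * exp z) * deriv (deriv (u i)) z) - (\<Sum>c<N. M i c * deriv (u c) z)
      = (\<Sum>j<N. P i j * deriv (v j) z)" by (rule DERIV_unique)
  have "(\<Sum>j<N. P i j * deriv (v j) z) = (\<Sum>j<N. P i j * (\<mu> j * (\<mu> j * Qx j)) - (\<rho>1 + \<rho>2) * (P i j * (\<mu> j * Qx j))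
      + \<rho>1 * \<rho>2 * (P i j * Qx j) - (\<rho>1 + \<rho>2) * (P i j * v j z) + P i j * (\<mu> j * v j z))"
  proof (rule sum.cong[OF refl])
    fix j assume "j \<in> {..<N}"
    then have e: "deriv (v j) z = (\<mu> j - \<rho>1) * (\<mu> j - \<rho>2) * Qx j - (\<rho>1 + \<rho>2 - \<mu> j) * v j z"
      using E2[of j z] z by (simp add: Qx_def algebra_simps)
    show "P i j * deriv (v j) z = P i j * (\<mu> j * (\<mu> j * Qx j)) - (\<rho>1 + \<rho>2) * (P i j * (\<mu> j * Qx j))
      + \<rho>1 * \<rho>2 * (P i j * Qx j) - (\<rho>1 + \<rho>2) * (P i j * v j z) + P i j * (\<mu> j * v j z)"
      unfolding e by (simp add: algebra_simps)
  qed
  also have "\<dots> = Mu (Mu (\<lambda>c. u c z)) i - (\<rho>1 + \<rho>2) * Mu (\<lambda>c. u c z) i + \<rho>1 * \<rho>2 * u i z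
      - (\<rho>1 + \<rho>2) * y i z + Mu (\<lambda>c. y c z) i"
    by (simp only: sum.distrib sum_subtractf sum_distrib_left[symmetric] b1[OF i] b2[OF i] b3[OF i] a[OF i, of "\<lambda>j. v j z"] y_def Mu_def[of "\<lambda>c. \<Sum>j<N. P c j * v j z"])
  finally have d2: "(\<Sum>j<N. P i j * deriv (v j) z) = Mu (Mu (\<lambda>c. u c z)) i - (\<rho>1 + \<rho>2) * Mu (\<lambda>c. u c z) i + \<rho>1 * \<rho>2 * u i z
      - (\<rho>1 + \<rho>2) * y i z + Mu (\<lambda>c. y c z) i" .
  define s1 s2 where "s1 = (\<Sum>c<N. M i c * deriv (u c) z)" and "s2 = (\<Sum>c<N. M i c * (\<tau> c * exp z * deriv (u c) z))"
  have My: "Mu (\<lambda>c. y c z) i = - s1 + s2 - Mu (Mu (\<lambda>c. u c z)) i"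
  proof -
    have "Mu (\<lambda>c. y c z) i = (\<Sum>c<N. - (M i c * deriv (u c) z) + M i c * (\<tau> c * exp z * deriv (u c) z) - M i c * Mu (\<lambda>c. u c z) c)"
      unfolding Mu_def[of "\<lambda>c. y c z"]
      by (rule sum.cong[OF refl]) (simp add: y_eq[OF _ z] Mu_def algebra_simps)
    then show ?thesis by (simp only: sum.distrib sum_subtractf sum_negf s1_def s2_def Mu_def[of "Mu _"])
  qed
  have yi: "y i z = - (1 - \<tau> i * exp z) * deriv (u i) z - Mu (\<lambda>c. u c z) i" using y_eq[OF i z] by (simp add: Mu_def)
  show "deriv (deriv (u i)) z + (\<rho>1 + \<rho>2) * deriv (u i) z + \<rho>1 * \<rho>2 * u i z
       = \<tau> i * exp z * (deriv (deriv (u i)) z + (1 + \<rho>1 + \<rho>2) * deriv (u i) z)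
         - (\<Sum>j<N. M i j * (\<tau> j * exp z * deriv (u j) z))"
    using d unfolding d2 My yi s1_def[symmetric] s2_def[symmetric] by (simp add: algebra_simps)
qed

lemma sector_strip: "sector c \<alpha> \<beta> = (\<lambda>z. c + exp (- z)) ` strip (- \<beta>) (- \<alpha>)"
proof (intro equalityI subsetI)
  fix x assume "x \<in> sector c \<alpha> \<beta>"
  then obtain r \<phi> where x: "x = c + of_real r * cis \<phi>" "0 < r" "\<alpha> < \<phi>" "\<phi> < \<beta>" unfolding sector_def by blast
  then have "x = c + exp (- Complex (- ln r) (- \<phi>))" by (simp add: exp_eq_polar)
  then show "x \<in> (\<lambda>z. c + exp (- z)) ` strip (- \<beta>) (- \<alpha>)" using x by (intro image_eqI) (auto simp: strip_def)
next
  fix x assume "x \<in> (\<lambda>z. c + exp (- z)) ` strip (- \<beta>) (- \<alpha>)"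
  then obtain z where "x = c + exp (- z)" "- \<beta> < Im z" "Im z < - \<alpha>" by (auto simp: strip_def)
  then have "x = c + of_real (exp (- Re z)) * cis (- Im z) \<and> 0 < exp (- Re z) \<and> \<alpha> < - Im z \<and> - Im z < \<beta>"
    by (simp add: exp_eq_polar)
  then show "x \<in> sector c \<alpha> \<beta>" unfolding sector_def by blast
qed

text \<open>r is the local inverse of z -> c + e^{-z} at c + e^{-B}, and G composed with r is the
  extension. The claim concerns all points of the strip whose image is near c + e^{-B}, not only
  those near B, so it has to be excluded that r returns a point shifted by a multiple of
  2\<pi>i.\<close>

lemma branch_at_exp_pullback:
  assumes B: "edge_point a b B" and f: "branch_at B (strip a b) 0 f L"
  shows "\<exists>\<epsilon>>0. \<exists>H. H holomorphic_on ball (c + exp (- B)) \<epsilon> \<and>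
     (\<forall>z\<in>strip a b. c + exp (- z) \<in> ball (c + exp (- B)) \<epsilon> \<longrightarrow> f z = H (c + exp (- z)))"
proof -
  obtain d G where G: "d > 0" "G holomorphic_on ball B d" "\<And>z. z \<in> strip a b \<inter> ball B d \<Longrightarrow> f z = (z - B) powr 0 * G z"
    using f unfolding branch_at_def by blast
  define r where "r = (\<lambda>x. B - Ln ((x - c) * exp B))"
  have ab: "a < b" "b - a < 2 * pi" "Im B = a \<or> Im B = b" using B by (auto simp: edge_point_def)
  \<comment> \<open>With this bound and width b - a the imaginary parts of r(x) and z differ by less
    than 2\<pi>, which leaves only the shift k = 0.\<close>
  define d' where "d' = min d (2 * pi - (b - a))"
  have d': "d' > 0" using G ab by (simp add: d'_def)
  have eB: "exp (- B) * exp B = 1" by (simp add: exp_minus)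
  have "isCont r (c + exp (- B))"
    unfolding r_def by (intro continuous_intros) (auto simp: eB)
  moreover have rB: "r (c + exp (- B)) = B" by (simp add: r_def eB)
  ultimately obtain e1 where e1: "e1 > 0" "\<And>x. dist x (c + exp (- B)) < e1 \<Longrightarrow> dist (r x) B < d'"
    unfolding continuous_at_eps_delta using d' by metis
  define \<epsilon> where "\<epsilon> = min e1 (cmod (exp (- B)))"
  have \<epsilon>: "\<epsilon> > 0" using e1 by (simp add: \<epsilon>_def)
  have slit: "(x - c) * exp B \<notin> \<real>\<^sub>\<le>\<^sub>0" if x: "x \<in> ball (c + exp (- B)) \<epsilon>" for x
  proof -
    have "cmod (x - c - exp (- B)) < cmod (exp (- B))"
      using x by (simp add: \<epsilon>_def dist_norm norm_minus_commute algebra_simps)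
    then have "cmod (x - c - exp (- B)) * cmod (exp B) < cmod (exp (- B)) * cmod (exp B)" by (intro mult_strict_right_mono) auto
    then have "cmod ((x - c) * exp B - 1) < 1"
      by (simp only: norm_mult[symmetric] left_diff_distrib eB norm_one)
    then have "\<bar>Re ((x - c) * exp B - 1)\<bar> < 1" using abs_Re_le_cmod le_less_trans by blast
    then show ?thesis by (auto simp: complex_nonpos_Reals_iff)
  qed
  have rh: "r holomorphic_on ball (c + exp (- B)) \<epsilon>"
    unfolding r_def using slit by (intro holomorphic_intros) auto
  have rball: "r x \<in> ball B d'" if "x \<in> ball (c + exp (- B)) \<epsilon>" for x
    using e1(2)[of x] that by (simp add: \<epsilon>_def dist_commute)
  have "(G \<circ> r) holomorphic_on ball (c + exp (- B)) \<epsilon>"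
    by (rule holomorphic_on_compose_gen[OF rh G(2)]) (use rball in \<open>auto simp: d'_def\<close>)
  moreover have "f z = (G \<circ> r) (c + exp (- z))" if z: "z \<in> strip a b" and x: "c + exp (- z) \<in> ball (c + exp (- B)) \<epsilon>" for z
  proof -
    have "exp (- r (c + exp (- z))) = exp (- z)"
    proof -
      have "exp (- z) * exp B \<noteq> 0" by simp
      then have "exp (Ln (exp (- z) * exp B)) = exp (- z) * exp B" by (rule exp_Ln)
      then show ?thesis by (simp add: r_def exp_diff)
    qed
    then obtain k :: int where k: "- r (c + exp (- z)) = - z + (of_int (2 * k) * pi) * \<i>" by (auto simp: exp_eq)
    have "\<bar>Im (r (c + exp (- z)) - B)\<bar> \<le> cmod (r (c + exp (- z)) - B)" by (rule abs_Im_le_cmod)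
    also have "\<dots> < d'" using rball[OF x] by (simp add: dist_norm norm_minus_commute)
    finally have "\<bar>Im (r (c + exp (- z))) - Im B\<bar> < 2 * pi - (b - a)" by (simp add: d'_def)
    moreover have "\<bar>Im z - Im B\<bar> < b - a" using z ab by (auto simp: strip_def)
    ultimately have "\<bar>Im (r (c + exp (- z))) - Im z\<bar> < 2 * pi" by linarith
    moreover have "Im (r (c + exp (- z))) - Im z = - (2 * pi * of_int k)" using arg_cong[OF k, of Im] by (simp add: algebra_simps)
    ultimately have "2 * pi * \<bar>of_int k\<bar> < 2 * pi * 1" by (simp add: abs_mult)
    then have "\<bar>of_int k\<bar> < (1::real)" using mult_less_cancel_left_pos[of "2 * pi" "\<bar>of_int k\<bar>" 1] by simp
    then have "k = 0" by linarith
    then have rz: "r (c + exp (- z)) = z" using k by simp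
    have "z \<in> ball B d" using rball[OF x] unfolding rz by (simp add: d'_def)
    then show ?thesis using G(3)[of z] z rz edge_point_neq[OF B z] by simp
  qed
  ultimately show ?thesis using \<epsilon> by blast
qed

section \<open>Block matrices in coordinates\<close>

definition block_of :: "(nat \<Rightarrow> nat) \<Rightarrow> nat \<Rightarrow> nat" where
  "block_of s x = (LEAST i. x < (\<Sum>u\<in>{1..i}. s u))"

lemma sum_block_Suc: "1 \<le> (i::nat) \<Longrightarrow> (\<Sum>u\<in>{1..i}. s u) = (\<Sum>u\<in>{1..<i}. s u) + (s i :: nat)"
proof -
  assume "1 \<le> i"
  then have "{1..i} = insert i {1..<i}" by auto
  then show ?thesis by simp
qed

lemma block_of_eqI:
  assumes "1 \<le> i" "a < s i" "x = (\<Sum>u\<in>{1..<i}. s u) + a"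
  shows "block_of s x = i"
  unfolding block_of_def
proof (rule Least_equality)
  show "x < (\<Sum>u\<in>{1..i}. s u)" using assms sum_block_Suc[OF assms(1), of s] by simp
  fix j assume j: "x < (\<Sum>u\<in>{1..j}. s u)"
  show "i \<le> j"
  proof (rule ccontr)
    assume "\<not> i \<le> j"
    then have "(\<Sum>u\<in>{1..j}. s u) \<le> (\<Sum>u\<in>{1..<i}. s u)" by (intro sum_mono2) auto
    then show False using j assms(3) by simp
  qed
qed

lemma block_ofE:
  assumes "x < (\<Sum>u\<in>{1..p}. s u)"
  obtains a where "block_of s x \<in> {1..p}" "a < s (block_of s x)" "x = (\<Sum>u\<in>{1..<block_of s x}. s u) + a"
proof -
  let ?i = "block_of s x"
  have lt: "x < (\<Sum>u\<in>{1..?i}. s u)" unfolding block_of_def by (rule LeastI[of _ p]) (rule assms)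
  have le: "?i \<le> p" unfolding block_of_def by (rule Least_le) (rule assms)
  have i1: "1 \<le> ?i"
  proof (rule ccontr)
    assume "\<not> 1 \<le> ?i"
    then have "?i = 0" by simp
    then show False using lt by simp
  qed
  have "\<not> x < (\<Sum>u\<in>{1..?i - 1}. s u)"
    using not_less_Least[of "?i - 1" "\<lambda>i. x < (\<Sum>u\<in>{1..i}. s u)"] i1 unfolding block_of_def by simp
  moreover have "{1..?i - 1} = {1..<?i}" using i1 by auto
  ultimately have ge: "(\<Sum>u\<in>{1..<?i}. s u) \<le> x" by simp
  show thesis
    by (rule that[of "x - (\<Sum>u\<in>{1..<?i}. s u)"]) (use i1 le lt ge sum_block_Suc[OF i1, of s] in auto)
qed

text \<open>A scalar block matrix becomes a diagonal indexed by position. Block numbers start at 1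
  and positions at 0, and \<open>block_of\<close> translates between them; the induction splits off
  the last block.\<close>

lemma scalar_blocks_mat:
  "scalar_blocks p s c = Matrix.mat (\<Sum>u\<in>{1..p}. s u) (\<Sum>u\<in>{1..p}. s u) (\<lambda>(x, y). if x = y then c (block_of s x) else 0)"
proof (induction p)
  case 0
  then show ?case by (simp add: scalar_blocks_def) (rule eq_matI, auto)
next
  case (Suc p)
  let ?D = "\<Sum>u\<in>{1..p}. s u"
  have l: "[1..<Suc (Suc p)] = [1..<Suc p] @ [Suc p]" by simp
  have S: "(\<Sum>u\<in>{1..Suc p}. s u) = ?D + s (Suc p)" by simp
  have bl: "block_of s x = Suc p" if "?D \<le> x" "x < ?D + s (Suc p)" for x
  proof (rule block_of_eqI[of "Suc p" "x - ?D"])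
    have "{1..<Suc p} = {1..p}" by auto
    then show "x = (\<Sum>u\<in>{1..<Suc p}. s u) + (x - ?D)" using that by simp
  qed (use that in auto)
  have "scalar_blocks (Suc p) s c = four_block_mat (scalar_blocks p s c) (0\<^sub>m ?D (s (Suc p))) (0\<^sub>m (s (Suc p)) ?D) (c (Suc p) \<cdot>\<^sub>m 1\<^sub>m (s (Suc p)))"
    unfolding scalar_blocks_def l map_append list.map diag_block_mat_last
    using Suc.IH unfolding scalar_blocks_def by (simp add: Let_def)
  also have "\<dots> = Matrix.mat (\<Sum>u\<in>{1..Suc p}. s u) (\<Sum>u\<in>{1..Suc p}. s u) (\<lambda>(x, y). if x = y then c (block_of s x) else 0)"
    unfolding S Suc.IH
  proof (rule eq_matI)
    fix i j assume "i < dim_row (Matrix.mat (?D + s (Suc p)) (?D + s (Suc p)) (\<lambda>(x, y). if x = y then c (block_of s x) else 0))"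
      "j < dim_col (Matrix.mat (?D + s (Suc p)) (?D + s (Suc p)) (\<lambda>(x, y). if x = y then c (block_of s x) else 0))"
    then have ij: "i < ?D + s (Suc p)" "j < ?D + s (Suc p)" by simp_all
    show "four_block_mat (Matrix.mat ?D ?D (\<lambda>(x, y). if x = y then c (block_of s x) else 0)) (0\<^sub>m ?D (s (Suc p))) (0\<^sub>m (s (Suc p)) ?D) (c (Suc p) \<cdot>\<^sub>m 1\<^sub>m (s (Suc p))) $$ (i, j)
      = Matrix.mat (?D + s (Suc p)) (?D + s (Suc p)) (\<lambda>(x, y). if x = y then c (block_of s x) else 0) $$ (i, j)"
      using ij bl[of i] by (cases "i < ?D"; cases "j < ?D") (auto simp: index_mat_four_block)
  qed (auto simp: index_mat_four_block)
  finally show ?case .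
qed

lemma mult_mat_vec_index:
  assumes "B \<in> carrier_mat k n" "x \<in> carrier_vec n" "i < k"
  shows "vec_index (B *\<^sub>v x) i = (\<Sum>j<n. B $$ (i, j) * vec_index x j)"
  using assms by (simp add: scalar_prod_def atLeast0LessThan row_def)

lemma mult_mat_index:
  assumes "B \<in> carrier_mat k n" "C \<in> carrier_mat n l" "i < k" "j < l"
  shows "(B * C) $$ (i, j) = (\<Sum>u<n. B $$ (i, u) * C $$ (u, j))"
  using assms by (simp add: scalar_prod_def atLeast0LessThan row_def col_def)

section \<open>Transport of systems, local solutions and relations to the strip\<close>

lemma solves_okubo_component:
  assumes F: "solves_okubo d (Matrix.mat d d (\<lambda>(x, y). if x = y then tt x else 0)) B S F"
    and B: "B \<in> carrier_mat d d" and x: "x \<in> S" and b: "b < d"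
  shows "(x - tt b) * deriv (\<lambda>y. vec_index (F y) b) x = (\<Sum>c<d. B $$ (b, c) * vec_index (F x) c)"
proof -
  let ?T = "Matrix.mat d d (\<lambda>(x, y). if x = y then tt x else 0)"
  have Fx: "F x \<in> carrier_vec d" using F x by (simp add: solves_okubo_def vec_holomorphic_on_def)
  have "vec_index ((x \<cdot>\<^sub>m 1\<^sub>m d - ?T) *\<^sub>v vec_deriv d F x) b
      = (\<Sum>c<d. (x \<cdot>\<^sub>m 1\<^sub>m d - ?T) $$ (b, c) * vec_index (vec_deriv d F x) c)"
    by (rule mult_mat_vec_index) (use b in \<open>auto simp: vec_deriv_def\<close>)
  also have "\<dots> = (\<Sum>c<d. if c = b then (x - tt b) * deriv (\<lambda>y. vec_index (F y) b) x else 0)"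
    by (rule sum.cong) (use b in \<open>auto simp: vec_deriv_def\<close>)
  also have "\<dots> = (x - tt b) * deriv (\<lambda>y. vec_index (F y) b) x" using b by simp
  finally show ?thesis
    using F x mult_mat_vec_index[OF B Fx b] by (simp add: solves_okubo_def)
qed

lemma exp_pullback:
  assumes F: "vec_holomorphic_on d F S" and S: "open S" and sub: "\<And>z. z \<in> R \<Longrightarrow> o' + exp (s * z) \<in> S" and b: "b < d"
    and z: "z \<in> R"
  shows "((\<lambda>z. vec_index (F (o' + exp (s * z))) b) has_field_derivative
      s * exp (s * z) * deriv (\<lambda>y. vec_index (F y) b) (o' + exp (s * z))) (at z)"
proof -
  have "(\<lambda>y. vec_index (F y) b) holomorphic_on S" using F b by (simp add: vec_holomorphic_on_def)
  note 1 = holomorphic_derivI[OF this S sub[OF z]]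
  have "((\<lambda>z. o' + exp (s * z)) has_field_derivative s * exp (s * z)) (at z)"
    by (rule derivative_eq_intros refl | simp)+
  from DERIV_chain2[OF 1 this] show ?thesis by (simp add: mult_ac)
qed

lemma exp_pullback_holomorphic:
  assumes F: "vec_holomorphic_on d F S" and S: "open S" and R: "open R" and sub: "\<And>z. z \<in> R \<Longrightarrow> o' + exp (s * z) \<in> S" and b: "b < d"
  shows "(\<lambda>z. vec_index (F (o' + exp (s * z))) b) holomorphic_on R"
  unfolding holomorphic_on_open[OF R] using exp_pullback[OF F S sub b] by blast

lemma okubo_level_pullback:
  assumes F: "solves_okubo N (Matrix.mat N N (\<lambda>(x, y). if x = y then tt x else 0)) B S F" and B: "B \<in> carrier_mat N N"
    and S: "open S" and sub: "\<And>z. z \<in> strip a b \<Longrightarrow> o' + exp z \<in> S"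
    and \<tau>: "\<And>i. i < N \<Longrightarrow> \<tau> i * (tt i - o') = 1"
  shows "okubo_level N (\<lambda>i j. B $$ (i, j)) \<tau> 0 (strip a b) (\<lambda>i z. vec_index (F (o' + exp z)) i)"
  unfolding okubo_level_def
proof (intro allI impI conjI ballI)
  fix i assume i: "i < N"
  have Fh: "vec_holomorphic_on N F S" using F by (simp add: solves_okubo_def)
  have sub': "o' + exp (1 * z) \<in> S" if "z \<in> strip a b" for z using sub[OF that] by simp
  show "(\<lambda>z. vec_index (F (o' + exp z)) i) holomorphic_on strip a b"
    using exp_pullback_holomorphic[OF Fh S strip_open sub' i] by simp
  fix z assume z: "z \<in> strip a b"
  have d: "deriv (\<lambda>z. vec_index (F (o' + exp z)) i) z = exp z * deriv (\<lambda>y. vec_index (F y) i) (o' + exp z)"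
    using DERIV_imp_deriv[OF exp_pullback[OF Fh S sub' i z]] by simp
  define w' where "w' = deriv (\<lambda>y. vec_index (F y) i) (o' + exp z)"
  have e: "(o' + exp z - tt i) * w' = (\<Sum>j<N. B $$ (i, j) * vec_index (F (o' + exp z)) j)"
    unfolding w'_def by (rule solves_okubo_component[OF F B sub[OF z] i])
  then have "\<tau> i * exp z * (exp z * w' - (\<Sum>j<N. B $$ (i, j) * vec_index (F (o' + exp z)) j) - 0 * vec_index (F (o' + exp z)) i)
      = (\<tau> i * (tt i - o')) * (exp z * w')"
    by (simp add: algebra_simps flip: e)
  then show "deriv (\<lambda>z. vec_index (F (o' + exp z)) i) z
      = \<tau> i * exp z * (deriv (\<lambda>z. vec_index (F (o' + exp z)) i) z - (\<Sum>j<N. B $$ (i, j) * vec_index (F (o' + exp z)) j)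
        - 0 * vec_index (F (o' + exp z)) i)"
    unfolding d w'_def[symmetric] \<tau>[OF i] by simp
qed

text \<open>S0 has to contain the image of the strip only near A: the branch is prescribed there,
  and elsewhere F is its continuation. The number l0 is the logarithm at A of the quotient of x - c
  by z - A, so the normalisation of the power enters as e^{e l0}.\<close>

lemma local_solution_branch:
  assumes F: "local_solution d T B c e v \<alpha> S0 S F" and b: "b < d" and A: "edge_point x y A"
    and s: "s = 1 \<or> s = - 1" and l0: "exp l0 = s * exp (s * A)" and c: "c = o' + exp (s * A)"
    and above: "Im A = x \<Longrightarrow> \<alpha> - pi \<le> Im l0 \<and> Im l0 \<le> \<alpha>"
    and below: "Im A = y \<Longrightarrow> \<alpha> \<le> Im l0 \<and> Im l0 \<le> \<alpha> + pi"
    and S0: "\<epsilon>0 > 0" "\<And>z. z \<in> strip x y \<Longrightarrow> z \<in> ball A \<epsilon>0 \<Longrightarrow> o' + exp (s * z) \<in> S0"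
  shows "branch_at A (strip x y) e (\<lambda>z. vec_index (F (o' + exp (s * z))) b) (exp (e * l0) * vec_index v b)"
proof -
  obtain \<epsilon> G where G: "\<epsilon> > 0" "vec_holomorphic_on d G (ball c \<epsilon>)" "G c = v"
    "\<And>x. x \<in> S0 \<inter> ball c \<epsilon> \<Longrightarrow> F x = branch_powr \<alpha> (x - c) e \<cdot>\<^sub>v G x"
    using F unfolding local_solution_def by blast
  have Gb: "(\<lambda>x. vec_index (G x) b) holomorphic_on ball c \<epsilon>" using G(2) b by (simp add: vec_holomorphic_on_def)
  have "isCont (\<lambda>z. o' + exp (s * z)) A" by (intro continuous_intros)
  then obtain d' where d': "d' > 0" "\<And>z. dist z A < d' \<Longrightarrow> dist (o' + exp (s * z)) (o' + exp (s * A)) < \<epsilon>"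
    unfolding continuous_at_eps_delta using G(1) by metis
  have inball: "o' + exp (s * z) \<in> ball c \<epsilon>" if "z \<in> ball A d'" for z
    using d'(2)[of z] that by (simp add: c dist_commute)
  have "((\<lambda>x. vec_index (G x) b) \<circ> (\<lambda>z. o' + exp (s * z))) holomorphic_on ball A d'"
    by (rule holomorphic_on_compose_gen[OF _ Gb]) (use inball in \<open>auto intro!: holomorphic_intros\<close>)
  from branch_at_holomorphic[OF this d'(1) edge_point_notin[OF A]]
  have 1: "branch_at A (strip x y) 0 (\<lambda>z. vec_index (G (o' + exp (s * z))) b) (vec_index v b)"
    using G(3) by (simp add: o_def c)
  have 2: "branch_at A (strip x y) e (\<lambda>z. branch_powr \<alpha> (exp (s * z) - exp (s * A)) e) (exp (e * l0))"
    by (rule branch_powr_exp_diff[OF A s l0 above below])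
  from branch_at_mult[OF 2 1]
  obtain \<epsilon>1 H where H: "\<epsilon>1 > 0" "H holomorphic_on ball A \<epsilon>1" "H A = exp (e * l0) * vec_index v b"
    "\<And>z. z \<in> strip x y \<inter> ball A \<epsilon>1 \<Longrightarrow> branch_powr \<alpha> (exp (s * z) - exp (s * A)) e * vec_index (G (o' + exp (s * z))) b = (z - A) powr (e + 0) * H z"
    unfolding branch_at_def by blast
  define \<epsilon>2 where "\<epsilon>2 = min \<epsilon>1 (min d' \<epsilon>0)"
  have \<epsilon>2: "\<epsilon>2 > 0" "ball A \<epsilon>2 \<subseteq> ball A \<epsilon>1" "ball A \<epsilon>2 \<subseteq> ball A d'" "ball A \<epsilon>2 \<subseteq> ball A \<epsilon>0"
    using H(1) d'(1) S0(1) by (auto simp: \<epsilon>2_def)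
  have "vec_index (F (o' + exp (s * z))) b = (z - A) powr e * H z" if z: "z \<in> strip x y \<inter> ball A \<epsilon>2" for z
  proof -
    have zz: "z \<in> strip x y" "z \<in> ball A \<epsilon>1" "z \<in> ball A d'" "z \<in> ball A \<epsilon>0" using z \<epsilon>2 by auto
    have X: "o' + exp (s * z) \<in> S0 \<inter> ball c \<epsilon>" using S0(2)[OF zz(1,4)] inball[OF zz(3)] by blast
    have "G (o' + exp (s * z)) \<in> carrier_vec d" using G(2) X unfolding vec_holomorphic_on_def by blast
    then have "vec_index (F (o' + exp (s * z))) b = branch_powr \<alpha> (exp (s * z) - exp (s * A)) e * vec_index (G (o' + exp (s * z))) b"
      using G(4)[OF X] b by (simp add: c)
    then show ?thesis using H(4)[of z] zz by simp
  qed
  then show ?thesis unfolding branch_at_def using \<epsilon>2(1) H(3) holomorphic_on_subset[OF H(2) \<epsilon>2(2)] by blast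
qed

lemma connection_relation_pullback:
  assumes R: "connection_relation d S c r l C F V" and b: "b < d" and B: "edge_point x y B" and c: "c = o' + exp B"
    and sub: "\<And>z. z \<in> strip x y \<Longrightarrow> o' + exp z \<in> S"
  shows "\<exists>L. branch_at B (strip x y) 0 (\<lambda>z. vec_index (F (o' + exp z)) b
     - (\<Sum>k=1..r. \<Sum>h=1..l k. C k h * vec_index (V k h (o' + exp z)) b)) L"
proof -
  obtain H \<epsilon> where H: "\<epsilon> > 0" "vec_holomorphic_on d H (ball c \<epsilon>)"
    "\<And>x. x \<in> S \<Longrightarrow> vec_index (F x) b = (\<Sum>k=1..r. \<Sum>h=1..l k. C k h * vec_index (V k h x) b) + vec_index (H x) b"
    using R b unfolding connection_relation_def by blast
  have Hb: "(\<lambda>x. vec_index (H x) b) holomorphic_on ball c \<epsilon>" using H(2) b by (simp add: vec_holomorphic_on_def)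
  have "isCont (\<lambda>z. o' + exp z) B" by (intro continuous_intros)
  then obtain d' where d': "d' > 0" "\<And>z. dist z B < d' \<Longrightarrow> dist (o' + exp z) (o' + exp B) < \<epsilon>"
    unfolding continuous_at_eps_delta using H(1) by metis
  have "((\<lambda>x. vec_index (H x) b) \<circ> (\<lambda>z. o' + exp z)) holomorphic_on ball B d'"
    by (rule holomorphic_on_compose_gen[OF _ Hb]) (use d' in \<open>auto intro!: holomorphic_intros simp: c dist_commute\<close>)
  from branch_at_holomorphic[OF this d'(1) edge_point_notin[OF B]]
  have "branch_at B (strip x y) 0 (\<lambda>z. vec_index (H (o' + exp z)) b) (vec_index (H c) b)"
    by (simp add: o_def c)
  then have "branch_at B (strip x y) 0 (\<lambda>z. vec_index (F (o' + exp z)) b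
     - (\<Sum>k=1..r. \<Sum>h=1..l k. C k h * vec_index (V k h (o' + exp z)) b)) (vec_index (H c) b)"
    by (rule branch_at_cong) (simp add: H(3)[OF sub])
  then show ?thesis by blast
qed

lemma connection_relation_pushforward:
  assumes B: "edge_point x y B" and c: "c = o' + exp (- B)" and S: "S = (\<lambda>z. o' + exp (- z)) ` strip x y"
    and reg: "\<And>b. b < d \<Longrightarrow> \<exists>L. branch_at B (strip x y) 0 (\<lambda>z. vec_index (F (o' + exp (- z))) b
     - (\<Sum>k=1..r. \<Sum>h=1..l k. C k h * vec_index (V k h (o' + exp (- z))) b)) L"
  shows "connection_relation d S c r l C F V"
proof -
  define D where "D = (\<lambda>b x. vec_index (F x) b - (\<Sum>k=1..r. \<Sum>h=1..l k. C k h * vec_index (V k h x) b))"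
  have "\<forall>b. \<exists>p. b < d \<longrightarrow> fst p > 0 \<and> snd p holomorphic_on ball c (fst p) \<and> (\<forall>x\<in>S \<inter> ball c (fst p). D b x = snd p x)"
  proof
    fix b
    show "\<exists>p. b < d \<longrightarrow> fst p > 0 \<and> snd p holomorphic_on ball c (fst p) \<and> (\<forall>x\<in>S \<inter> ball c (fst p). D b x = snd p x)"
    proof (cases "b < d")
      case True
      then obtain L where "branch_at B (strip x y) 0 (\<lambda>z. D b (o' + exp (- z))) L" using reg unfolding D_def by blast
      from branch_at_exp_pullback[OF B this, of o'] obtain \<epsilon> H where
        "\<epsilon> > 0" "H holomorphic_on ball c \<epsilon>" "\<And>z. z \<in> strip x y \<Longrightarrow> o' + exp (- z) \<in> ball c \<epsilon> \<Longrightarrow> D b (o' + exp (- z)) = H (o' + exp (- z))"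
        unfolding c by blast
      then show ?thesis by (intro exI[of _ "(\<epsilon>, H)"]) (auto simp: S)
    qed auto
  qed
  from choice[OF this] obtain p where p: "\<And>b. b < d \<Longrightarrow> fst (p b) > 0"
    "\<And>b. b < d \<Longrightarrow> snd (p b) holomorphic_on ball c (fst (p b))"
    "\<And>b x. b < d \<Longrightarrow> x \<in> S \<Longrightarrow> x \<in> ball c (fst (p b)) \<Longrightarrow> D b x = snd (p b) x" by blast
  define \<epsilon> where "\<epsilon> = Min (insert 1 ((\<lambda>b. fst (p b)) ` {..<d}))"
  have \<epsilon>: "\<epsilon> > 0" unfolding \<epsilon>_def using p(1) by (subst Min_gr_iff) auto
  have sub: "ball c \<epsilon> \<subseteq> ball c (fst (p b))" if "b < d" for b
    by (rule subset_ball) (use that in \<open>auto simp: \<epsilon>_def intro!: Min_le\<close>)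
  \<comment> \<open>The remainder is wanted on all of S as well as near c. On S it is the difference
    itself, off S the local extension; the two agree on the overlap.\<close>
  define H where "H = (\<lambda>x. if x \<in> S then Matrix.vec d (\<lambda>b. D b x) else Matrix.vec d (\<lambda>b. snd (p b) x))"
  have "vec_holomorphic_on d H (ball c \<epsilon>)"
    unfolding vec_holomorphic_on_def
  proof (intro conjI ballI allI impI)
    show "H x \<in> carrier_vec d" for x by (simp add: H_def)
    fix b assume b: "b < d"
    have "snd (p b) holomorphic_on ball c \<epsilon>" by (rule holomorphic_on_subset[OF p(2)[OF b] sub[OF b]])
    then show "(\<lambda>x. vec_index (H x) b) holomorphic_on ball c \<epsilon>"
      by (rule holomorphic_transform) (use p(3)[OF b] sub[OF b] b in \<open>auto simp: H_def\<close>)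
  qed
  then show ?thesis unfolding connection_relation_def
    using \<epsilon> by (intro exI[of _ H] conjI ballI) (auto simp: H_def D_def)
qed

lemma sum_lessThan_add: "(\<Sum>c<N + (k::nat). f c) = (\<Sum>c<N. f c) + (\<Sum>j<k. f (N + j) :: 'a :: comm_monoid_add)"
  by (induction k) (auto simp: add.assoc)

lemma regular_deriv:
  assumes B: "edge_point a b B" and f: "branch_at B (strip a b) 0 f L"
  shows "\<exists>L'. branch_at B (strip a b) 0 (deriv f) L'"
  using branch_at_lift[of B "strip a b" "-1" "deriv f"] branch_at_deriv[OF B f] edge_point_notin[OF B] by auto

text \<open>The lower components are first-order differential expressions in the upper ones with
  entire coefficients, so they satisfy the same relation: such an operator maps a remainder
  holomorphic at B to another one.\<close>

lemma companion_connection: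
  assumes B: "edge_point a b B" and u: "\<And>i. i < N \<Longrightarrow> u i holomorphic_on strip a b"
    and u': "\<And>q i. q \<in> K \<Longrightarrow> i < N \<Longrightarrow> u' q i holomorphic_on strip a b"
    and reg: "\<And>i. i < N \<Longrightarrow> \<exists>L. branch_at B (strip a b) 0 (\<lambda>z. u i z - (\<Sum>q\<in>K. C q * u' q i z)) L"
    and v: "\<And>z. z \<in> strip a b \<Longrightarrow> v z = (\<Sum>i<N. Q i * (- (1 - \<tau> i * exp z) * deriv (u i) z - (\<Sum>c<N. M i c * u c z)))"
    and v': "\<And>q z. q \<in> K \<Longrightarrow> z \<in> strip a b \<Longrightarrow> v' q z = (\<Sum>i<N. Q i * (- (1 - \<tau> i * exp z) * deriv (u' q i) z - (\<Sum>c<N. M i c * u' q c z)))"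
  shows "\<exists>L. branch_at B (strip a b) 0 (\<lambda>z. v z - (\<Sum>q\<in>K. C q * v' q z)) L"
proof -
  let ?S = "strip a b"
  note Bn = edge_point_notin[OF B]
  define D where "D = (\<lambda>i z. u i z - (\<Sum>q\<in>K. C q * u' q i z))"
  have "\<forall>i. \<exists>L. i < N \<longrightarrow> branch_at B ?S 0 (D i) L" using reg by (auto simp: D_def)
  from choice[OF this] obtain L where L: "\<And>i. i < N \<Longrightarrow> branch_at B ?S 0 (D i) (L i)" by blast
  have "\<forall>i. \<exists>L. i < N \<longrightarrow> branch_at B ?S 0 (deriv (D i)) L" using regular_deriv[OF B L] by blast
  from choice[OF this] obtain L' where L': "\<And>i. i < N \<Longrightarrow> branch_at B ?S 0 (deriv (D i)) (L' i)" by blast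
  have dD: "deriv (D i) z = deriv (u i) z - (\<Sum>q\<in>K. C q * deriv (u' q i) z)" if i: "i < N" and z: "z \<in> ?S" for i z
    unfolding D_def
    by (rule DERIV_imp_deriv) (intro DERIV_diff DERIV_sum DERIV_cmult holomorphic_derivI[OF _ strip_open z] u u' i)
  have c: "branch_at B ?S 0 (\<lambda>z. - (1 - \<tau> i * exp z)) (- (1 - \<tau> i * exp B))" for i
    by (rule branch_at_holomorphic[of _ _ 1]) (auto intro!: holomorphic_intros Bn)
  have cd: "branch_at B ?S 0 (\<lambda>z. - (1 - \<tau> i * exp z) * deriv (D i) z) (- (1 - \<tau> i * exp B) * L' i)" if "i < N" for i
    using branch_at_mult[OF c L'[OF that]] by simp
  have "branch_at B ?S 0 (\<lambda>z. \<Sum>i<N. Q i * (- (1 - \<tau> i * exp z) * deriv (D i) z - (\<Sum>c<N. M i c * D c z)))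
     (\<Sum>i<N. Q i * (- (1 - \<tau> i * exp B) * L' i - (\<Sum>c<N. M i c * L c)))"
    by (intro branch_at_sum branch_at_cmult branch_at_diff cd L Bn) auto
  then have "branch_at B ?S 0 (\<lambda>z. v z - (\<Sum>q\<in>K. C q * v' q z)) (\<Sum>i<N. Q i * (- (1 - \<tau> i * exp B) * L' i - (\<Sum>c<N. M i c * L c)))"
  proof (rule branch_at_cong)
    fix z assume z: "z \<in> ?S"
    have "(\<Sum>q\<in>K. C q * v' q z) = (\<Sum>q\<in>K. \<Sum>i<N. C q * (Q i * (- (1 - \<tau> i * exp z) * deriv (u' q i) z - (\<Sum>c<N. M i c * u' q c z))))"
      by (rule sum.cong[OF refl]) (simp add: v'[OF _ z] sum_distrib_left)
    also have "\<dots> = (\<Sum>i<N. \<Sum>q\<in>K. C q * (Q i * (- (1 - \<tau> i * exp z) * deriv (u' q i) z - (\<Sum>c<N. M i c * u' q c z))))"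
      by (rule sum.swap)
    also have "\<dots> = (\<Sum>i<N. Q i * (- (1 - \<tau> i * exp z) * (\<Sum>q\<in>K. C q * deriv (u' q i) z) - (\<Sum>c<N. M i c * (\<Sum>q\<in>K. C q * u' q c z))))"
    proof (rule sum.cong[OF refl])
      fix i
      have "(\<Sum>q\<in>K. C q * (Q i * (- (1 - \<tau> i * exp z) * deriv (u' q i) z - (\<Sum>c<N. M i c * u' q c z))))
          = Q i * (\<Sum>q\<in>K. - (1 - \<tau> i * exp z) * (C q * deriv (u' q i) z) - (\<Sum>c<N. M i c * (C q * u' q c z)))"
        unfolding sum_distrib_left by (rule sum.cong[OF refl]) (simp add: right_diff_distrib sum_distrib_left mult_ac)
      also have "\<dots> = Q i * (- (1 - \<tau> i * exp z) * (\<Sum>q\<in>K. C q * deriv (u' q i) z) - (\<Sum>q\<in>K. \<Sum>c<N. M i c * (C q * u' q c z)))"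
        by (simp only: sum_subtractf sum_distrib_left)
      also have "(\<Sum>q\<in>K. \<Sum>c<N. M i c * (C q * u' q c z)) = (\<Sum>c<N. M i c * (\<Sum>q\<in>K. C q * u' q c z))"
        unfolding sum_distrib_left by (rule sum.swap)
      finally show "(\<Sum>q\<in>K. C q * (Q i * (- (1 - \<tau> i * exp z) * deriv (u' q i) z - (\<Sum>c<N. M i c * u' q c z))))
          = Q i * (- (1 - \<tau> i * exp z) * (\<Sum>q\<in>K. C q * deriv (u' q i) z) - (\<Sum>c<N. M i c * (\<Sum>q\<in>K. C q * u' q c z)))" .
    qed
    finally have s: "(\<Sum>q\<in>K. C q * v' q z) = (\<Sum>i<N. Q i * (- (1 - \<tau> i * exp z) * (\<Sum>q\<in>K. C q * deriv (u' q i) z) - (\<Sum>c<N. M i c * (\<Sum>q\<in>K. C q * u' q c z))))" .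
    show "(\<Sum>i<N. Q i * (- (1 - \<tau> i * exp z) * deriv (D i) z - (\<Sum>c<N. M i c * D c z))) = v z - (\<Sum>q\<in>K. C q * v' q z)"
      unfolding s v[OF z] sum_subtractf[symmetric]
    proof (rule sum.cong[OF refl])
      fix i assume "i \<in> {..<N}"
      then have i: "i < N" by simp
      have m: "(\<Sum>c<N. M i c * D c z) = (\<Sum>c<N. M i c * u c z) - (\<Sum>c<N. M i c * (\<Sum>q\<in>K. C q * u' q c z))"
        by (simp only: D_def right_diff_distrib sum_subtractf)
      show "Q i * (- (1 - \<tau> i * exp z) * deriv (D i) z - (\<Sum>c<N. M i c * D c z))
        = Q i * (- (1 - \<tau> i * exp z) * deriv (u i) z - (\<Sum>c<N. M i c * u c z))
          - Q i * (- (1 - \<tau> i * exp z) * (\<Sum>q\<in>K. C q * deriv (u' q i) z) - (\<Sum>c<N. M i c * (\<Sum>q\<in>K. C q * u' q c z)))"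
        unfolding m dD[OF i z] right_diff_distrib by simp
    qed
  qed
  then show ?thesis by blast
qed

section \<open>Consequences of the diagonalisation of A\<close>

lemma inverse_sums:
  fixes P Q :: "nat \<Rightarrow> nat \<Rightarrow> complex"
  assumes "\<And>i c. i < N \<Longrightarrow> c < N \<Longrightarrow> (\<Sum>j<N. P i j * Q j c) = (if i = c then 1 else 0)" and i: "i < N"
  shows "(\<Sum>j<N. P i j * (\<Sum>c<N. Q j c * x c)) = x i"
proof -
  have "(\<Sum>j<N. P i j * (\<Sum>c<N. Q j c * x c)) = (\<Sum>c<N. (\<Sum>j<N. P i j * Q j c) * x c)"
    by (simp only: sum_distrib_left sum_distrib_right mult.assoc) (rule sum.swap)
  also have "\<dots> = (\<Sum>c<N. if c = i then x i else 0)"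
    by (rule sum.cong) (use assms in auto)
  finally show ?thesis using i by simp
qed

text \<open>With M = P diag(\<mu>) Q and Q = P^{-1}, the inverse of M + s is P diag(1 / (\<mu> + s))
  Q.\<close>

lemma shifted_inverse_diagonalized:
  fixes P Q M :: "nat \<Rightarrow> nat \<Rightarrow> complex"
  assumes PQ: "\<And>i x. i < N \<Longrightarrow> (\<Sum>j<N. P i j * (\<Sum>c<N. Q j c * x c)) = (x i :: complex)"
    and MP: "\<And>i j. i < N \<Longrightarrow> j < N \<Longrightarrow> (\<Sum>c<N. M i c * P c j) = P i j * \<mu> j"
    and QM: "\<And>j c. j < N \<Longrightarrow> c < N \<Longrightarrow> (\<Sum>i<N. Q j i * M i c) = \<mu> j * Q j c"
    and nz: "\<And>j. j < N \<Longrightarrow> \<mu> j + s \<noteq> 0"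
  shows "shifted_inverse N M s (\<lambda>i c. \<Sum>j<N. P i j * (Q j c / (\<mu> j + s)))"
  unfolding shifted_inverse_def
proof (intro allI impI conjI)
  fix i and v :: "nat \<Rightarrow> complex" assume i: "i < N"
  define R where "R = (\<lambda>i c. \<Sum>j<N. P i j * (Q j c / (\<mu> j + s)))"
  have Rx: "(\<Sum>c<N. R i c * x c) = (\<Sum>j<N. P i j * ((\<Sum>c<N. Q j c * x c) / (\<mu> j + s)))" for i x
    unfolding R_def by (simp add: sum_distrib_left sum_distrib_right sum_divide_distrib mult_ac) (rule sum.swap)
  have Qv: "(\<Sum>c<N. Q j c * ((\<Sum>l<N. M c l * v l) + s * v c)) = (\<mu> j + s) * (\<Sum>c<N. Q j c * v c)" if j: "j < N" for j
  proof -
    have "(\<Sum>c<N. Q j c * (\<Sum>l<N. M c l * v l)) = (\<Sum>l<N. (\<Sum>c<N. Q j c * M c l) * v l)"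
      by (simp only: sum_distrib_left sum_distrib_right mult.assoc) (rule sum.swap)
    also have "\<dots> = \<mu> j * (\<Sum>l<N. Q j l * v l)"
      unfolding sum_distrib_left by (rule sum.cong[OF refl]) (simp add: QM[OF j] mult.assoc)
    finally show ?thesis by (simp add: distrib_left distrib_right sum.distrib sum_distrib_left mult_ac)
  qed
  have "(\<Sum>j<N. R i j * ((\<Sum>l<N. M j l * v l) + s * v j)) = (\<Sum>j<N. P i j * (\<Sum>c<N. Q j c * v c))"
    unfolding Rx by (rule sum.cong[OF refl]) (use nz in \<open>auto simp: Qv\<close>)
  then show "(\<Sum>j<N. (\<Sum>u<N. P i u * (Q u j / (\<mu> u + s))) * ((\<Sum>l<N. M j l * v l) + s * v j)) = v i"
    using PQ[OF i, of v] by (simp add: R_def)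
  have "(\<Sum>j<N. M i j * (\<Sum>l<N. R j l * v l)) = (\<Sum>u<N. (\<Sum>j<N. M i j * P j u) * ((\<Sum>c<N. Q u c * v c) / (\<mu> u + s)))"
    unfolding Rx by (simp only: sum_distrib_left[of "M i _"] sum_distrib_right mult.assoc) (rule sum.swap)
  also have "\<dots> = (\<Sum>u<N. P i u * (\<mu> u * ((\<Sum>c<N. Q u c * v c) / (\<mu> u + s))))"
    by (rule sum.cong[OF refl]) (simp add: MP[OF i] mult.assoc)
  finally have "(\<Sum>j<N. M i j * (\<Sum>l<N. R j l * v l)) + s * (\<Sum>l<N. R i l * v l)
      = (\<Sum>u<N. P i u * (\<mu> u * ((\<Sum>c<N. Q u c * v c) / (\<mu> u + s))) + s * (P i u * ((\<Sum>c<N. Q u c * v c) / (\<mu> u + s))))"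
    by (simp only: Rx sum.distrib sum_distrib_left)
  also have "\<dots> = (\<Sum>u<N. P i u * (\<Sum>c<N. Q u c * v c))"
  proof (rule sum.cong[OF refl])
    fix u assume "u \<in> {..<N}"
    then have n: "\<mu> u + s \<noteq> 0" using nz by simp
    define X where "X = (\<Sum>c<N. Q u c * v c)"
    have "P i u * (\<mu> u * (X / (\<mu> u + s))) + s * (P i u * (X / (\<mu> u + s))) = P i u * (((\<mu> u + s) * X) / (\<mu> u + s))"
      by (simp add: distrib_left distrib_right add_divide_distrib mult_ac)
    also have "\<dots> = P i u * X" using n by simp
    finally show "P i u * (\<mu> u * ((\<Sum>c<N. Q u c * v c) / (\<mu> u + s))) + s * (P i u * ((\<Sum>c<N. Q u c * v c) / (\<mu> u + s))) = P i u * (\<Sum>c<N. Q u c * v c)"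
      unfolding X_def .
  qed
  also have "\<dots> = v i" by (rule PQ[OF i])
  finally show "(\<Sum>j<N. M i j * (\<Sum>l<N. (\<Sum>u<N. P j u * (Q u l / (\<mu> u + s))) * v l)) + s * (\<Sum>l<N. (\<Sum>u<N. P i u * (Q u l / (\<mu> u + s))) * v l) = v i"
    unfolding R_def .
qed

lemma diagonal_mult_index:
  assumes X: "X \<in> carrier_mat N k" and i: "i < N" "j < k"
  shows "(Matrix.mat N N (\<lambda>(x, y). if x = y then f x else 0) * X) $$ (i, j) = f i * X $$ (i, j)"
proof -
  have "(Matrix.mat N N (\<lambda>(x, y). if x = y then f x else 0) * X) $$ (i, j) = (\<Sum>u<N. (if i = u then f i else 0) * X $$ (u, j))"
    by (subst mult_mat_index[OF _ X i]) (use i in auto)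
  also have "\<dots> = (\<Sum>u<N. if u = i then f i * X $$ (i, j) else 0)" by (rule sum.cong) auto
  finally show ?thesis using i by simp
qed

lemma extension_matrix_index:
  assumes A: "A \<in> carrier_mat N N" and P: "P \<in> carrier_mat N N" and Q: "Q \<in> carrier_mat N N"
    and A': "A' = Matrix.mat N N (\<lambda>(x, y). if x = y then \<mu> x else 0)" and i: "i < N" "j < N"
  shows "extension_matrix N A A' P Q \<rho>1 \<rho>2 $$ (i, j) = A $$ (i, j)"
    "extension_matrix N A A' P Q \<rho>1 \<rho>2 $$ (i, N + j) = P $$ (i, j)"
    "extension_matrix N A A' P Q \<rho>1 \<rho>2 $$ (N + i, j) = - ((\<mu> i - \<rho>1) * (\<mu> i - \<rho>2)) * Q $$ (i, j)"
    "extension_matrix N A A' P Q \<rho>1 \<rho>2 $$ (N + i, N + j) = (if i = j then \<rho>1 + \<rho>2 - \<mu> i else 0)"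
proof -
  have sub: "A' - c \<cdot>\<^sub>m 1\<^sub>m N = Matrix.mat N N (\<lambda>(x, y). if x = y then \<mu> x - c else 0)" for c
    unfolding A' by (rule eq_matI) auto
  define X where "X = (A' - \<rho>1 \<cdot>\<^sub>m 1\<^sub>m N) * (A' - \<rho>2 \<cdot>\<^sub>m 1\<^sub>m N) * Q"
  have c: "A' - c \<cdot>\<^sub>m 1\<^sub>m N \<in> carrier_mat N N" for c unfolding sub by simp
  have "X = (A' - \<rho>1 \<cdot>\<^sub>m 1\<^sub>m N) * ((A' - \<rho>2 \<cdot>\<^sub>m 1\<^sub>m N) * Q)"
    unfolding X_def by (rule assoc_mult_mat[OF c c Q])
  then have "X $$ (i, j) = (\<mu> i - \<rho>1) * (((A' - \<rho>2 \<cdot>\<^sub>m 1\<^sub>m N) * Q) $$ (i, j))"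
    using diagonal_mult_index[of "(A' - \<rho>2 \<cdot>\<^sub>m 1\<^sub>m N) * Q" N N i j "\<lambda>x. \<mu> x - \<rho>1"] mult_carrier_mat[OF c[of \<rho>2] Q] i
    by (simp add: sub)
  also have "((A' - \<rho>2 \<cdot>\<^sub>m 1\<^sub>m N) * Q) $$ (i, j) = (\<mu> i - \<rho>2) * Q $$ (i, j)"
    unfolding sub by (rule diagonal_mult_index[OF Q i])
  finally have Xij: "X $$ (i, j) = (\<mu> i - \<rho>1) * (\<mu> i - \<rho>2) * Q $$ (i, j)" by (simp add: mult.assoc)
  have Xc: "X \<in> carrier_mat N N" unfolding X_def using c Q by (intro mult_carrier_mat)
  have D: "((\<rho>1 + \<rho>2) \<cdot>\<^sub>m 1\<^sub>m N - A') \<in> carrier_mat N N" unfolding A' by (rule minus_carrier_mat) simp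
  have Dij: "((\<rho>1 + \<rho>2) \<cdot>\<^sub>m 1\<^sub>m N - A') $$ (i, j) = (if i = j then \<rho>1 + \<rho>2 - \<mu> i else 0)"
    unfolding A' using i by simp
  have dimA': "dim_row A' = N" "dim_col A' = N" by (simp_all add: A')
  have E: "extension_matrix N A A' P Q \<rho>1 \<rho>2 = four_block_mat A P (- X) ((\<rho>1 + \<rho>2) \<cdot>\<^sub>m 1\<^sub>m N - A')"
    by (simp only: extension_matrix_def X_def)
  show "extension_matrix N A A' P Q \<rho>1 \<rho>2 $$ (i, j) = A $$ (i, j)"
    "extension_matrix N A A' P Q \<rho>1 \<rho>2 $$ (i, N + j) = P $$ (i, j)"
    "extension_matrix N A A' P Q \<rho>1 \<rho>2 $$ (N + i, j) = - ((\<mu> i - \<rho>1) * (\<mu> i - \<rho>2)) * Q $$ (i, j)"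
    "extension_matrix N A A' P Q \<rho>1 \<rho>2 $$ (N + i, N + j) = (if i = j then \<rho>1 + \<rho>2 - \<mu> i else 0)"
    using i A P Xc D Xij Dij dimA' unfolding E by (simp_all add: index_mat_four_block(1))
qed

text \<open>v is padded by zeros in the deleted positions. There \<mu> = \<rho>2, so (\<mu> -
  \<rho>1)(\<mu> - \<rho>2) = 0 and the zero function satisfies its row. The truncated solution is
  thus one of the full system of size 2N, which can be treated with the square matrices P and
  Q.\<close>

lemma extended_system_components:
  assumes A: "A \<in> carrier_mat N N" and P: "P \<in> carrier_mat N N" and Q: "Q \<in> carrier_mat N N"
    and A': "A' = Matrix.mat N N (\<lambda>(x, y). if x = y then \<mu> x else 0)"
    and N0: "N0 \<le> N" "d = N + N0" "\<And>j. N0 \<le> j \<Longrightarrow> j < N \<Longrightarrow> \<mu> j = \<rho>2"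
    and F: "solves_okubo d (Matrix.mat d d (\<lambda>(x, y). if x = y then (if x < N then tb x else tp) else 0))
       (leading_block d (extension_matrix N A A' P Q \<rho>1 \<rho>2)) S F"
    and S: "open S" and sub: "\<And>z. z \<in> strip a b \<Longrightarrow> tp + exp (- z) \<in> S"
  defines "u \<equiv> \<lambda>i z. vec_index (F (tp + exp (- z))) i"
    and "v \<equiv> \<lambda>j z. if j < N0 then vec_index (F (tp + exp (- z))) (N + j) else 0"
  shows "\<And>i. i < N \<Longrightarrow> u i holomorphic_on strip a b" "\<And>j. v j holomorphic_on strip a b"
    "\<And>i z. i < N \<Longrightarrow> z \<in> strip a b \<Longrightarrow> - (1 - (tb i - tp) * exp z) * deriv (u i) z
       = (\<Sum>c<N. A $$ (i, c) * u c z) + (\<Sum>j<N. P $$ (i, j) * v j z)"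
    "\<And>j z. j < N \<Longrightarrow> z \<in> strip a b \<Longrightarrow> - deriv (v j) z
        = - ((\<mu> j - \<rho>1) * (\<mu> j - \<rho>2)) * (\<Sum>c<N. Q $$ (j, c) * u c z) + (\<rho>1 + \<rho>2 - \<mu> j) * v j z"
proof -
  let ?E = "extension_matrix N A A' P Q \<rho>1 \<rho>2"
  have Fh: "vec_holomorphic_on d F S" using F by (simp add: solves_okubo_def)
  have sub': "tp + exp ((- 1) * z) \<in> S" if "z \<in> strip a b" for z using sub[OF that] by simp
  have hol: "(\<lambda>z. vec_index (F (tp + exp (- z))) i) holomorphic_on strip a b" if "i < d" for i
    using exp_pullback_holomorphic[OF Fh S strip_open sub' that] by simp
  show u: "u i holomorphic_on strip a b" if "i < N" for i unfolding u_def by (rule hol) (use that N0 in simp)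
  show "v j holomorphic_on strip a b" for j
    unfolding v_def using hol[of "N + j"] N0 by (cases "j < N0") auto
  have B: "leading_block d ?E \<in> carrier_mat d d" by (simp add: leading_block_def)
  have lb: "leading_block d ?E $$ (i, j) = ?E $$ (i, j)" if "i < d" "j < d" for i j using that by (simp add: leading_block_def)
  have der: "deriv (\<lambda>z. vec_index (F (tp + exp (- z))) i) z = - (exp (- z) * deriv (\<lambda>y. vec_index (F y) i) (tp + exp (- z)))"
    if "i < d" "z \<in> strip a b" for i z
    using DERIV_imp_deriv[OF exp_pullback[OF Fh S sub' that]] by simp
  have vsum: "(\<Sum>j<N0. f j * vec_index (F (tp + exp (- z))) (N + j)) = (\<Sum>j<N. f j * v j z)" for f z
  proof -
    have "(\<Sum>j<N0 + (N - N0). f j * v j z) = (\<Sum>j<N0. f j * v j z)"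
      unfolding sum_lessThan_add by (simp add: v_def)
    then show ?thesis using N0(1) by (simp add: v_def)
  qed
  show "- (1 - (tb i - tp) * exp z) * deriv (u i) z = (\<Sum>c<N. A $$ (i, c) * u c z) + (\<Sum>j<N. P $$ (i, j) * v j z)"
    if i: "i < N" and z: "z \<in> strip a b" for i z
  proof -
    have id: "i < d" using i N0 by simp
    define y where "y = deriv (\<lambda>y. vec_index (F y) i) (tp + exp (- z))"
    have "(tp + exp (- z) - tb i) * y = (\<Sum>c<d. leading_block d ?E $$ (i, c) * vec_index (F (tp + exp (- z))) c)"
      using solves_okubo_component[OF F B sub[OF z] id] i by (simp add: y_def)
    also have "\<dots> = (\<Sum>c<N + N0. ?E $$ (i, c) * vec_index (F (tp + exp (- z))) c)"
      by (rule sum.cong) (use id lb N0 in auto)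
    also have "\<dots> = (\<Sum>c<N. A $$ (i, c) * u c z) + (\<Sum>j<N0. P $$ (i, j) * vec_index (F (tp + exp (- z))) (N + j))"
      unfolding sum_lessThan_add
      by (intro arg_cong2[where f = "(+)"] sum.cong refl) (use extension_matrix_index[OF A P Q A' i] N0 in \<open>auto simp: u_def\<close>)
    finally have e: "(tp + exp (- z) - tb i) * y = (\<Sum>c<N. A $$ (i, c) * u c z) + (\<Sum>j<N. P $$ (i, j) * v j z)"
      by (simp only: vsum)
    have "- (1 - (tb i - tp) * exp z) * deriv (u i) z = (1 - (tb i - tp) * exp z) * exp (- z) * y"
      unfolding u_def der[OF id z] y_def by (simp only: minus_mult_minus mult.assoc)
    also have "(1 - (tb i - tp) * exp z) * exp (- z) = tp + exp (- z) - tb i"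
    proof -
      have "exp z * exp (- z) = 1" by (simp add: exp_minus)
      then show ?thesis by (simp add: left_diff_distrib mult.assoc)
    qed
    finally show ?thesis using e by simp
  qed
  show "- deriv (v j) z = - ((\<mu> j - \<rho>1) * (\<mu> j - \<rho>2)) * (\<Sum>c<N. Q $$ (j, c) * u c z) + (\<rho>1 + \<rho>2 - \<mu> j) * v j z"
    if j: "j < N" and z: "z \<in> strip a b" for j z
  proof (cases "j < N0")
    \<comment> \<open>A padded row: both sides are 0.\<close>
    case False
    then show ?thesis using N0(3)[of j] j by (simp add: v_def)
  next
    case True
    then have jd: "N + j < d" using N0 by simp
    define y where "y = deriv (\<lambda>y. vec_index (F y) (N + j)) (tp + exp (- z))"
    have "(tp + exp (- z) - tp) * y = (\<Sum>c<d. leading_block d ?E $$ (N + j, c) * vec_index (F (tp + exp (- z))) c)"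
      using solves_okubo_component[OF F B sub[OF z] jd] by (simp add: y_def)
    also have "\<dots> = (\<Sum>c<N + N0. ?E $$ (N + j, c) * vec_index (F (tp + exp (- z))) c)"
      by (rule sum.cong) (use jd lb N0 in auto)
    also have "\<dots> = (\<Sum>c<N. - ((\<mu> j - \<rho>1) * (\<mu> j - \<rho>2)) * (Q $$ (j, c) * u c z))
        + (\<Sum>c<N0. (if j = c then \<rho>1 + \<rho>2 - \<mu> j else 0) * vec_index (F (tp + exp (- z))) (N + c))"
      unfolding sum_lessThan_add
      by (intro arg_cong2[where f = "(+)"] sum.cong refl) (use extension_matrix_index[OF A P Q A' j] N0 in \<open>auto simp: u_def\<close>)
    also have "(\<Sum>c<N0. (if j = c then \<rho>1 + \<rho>2 - \<mu> j else 0) * vec_index (F (tp + exp (- z))) (N + c))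
        = (\<Sum>c<N0. if c = j then (\<rho>1 + \<rho>2 - \<mu> j) * v j z else 0)"
      by (rule sum.cong) (use True in \<open>auto simp: v_def\<close>)
    also have "\<dots> = (\<rho>1 + \<rho>2 - \<mu> j) * v j z" using True by simp
    finally have e: "exp (- z) * y = - ((\<mu> j - \<rho>1) * (\<mu> j - \<rho>2)) * (\<Sum>c<N. Q $$ (j, c) * u c z) + (\<rho>1 + \<rho>2 - \<mu> j) * v j z"
      by (simp add: sum_distrib_left)
    have "- deriv (v j) z = exp (- z) * y" using der[OF jd z] True by (simp add: v_def y_def)
    then show ?thesis using e by simp
  qed
qed

lemma exp_image_open:
  assumes "s \<noteq> 0" shows "open ((\<lambda>z. c + exp (s * z)) ` strip a b)"
proof (rule open_mapping_thm[of _ UNIV])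
  show "\<not> (\<lambda>z. c + exp (s * z)) constant_on UNIV"
  proof
    assume "(\<lambda>z. c + exp (s * z)) constant_on UNIV"
    then obtain v where "\<And>z. c + exp (s * z) = v" by (auto simp: constant_on_def)
    then have "c + exp (s * 0) = c + exp (s * (\<i> * of_real pi / s))" by metis
    then show False using assms by (simp add: exp_pi_i')
  qed
qed (auto intro!: holomorphic_intros strip_open)

lemma solves_okubo_subset: "solves_okubo d T B S F \<Longrightarrow> S' \<subseteq> S \<Longrightarrow> solves_okubo d T B S' F"
  unfolding solves_okubo_def vec_holomorphic_on_def by (meson holomorphic_on_subset subsetD)

lemma strip_union:
  assumes "a \<le> - M1" "- M2 \<le> b" "M2 < M1"
  shows "strip (- M1) b \<union> strip a (- M2) = strip a b"
  using assms by (auto simp: strip_def)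

lemma sum_block_bound:
  fixes k r :: nat
  assumes "1 \<le> k" "k \<le> r" "1 \<le> h" "h \<le> s k"
  shows "(\<Sum>u\<in>{1..<k}. s u) + h - 1 < (\<Sum>u\<in>{1..r}. s u :: nat)"
proof -
  have "(\<Sum>u\<in>{1..<k}. s u) + s k \<le> (\<Sum>u\<in>{1..r}. s u)"
    unfolding sum_block_Suc[OF assms(1), symmetric] by (rule sum_mono2) (use assms in auto)
  then show ?thesis using assms by linarith
qed

section \<open>Two neighbouring points as the edges of one strip\<close>

theorem theorem7p11:
  fixes p q N d :: nat
    and r n m :: "nat \<Rightarrow> nat"
    and l :: "nat \<Rightarrow> nat \<Rightarrow> nat"
    and t t' \<mu> :: "nat \<Rightarrow> complex"
    and lam :: "nat \<Rightarrow> nat \<Rightarrow> complex"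
    and \<rho>1 \<rho>2 \<eta>0 :: complex
    and \<theta> \<theta>' :: "nat \<Rightarrow> real"
    and T T' TT A A' P Pinv AP AP' :: cmat
    and w :: "nat \<Rightarrow> nat \<Rightarrow> nat \<Rightarrow> complex \<Rightarrow> cvec"
    and c C' :: "nat \<Rightarrow> nat \<Rightarrow> nat \<Rightarrow> nat \<Rightarrow> nat \<Rightarrow> nat \<Rightarrow> complex"
  assumes sizes: "1 \<le> p" "1 \<le> q"
      "\<And>i. i \<in> {1..p} \<Longrightarrow> 1 \<le> r i"
      "\<And>i k. i \<in> {1..p} \<Longrightarrow> k \<in> {1..r i} \<Longrightarrow> 1 \<le> l i k"
      "\<And>k. k \<in> {1..q} \<Longrightarrow> 1 \<le> m k"
      "\<And>i. i \<in> {1..p} \<Longrightarrow> n i = (\<Sum>k=1..r i. l i k)"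
      "N = (\<Sum>i=1..p. n i)" "N = (\<Sum>k=1..q. m k)" "d = 2 * N - m q"
    and points: "inj_on t {1..p + 1}"
      "\<And>i j k. i \<in> {1..p + 1} \<Longrightarrow> j \<in> {1..p + 1} \<Longrightarrow> k \<in> {1..p + 1} \<Longrightarrow>
         i \<noteq> j \<Longrightarrow> j \<noteq> k \<Longrightarrow> i \<noteq> k \<Longrightarrow> \<not> collinear {t i, t j, t k}"
    and T: "T = scalar_blocks p n t"
    and A: "A \<in> carrier_mat N N"
      "\<And>i. i \<in> {1..p} \<Longrightarrow> matrix_block n A i i = scalar_blocks (r i) (l i) (lam i)"
      "\<And>i. i \<in> {1..p} \<Longrightarrow> inj_on (lam i) {1..r i}"
    and P: "P \<in> carrier_mat N N" "Pinv \<in> carrier_mat N N"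
      "inverts_mat P Pinv" "inverts_mat Pinv P"
    and A': "A' = Pinv * A * P" "A' = scalar_blocks q m \<mu>" "inj_on \<mu> {1..q}"
    and \<rho>2: "\<rho>2 = \<mu> q"
    and extended: "AP = extension_matrix N A A' P Pinv \<rho>1 \<rho>2"
      "AP' = leading_block d AP"
      "TT = diag_block_mat [T, t (p + 1) \<cdot>\<^sub>m 1\<^sub>m (N - m q)]"
    and nonint:
      "\<And>i k. i \<in> {1..p} \<Longrightarrow> k \<in> {1..r i} \<Longrightarrow> lam i k \<notin> \<int>"
      "\<And>i k h. i \<in> {1..p} \<Longrightarrow> k \<in> {1..r i} \<Longrightarrow> h \<in> {1..r i} \<Longrightarrow> k \<noteq> h \<Longrightarrow> lam i k - lam i h \<notin> \<int>"
      "\<And>k. k \<in> {1..q} \<Longrightarrow> \<mu> k \<notin> \<int>"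
      "\<And>k h. k \<in> {1..q} \<Longrightarrow> h \<in> {1..q} \<Longrightarrow> k \<noteq> h \<Longrightarrow> \<mu> k - \<mu> h \<notin> \<int>"
      "\<And>i k h. i \<in> {1..p} \<Longrightarrow> k \<in> {1..r i} \<Longrightarrow> h \<in> {1..q} \<Longrightarrow> lam i k - \<mu> h \<notin> \<int>"
      "\<rho>1 \<notin> \<int>"
      "\<And>i k. i \<in> {1..p} \<Longrightarrow> k \<in> {1..r i} \<Longrightarrow> \<rho>1 - lam i k \<notin> \<int>"
      "\<And>k. k \<in> {1..q} \<Longrightarrow> \<rho>1 - \<mu> k \<notin> \<int>"
    and args:
      "\<And>i. i \<in> {1..p} \<Longrightarrow> t i - t (p + 1) = of_real (cmod (t i - t (p + 1))) * cis (\<theta> i)"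
      "strict_mono_on {1..p} \<theta>"
      "\<theta> p < \<theta> 1 + 2 * pi"
      "\<theta> p < \<theta> (p + 1)" "\<theta> (p + 1) < \<theta> 1 + 2 * pi" "\<theta> 0 = \<theta> (p + 1) - 2 * pi"
    and underlying:
      "\<And>i. i \<in> {1..p} \<Longrightarrow> t' i = \<eta>0 + 1 / (t i - t (p + 1))"
      "\<And>i. i \<in> {1..p} \<Longrightarrow> \<theta>' i = - \<theta> i"
      "T' = scalar_blocks p n t'"
    and w: "\<And>i k h. i \<in> {1..p} \<Longrightarrow> k \<in> {1..r i} \<Longrightarrow> h \<in> {1..l i k} \<Longrightarrow>
         local_solution N T' (0 \<cdot>\<^sub>m 1\<^sub>m N + A) (t' i) (lam i k) (block_unit_vec N n l i k h)
           (\<theta>' i - pi) (cut_plane p t' \<eta>0) (cut_plane p t' \<eta>0) (w i k h)"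
    and c: "\<And>\<nu> i k h. i \<in> {1..p} \<Longrightarrow> \<nu> \<in> {1..p} \<Longrightarrow> \<nu> \<noteq> i \<Longrightarrow> k \<in> {1..r i} \<Longrightarrow> h \<in> {1..l i k} \<Longrightarrow>
         connection_relation N (cut_plane p t' \<eta>0) (t' \<nu>) (r \<nu>) (l \<nu>)
           (\<lambda>k' h'. c \<nu> k' h' i k h) (w i k h) (w \<nu>)"
    and C': "\<And>\<nu> k' h' i k h. C' \<nu> k' h' i k h =
         (exp (pi * \<i> * lam i k)
            * branch_powr (\<theta> i) (t i - t (p + 1)) (2 * lam i k - \<rho>1 - \<mu> q))
         / (exp (pi * \<i> * lam \<nu> k')
            * branch_powr (\<theta> \<nu>) (t \<nu> - t (p + 1)) (2 * lam \<nu> k' - \<rho>1 - \<mu> q))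
         * c \<nu> k' h' i k h"
  shows "\<forall>\<^sub>F \<delta> in at_right 0.
      (\<forall>i k h. 1 \<le> i \<and> i \<le> p - 1 \<and> k \<in> {1..r i} \<and> h \<in> {1..l i k} \<longrightarrow>
        (let S = sector_plus p t \<theta> \<delta> i \<union> sector_minus p t \<theta> \<delta> (i + 1) in
          \<forall>U V. local_solution d TT AP' (t i) (lam i k) (block_unit_vec d n l i k h)
                  (\<theta> i) (sector_plus p t \<theta> \<delta> i) S U \<and>
                (\<forall>k'\<in>{1..r (i + 1)}. \<forall>h'\<in>{1..l (i + 1) k'}.
                  local_solution d TT AP' (t (i + 1)) (lam (i + 1) k') (block_unit_vec d n l (i + 1) k' h')
                    (\<theta> (i + 1)) (sector_minus p t \<theta> \<delta> (i + 1)) S (V k' h')) \<longrightarrow>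
             connection_relation d S (t (i + 1)) (r (i + 1)) (l (i + 1))
               (\<lambda>k' h'. C' (i + 1) k' h' i k h) U V)) \<and>
      (\<forall>i k h. 2 \<le> i \<and> i \<le> p \<and> k \<in> {1..r i} \<and> h \<in> {1..l i k} \<longrightarrow>
        (let S = sector_minus p t \<theta> \<delta> i \<union> sector_plus p t \<theta> \<delta> (i - 1) in
          \<forall>U V. local_solution d TT AP' (t i) (lam i k) (block_unit_vec d n l i k h)
                  (\<theta> i) (sector_minus p t \<theta> \<delta> i) S U \<and>
                (\<forall>k'\<in>{1..r (i - 1)}. \<forall>h'\<in>{1..l (i - 1) k'}.
                  local_solution d TT AP' (t (i - 1)) (lam (i - 1) k') (block_unit_vec d n l (i - 1) k' h')
                    (\<theta> (i - 1)) (sector_plus p t \<theta> \<delta> (i - 1)) S (V k' h')) \<longrightarrow>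
             connection_relation d S (t (i - 1)) (r (i - 1)) (l (i - 1))
               (\<lambda>k' h'. C' (i - 1) k' h' i k h) U V))"
proof -
  define tp where "tp = t (p + 1)"
  define tb where "tb = (\<lambda>b. t (block_of n b))"
  define \<tau> where "\<tau> = (\<lambda>b. tb b - tp)"
  define N0 where "N0 = N - m q"
  define mu where "mu = (\<lambda>j. \<mu> (block_of m j))"
  \<comment> \<open>The logarithm of 1 / (t_i - t_{p+1}) with argument -\<theta>_i. It is the common
    position in the z-plane of t_i and of t'_i.\<close>
  define pt where "pt = (\<lambda>i. Complex (- ln (cmod (t i - tp))) (- \<theta> i))"
  define cut where "cut = cut_plane p t' \<eta>0"
  define M where "M = (\<lambda>i j. A $$ (i, j))"
  define PP where "PP = (\<lambda>i j. P $$ (i, j))"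
  define Q where "Q = (\<lambda>i j. Pinv $$ (i, j))"
  have q1: "q \<in> {1..q}" using sizes(2) by simp
  have mqN: "m q \<le> N" unfolding sizes(8) by (rule member_le_sum[OF q1]) auto
  have d: "d = N + N0" using mqN by (simp add: N0_def sizes(9))
  have tne: "t i - tp \<noteq> 0" if "i \<in> {1..p}" for i
    using inj_onD[OF points(1), of i "p + 1"] that by (auto simp: tp_def)
  have ept: "exp (- pt i) = t i - tp" if "i \<in> {1..p}" for i
  proof -
    have "exp (- pt i) = of_real (cmod (t i - tp)) * cis (\<theta> i)"
      using tne[OF that] by (simp add: exp_eq_polar pt_def)
    then show ?thesis using args(1)[OF that] by (simp add: tp_def)
  qed
  have ept1: "(t i - tp) * exp (pt i) = 1" if "i \<in> {1..p}" for i
    unfolding ept[OF that, symmetric] by (simp add: exp_minus)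
  have t'pt: "t' i = \<eta>0 + exp (pt i)" if "i \<in> {1..p}" for i
  proof -
    have "1 / (t i - tp) = exp (pt i)" using ept1[OF that] tne[OF that] by (simp add: field_simps)
    then show ?thesis using underlying(1)[OF that] by (simp add: tp_def)
  qed
  have tpt: "t i = tp + exp (- pt i)" if "i \<in> {1..p}" for i using ept[OF that] by simp
  have Impt: "Im (pt i) = - \<theta> i" for i by (simp add: pt_def)
  have blk: "block_of n b \<in> {1..p}" if "b < N" for b
    using block_ofE[of b n p] that unfolding sizes(7) by metis
  have \<tau>nz: "\<tau> b \<noteq> 0" if "b < N" for b using tne[OF blk[OF that]] by (simp add: \<tau>_def tb_def)
  \<comment> \<open>By distinctness of the points, the rows singular at \<open>pt i\<close> are
    exactly those of the i-th block.\<close>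
  have \<tau>1: "\<tau> b * exp (pt i) = 1 \<longleftrightarrow> block_of n b = i" if b: "b < N" and i: "i \<in> {1..p}" for b i
  proof
    assume "\<tau> b * exp (pt i) = 1"
    then have "\<tau> b * exp (pt i) = (t i - tp) * exp (pt i)" using ept1[OF i] by simp
    then have "t (block_of n b) = t i" by (simp add: \<tau>_def tb_def)
    then show "block_of n b = i" using inj_onD[OF points(1), of "block_of n b" i] blk[OF b] i by auto
  next
    assume "block_of n b = i"
    then show "\<tau> b * exp (pt i) = 1" using ept1[OF i] by (simp add: \<tau>_def tb_def)
  qed
  have Tm: "T = Matrix.mat N N (\<lambda>(x, y). if x = y then tb x else 0)"
    unfolding T sizes(7) scalar_blocks_mat tb_def ..
  have T'm: "T' = Matrix.mat N N (\<lambda>(x, y). if x = y then t' (block_of n x) else 0)"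
    unfolding underlying(3) sizes(7) scalar_blocks_mat ..
  have TTm: "TT = Matrix.mat d d (\<lambda>(x, y). if x = y then (if x < N then tb x else tp) else 0)"
    unfolding extended(3) Tm d N0_def[symmetric] tp_def[symmetric]
    by (rule eq_matI) (auto simp: Let_def index_mat_four_block)
  have Bm: "0 \<cdot>\<^sub>m 1\<^sub>m N + A = A" using A(1) by (intro eq_matI) auto
  have A'm: "A' = Matrix.mat N N (\<lambda>(x, y). if x = y then mu x else 0)"
    unfolding A'(2) sizes(8) scalar_blocks_mat mu_def ..
  have blkm: "block_of m j \<in> {1..q}" if "j < N" for j
    using block_ofE[of j m q] that unfolding sizes(8) by metis
  have mu0: "mu j = \<rho>2" if "N0 \<le> j" "j < N" for j
  proof -
    have "N = (\<Sum>u\<in>{1..<q}. m u) + m q" unfolding sizes(8) by (rule sum_block_Suc[OF sizes(2)])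
    then have "block_of m j = q"
      using that by (intro block_of_eqI[OF sizes(2), of "j - (\<Sum>u\<in>{1..<q}. m u)"]) (auto simp: N0_def)
    then show ?thesis by (simp add: mu_def \<rho>2)
  qed
  have A'c: "A' \<in> carrier_mat N N" by (simp add: A'm)
  have PI: "P * Pinv = 1\<^sub>m N" "Pinv * P = 1\<^sub>m N"
    using P by (auto simp: inverts_mat_def)
  have AP_PA': "A * P = P * A'"
  proof -
    have "P * A' = P * (Pinv * (A * P))"
      unfolding A'(1) by (subst assoc_mult_mat[OF P(2) A(1) P(1)]) simp
    also have "\<dots> = (P * Pinv) * (A * P)"
      by (rule assoc_mult_mat[symmetric, OF P(1,2)]) (use A(1) P(1) in auto)
    also have "\<dots> = A * P" unfolding PI using A(1) P(1) by (intro left_mult_one_mat) auto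
    finally show ?thesis ..
  qed
  have QA: "Pinv * A = A' * Pinv"
  proof -
    have "A' * Pinv = (Pinv * A) * (P * Pinv)"
      unfolding A'(1) by (rule assoc_mult_mat) (use A(1) P in auto)
    also have "\<dots> = Pinv * A" unfolding PI using A(1) P(2) by (intro right_mult_one_mat) auto
    finally show ?thesis ..
  qed
  have MP: "(\<Sum>c<N. M i c * PP c j) = PP i j * mu j" if ij: "i < N" "j < N" for i j
  proof -
    have "(\<Sum>c<N. M i c * PP c j) = (P * A') $$ (i, j)"
      unfolding AP_PA'[symmetric] M_def PP_def by (rule mult_mat_index[OF A(1) P(1) ij, symmetric])
    also have "\<dots> = (\<Sum>c<N. PP i c * A' $$ (c, j))" unfolding PP_def by (rule mult_mat_index[OF P(1) A'c ij])
    also have "\<dots> = (\<Sum>c<N. if c = j then PP i j * mu j else 0)"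
      by (rule sum.cong) (use ij in \<open>auto simp: A'm\<close>)
    finally show ?thesis using ij by simp
  qed
  have QM: "(\<Sum>i<N. Q j i * M i c) = mu j * Q j c" if jc: "j < N" "c < N" for j c
  proof -
    have "(\<Sum>i<N. Q j i * M i c) = (A' * Pinv) $$ (j, c)"
      unfolding QA[symmetric] M_def Q_def by (rule mult_mat_index[OF P(2) A(1) jc, symmetric])
    then show ?thesis unfolding A'm diagonal_mult_index[OF P(2) jc] Q_def by simp
  qed
  have PQ: "(\<Sum>j<N. PP i j * (\<Sum>c<N. Q j c * x c)) = x i" if "i < N" for i and x :: "nat \<Rightarrow> complex"
  proof (rule inverse_sums[OF _ that])
    fix i c assume ic: "i < N" "c < N"
    show "(\<Sum>j<N. PP i j * Q j c) = (if i = c then 1 else 0)"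
      using mult_mat_index[OF P(1,2) ic] ic unfolding PI(1) PP_def Q_def by simp
  qed
  have QP: "(\<Sum>j<N. Q i j * (\<Sum>c<N. PP j c * x c)) = x i" if "i < N" for i and x :: "nat \<Rightarrow> complex"
  proof (rule inverse_sums[OF _ that])
    fix i c assume ic: "i < N" "c < N"
    show "(\<Sum>j<N. Q i j * PP j c) = (if i = c then 1 else 0)"
      using mult_mat_index[OF P(2,1) ic] ic unfolding PI(2) PP_def Q_def by simp
  qed
  \<comment> \<open>No \<mu>_k is an integer, so A + s is invertible for every positive integer s
    and all raising steps are available.\<close>
  define R where "R = (\<lambda>mm i c. \<Sum>j<N. PP i j * (Q j c / (mu j + of_nat (Suc mm))))"
  have R: "shifted_inverse N M (of_nat (Suc mm)) (R mm)" for mm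
    unfolding R_def
  proof (rule shifted_inverse_diagonalized[OF PQ MP QM])
    fix j assume j: "j < N"
    show "mu j + of_nat (Suc mm) \<noteq> 0"
    proof
      assume "mu j + of_nat (Suc mm) = 0"
      then have "mu j = of_int (- int (Suc mm))" by (simp add: eq_neg_iff_add_eq_0 del: of_nat_Suc)
      then show False using nonint(3)[OF blkm[OF j]] unfolding mu_def by (metis Ints_of_int)
    qed
  qed
  have diag: "M b b' = (if b = b' then lam i (block_of (l i) (b - (\<Sum>u\<in>{1..<i}. n u))) else 0)
       \<and> block_of (l i) (b - (\<Sum>u\<in>{1..<i}. n u)) \<in> {1..r i}"
    if b: "b < N" "b' < N" and bi: "block_of n b = i" "block_of n b' = i" for b b' i
  proof -
    have i: "i \<in> {1..p}" using blk[OF b(1)] bi by simp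
    let ?o = "\<Sum>u\<in>{1..<i}. n u"
    obtain a where a: "a < n i" "b = ?o + a" using block_ofE[of b n p] b(1) bi(1) unfolding sizes(7) by metis
    obtain a' where a': "a' < n i" "b' = ?o + a'" using block_ofE[of b' n p] b(2) bi(2) unfolding sizes(7) by metis
    have "matrix_block n A i i $$ (a, a') = M b b'" using a a' by (simp add: matrix_block_def M_def)
    moreover have "matrix_block n A i i $$ (a, a') = (if a = a' then lam i (block_of (l i) a) else 0)"
      unfolding A(2)[OF i] scalar_blocks_mat sizes(6)[OF i, symmetric] using a a' by simp
    ultimately have "M b b' = (if a = a' then lam i (block_of (l i) a) else 0)" by (simp only:)
    moreover have "block_of (l i) a \<in> {1..r i}"
      using block_ofE[of a "l i" "r i"] a(1) unfolding sizes(6)[OF i] by metis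
    moreover have "b - ?o = a" "(b = b') = (a = a')" using a a' by auto
    ultimately show ?thesis by (simp only:)
  qed
  \<comment> \<open>In the first N entries the leading vectors of the two systems coincide, so the
    local solutions have proportional leading coefficients; these are supported in the i-th
    block.\<close>
  have buv: "vec_index (block_unit_vec N n l i k h) b = vec_index (block_unit_vec d n l i k h) b"
    "vec_index (block_unit_vec N n l i k h) b \<noteq> 0 \<Longrightarrow> block_of n b = i"
    if i: "i \<in> {1..p}" "k \<in> {1..r i}" "h \<in> {1..l i k}" and b: "b < N" for i k h b
  proof -
    let ?pos = "(\<Sum>u\<in>{1..<i}. n u) + (\<Sum>u\<in>{1..<k}. l i u) + h - 1"
    have in_block: "(\<Sum>u\<in>{1..<k}. l i u) + h - 1 < n i"
      unfolding sizes(6)[OF i(1)] by (rule sum_block_bound) (use i in auto)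
    have pos: "?pos = (\<Sum>u\<in>{1..<i}. n u) + ((\<Sum>u\<in>{1..<k}. l i u) + h - 1)" using i(3) by simp
    have bo: "block_of n ?pos = i"
      by (rule block_of_eqI[OF _ in_block pos]) (use i in simp)
    have "(\<Sum>u\<in>{1..<i}. n u) + n i \<le> N"
      unfolding sizes(7) sum_block_Suc[of i n, symmetric, OF iffD1[OF atLeastAtMost_iff i(1), THEN conjunct1]]
      by (rule sum_mono2) (use i in auto)
    then have "?pos < N" using in_block pos by linarith
    moreover have "N \<le> d" using d by simp
    ultimately have v: "vec_index (block_unit_vec N n l i k h) b = (if b = ?pos then 1 else 0)"
      "vec_index (block_unit_vec d n l i k h) b = (if b = ?pos then 1 else 0)"
      using b by (simp_all add: block_unit_vec_def)
    show "vec_index (block_unit_vec N n l i k h) b = vec_index (block_unit_vec d n l i k h) b" by (simp only: v)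
    show "block_of n b = i" if "vec_index (block_unit_vec N n l i k h) b \<noteq> 0"
      using that bo unfolding v by (auto split: if_splits)
  qed
  \<comment> \<open>Symmetric in the two points, so that it covers both directions of connection.
    \<open>aw E\<close> is the logarithm at \<open>pt E\<close> of the quotient of \<zeta> - t'_E by
    z - \<open>pt E\<close>; the one belonging to x - t_E is assumed to exceed it by \<pi>i - 2
    \<open>pt E\<close> at either point. Only this difference enters the constant.\<close>
  have pair: "connection_relation d S (t \<nu>) (r \<nu>) (l \<nu>) (\<lambda>k' h'. C' \<nu> k' h' i k h) U V"
    if i\<nu>: "i \<in> {1..p}" "\<nu> \<in> {1..p}" "\<nu> \<noteq> i" and k: "k \<in> {1..r i}" and h: "h \<in> {1..l i k}"
      and E: "edge_point x y (pt i)" "edge_point x y (pt \<nu>)"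
      and S: "S = (\<lambda>z. tp + exp (- z)) ` strip x y"
      and cut_sub: "\<And>z. z \<in> strip x y \<Longrightarrow> \<eta>0 + exp z \<in> cut"
      and bw: "\<And>E e v F b. E \<in> {i, \<nu>} \<Longrightarrow> local_solution N T' (0 \<cdot>\<^sub>m 1\<^sub>m N + A) (t' E) e v (\<theta>' E - pi) cut cut F \<Longrightarrow> b < N \<Longrightarrow>
         branch_at (pt E) (strip x y) e (\<lambda>z. vec_index (F (\<eta>0 + exp z)) b) (exp (e * aw E) * vec_index v b)"
      and U: "solves_okubo d TT AP' S U"
        "\<And>b. b < d \<Longrightarrow> branch_at (pt i) (strip x y) (lam i k) (\<lambda>z. vec_index (U (tp + exp (- z))) b)
          (exp (lam i k * (\<i> * of_real pi - 2 * pt i + aw i)) * vec_index (block_unit_vec d n l i k h) b)"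
      and V: "\<And>k' h'. k' \<in> {1..r \<nu>} \<Longrightarrow> h' \<in> {1..l \<nu> k'} \<Longrightarrow> solves_okubo d TT AP' S (V k' h')"
        "\<And>k' h' b. k' \<in> {1..r \<nu>} \<Longrightarrow> h' \<in> {1..l \<nu> k'} \<Longrightarrow> b < d \<Longrightarrow>
          branch_at (pt \<nu>) (strip x y) (lam \<nu> k') (\<lambda>z. vec_index (V k' h' (tp + exp (- z))) b)
          (exp (lam \<nu> k' * (\<i> * of_real pi - 2 * pt \<nu> + aw \<nu>)) * vec_index (block_unit_vec d n l \<nu> k' h') b)"
    for i \<nu> k h x y S U V aw
  proof -
    let ?St = "strip x y"
    define K where "K = (SIGMA k':{1..r \<nu>}. {1..l \<nu> k'})"
    have K: "finite K" by (simp add: K_def)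
    have Kq: "fst q \<in> {1..r \<nu>}" "snd q \<in> {1..l \<nu> (fst q)}" if "q \<in> K" for q using that by (auto simp: K_def)
    have sumK: "(\<Sum>k'=1..r \<nu>. \<Sum>h'=1..l \<nu> k'. f k' h') = (\<Sum>q\<in>K. f (fst q) (snd q))" for f :: "nat \<Rightarrow> nat \<Rightarrow> complex"
      unfolding K_def by (subst sum.Sigma) (auto simp: case_prod_beta)
    have Sopen: "open S" using exp_image_open[of "- 1" tp x y] by (simp add: S)
    have Ssub: "tp + exp (- z) \<in> S" if "z \<in> ?St" for z using that by (simp add: S)
    let ?S' = "(\<lambda>z. \<eta>0 + exp (1 * z)) ` ?St"
    have S'open: "open ?S'" by (rule exp_image_open) simp
    have S'sub: "\<eta>0 + exp z \<in> ?S'" if "z \<in> ?St" for z using that by simp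
    have S'cut: "?S' \<subseteq> cut" using cut_sub by auto
    have \<tau>t': "\<tau> b * (t' (block_of n b) - \<eta>0) = 1" if "b < N" for b
      using ept1[OF blk[OF that]] t'pt[OF blk[OF that]] by (simp add: \<tau>_def tb_def)
    have wlev: "okubo_level N M \<tau> 0 ?St (\<lambda>b z. vec_index (w E kk hh (\<eta>0 + exp z)) b)"
      if "E \<in> {1..p}" "kk \<in> {1..r E}" "hh \<in> {1..l E kk}" for E kk hh
    proof -
      have "solves_okubo N T' A cut (w E kk hh)"
        using w[OF that] unfolding local_solution_def Bm cut_def by blast
      from solves_okubo_subset[OF this S'cut, unfolded T'm]
      show ?thesis unfolding M_def by (rule okubo_level_pullback[OF _ A(1) S'open S'sub \<tau>t'])
    qed
    have comps: "extension_equation N M \<tau> \<rho>1 \<rho>2 ?St (\<lambda>b z. vec_index (F (tp + exp (- z))) b)"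
      "\<And>b. b < N \<Longrightarrow> (\<lambda>z. vec_index (F (tp + exp (- z))) b) holomorphic_on ?St"
      "\<And>j z. j < N0 \<Longrightarrow> z \<in> ?St \<Longrightarrow> vec_index (F (tp + exp (- z))) (N + j) = (\<Sum>b<N. Q j b *
         (- (1 - \<tau> b * exp z) * deriv (\<lambda>z. vec_index (F (tp + exp (- z))) b) z - (\<Sum>c<N. M b c * vec_index (F (tp + exp (- z))) c)))"
      if F: "solves_okubo d TT AP' S F" for F
    proof -
      have N0N: "N0 \<le> N" by (simp add: N0_def)
      define u where "u = (\<lambda>i z. vec_index (F (tp + exp (- z))) i)"
      define v where "v = (\<lambda>j z. if j < N0 then vec_index (F (tp + exp (- z))) (N + j) else 0)"
      note F' = F[unfolded TTm extended(1,2)]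
      have ex1: "u i holomorphic_on ?St" if "i < N" for i
        unfolding u_def by (rule extended_system_components(1)[OF A(1) P(1,2) A'm N0N d _ F' Sopen]) (auto intro: mu0 Ssub that)
      have ex2: "v i holomorphic_on ?St" for i
        unfolding v_def by (rule extended_system_components(2)[OF A(1) P(1,2) A'm N0N d _ F' Sopen]) (auto intro: mu0 Ssub)
      have ex3: "- (1 - \<tau> i * exp z) * deriv (u i) z = (\<Sum>c<N. M i c * u c z) + (\<Sum>j<N. PP i j * v j z)"
        if "i < N" "z \<in> ?St" for i z
        unfolding u_def v_def \<tau>_def M_def PP_def
        by (rule extended_system_components(3)[OF A(1) P(1,2) A'm N0N d _ F' Sopen _ that]) (auto intro: mu0 Ssub)
      have ex4: "- deriv (v i) z = - ((mu i - \<rho>1) * (mu i - \<rho>2)) * (\<Sum>c<N. Q i c * u c z) + (\<rho>1 + \<rho>2 - mu i) * v i z"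
        if "i < N" "z \<in> ?St" for i z
        unfolding u_def v_def Q_def
        by (rule extended_system_components(4)[OF A(1) P(1,2) A'm N0N d _ F' Sopen _ that]) (auto intro: mu0 Ssub)
      show hol: "(\<lambda>z. vec_index (F (tp + exp (- z))) b) holomorphic_on ?St" if "b < N" for b
        using ex1[OF that] by (simp only: u_def)
      show "extension_equation N M \<tau> \<rho>1 \<rho>2 ?St (\<lambda>b z. vec_index (F (tp + exp (- z))) b)"
        using extension_equation_of_system[OF strip_open ex1 ex2 ex3 ex4 MP PQ] by (simp only: u_def)
      fix j z assume j: "j < N0" and z: "z \<in> ?St"
      have jN: "j < N" using j N0N by simp
      define vv where "vv = (\<lambda>j. if j < N0 then vec_index (F (tp + exp (- z))) (N + j) else 0)"
      have "vv j = (\<Sum>b<N. Q j b * (\<Sum>c<N. PP b c * vv c))" by (rule QP[OF jN, symmetric])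
      also have "\<dots> = (\<Sum>b<N. Q j b * (- (1 - \<tau> b * exp z) * deriv (\<lambda>z. vec_index (F (tp + exp (- z))) b) z
          - (\<Sum>c<N. M b c * vec_index (F (tp + exp (- z))) c)))"
        by (rule sum.cong[OF refl]) (use ex3[OF _ z] in \<open>simp add: vv_def u_def v_def\<close>)
      finally show "vec_index (F (tp + exp (- z))) (N + j) = (\<Sum>b<N. Q j b *
         (- (1 - \<tau> b * exp z) * deriv (\<lambda>z. vec_index (F (tp + exp (- z))) b) z - (\<Sum>c<N. M b c * vec_index (F (tp + exp (- z))) c)))"
        using j by (simp add: vv_def)
    qed
    define g where "g = (\<lambda>E e. exp (e * (\<i> * of_real pi - 2 * pt E)))"
    have gsplit: "exp (e * (\<i> * of_real pi - 2 * pt E + aw E)) = g E e * exp (e * aw E)" for E e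
      by (simp add: g_def exp_add[symmetric] algebra_simps)
    have diag0: "M b b' = 0" if "b < N" "b' < N" "\<tau> b * exp (pt E) = 1" "\<tau> b' * exp (pt E) = 1" "b \<noteq> b'" "E \<in> {1..p}" for b b' E
      using diag[OF that(1,2)] \<tau>1[OF that(1,6)] \<tau>1[OF that(2,6)] that by auto
    \<comment> \<open>The diagonal entries of M in block E are exponents \<open>lam E kb\<close>.
      For kb = kk the shift mm \<ge> 1 excludes equality, otherwise two exponents of the block would
      differ by an integer.\<close>
    have nonres: "lam E kk + of_nat mm \<noteq> M b b" if b: "b < N" "\<tau> b * exp (pt E) = 1" "mm \<ge> 1" and E: "E \<in> {1..p}" "kk \<in> {1..r E}" for b E kk mm
    proof
      assume eq: "lam E kk + of_nat mm = M b b"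
      have "block_of n b = E" using \<tau>1[OF b(1) E(1)] b(2) by simp
      then obtain kb where kb: "M b b = lam E kb" "kb \<in> {1..r E}" using diag[OF b(1,1)] by auto
      show False
      proof (cases "kb = kk")
        case True
        then show False using eq kb(1) b(3) by simp
      next
        case False
        have "lam E kb - lam E kk = of_int (int mm)" using eq kb(1) by (simp add: algebra_simps)
        then show False using nonint(2)[OF E(1) kb(2) E(2) False] by (metis Ints_of_int)
      qed
    qed
    \<comment> \<open>The coefficients in the shape delivered by \<open>strip_connection\<close>;
      \<open>Cq\<close> identifies them with C'.\<close>
    define CC where "CC = (\<lambda>q. g i (lam i k) * exp ((\<rho>1 + \<rho>2) * pt i) / (g \<nu> (lam \<nu> (fst q)) * exp ((\<rho>1 + \<rho>2) * pt \<nu>)) * c \<nu> (fst q) (snd q) i k h)"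
    have regN: "\<exists>L1. branch_at (pt \<nu>) ?St 0 (\<lambda>z. vec_index (U (tp + exp (- z))) b
        - (\<Sum>q\<in>K. CC q * vec_index (V (fst q) (snd q) (tp + exp (- z))) b)) L1" if b: "b < N" for b
      unfolding CC_def
    proof (rule strip_connection[where L = "\<lambda>b. exp (lam i k * aw i) * vec_index (block_unit_vec N n l i k h) b"
           and L' = "\<lambda>q b. exp (lam \<nu> (fst q) * aw \<nu>) * vec_index (block_unit_vec N n l \<nu> (fst q) (snd q)) b"
           and w = "\<lambda>b z. vec_index (w i k h (\<eta>0 + exp z)) b"
           and w' = "\<lambda>q b z. vec_index (w \<nu> (fst q) (snd q) (\<eta>0 + exp z)) b"
           and e = "lam i k" and e' = "\<lambda>q. lam \<nu> (fst q)" and C = "\<lambda>q. c \<nu> (fst q) (snd q) i k h"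
           and u = "\<lambda>b z. vec_index (U (tp + exp (- z))) b"
           and u' = "\<lambda>q b z. vec_index (V (fst q) (snd q) (tp + exp (- z))) b"
           and M = M and \<tau> = \<tau> and N = N and R = R])
      show "edge_point x y (pt i)" "edge_point x y (pt \<nu>)" "finite K" "b < N" by (fact E K b)+
      show "shifted_inverse N M (of_nat (Suc mm)) (R mm)" for mm by (rule R)
      show "okubo_level N M \<tau> 0 ?St (\<lambda>b z. vec_index (w i k h (\<eta>0 + exp z)) b)" by (rule wlev[OF i\<nu>(1) k h])
      show "lam i k \<notin> \<int>" by (rule nonint(1)[OF i\<nu>(1) k])
      show "extension_equation N M \<tau> \<rho>1 \<rho>2 ?St (\<lambda>b z. vec_index (U (tp + exp (- z))) b)" by (rule comps(1)[OF U(1)])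
      show "M b b' = 0" if "b < N" "b' < N" "\<tau> b * exp (pt i) = 1" "\<tau> b' * exp (pt i) = 1" "b \<noteq> b'" for b b'
        by (rule diag0[OF that i\<nu>(1)])
      show "M b b' = 0" if "b < N" "b' < N" "\<tau> b * exp (pt \<nu>) = 1" "\<tau> b' * exp (pt \<nu>) = 1" "b \<noteq> b'" for b b'
        by (rule diag0[OF that i\<nu>(2)])
      show "lam i k + of_nat mm \<noteq> M b b" if "b < N" "\<tau> b * exp (pt i) = 1" "1 \<le> mm" for b mm
        by (rule nonres[OF that i\<nu>(1) k])
      show "lam \<nu> (fst q) + of_nat mm \<noteq> M b b" if "q \<in> K" "b < N" "\<tau> b * exp (pt \<nu>) = 1" "1 \<le> mm" for q b mm
        by (rule nonres[OF that(2-4) i\<nu>(2) Kq(1)[OF that(1)]])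
    next
      fix b assume b: "b < N"
      show "\<tau> b \<noteq> 0" by (rule \<tau>nz[OF b])
      show "branch_at (pt i) ?St (lam i k) (\<lambda>z. vec_index (w i k h (\<eta>0 + exp z)) b) (exp (lam i k * aw i) * vec_index (block_unit_vec N n l i k h) b)"
        by (rule bw[OF _ w[OF i\<nu>(1) k h, folded cut_def] b]) simp
      show "\<tau> b * exp (pt i) = 1" if "exp (lam i k * aw i) * vec_index (block_unit_vec N n l i k h) b \<noteq> 0"
        using buv(2)[OF i\<nu>(1) k h b] that \<tau>1[OF b i\<nu>(1)] by simp
      show "branch_at (pt i) ?St (lam i k) (\<lambda>z. vec_index (U (tp + exp (- z))) b) (g i (lam i k) * (exp (lam i k * aw i) * vec_index (block_unit_vec N n l i k h) b))"
        using U(2)[of b] b d unfolding gsplit buv(1)[OF i\<nu>(1) k h b] by (simp add: mult.assoc)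
      show "\<exists>L0. branch_at (pt \<nu>) ?St 0 (\<lambda>z. vec_index (w i k h (\<eta>0 + exp z)) b
          - (\<Sum>q\<in>K. c \<nu> (fst q) (snd q) i k h * vec_index (w \<nu> (fst q) (snd q) (\<eta>0 + exp z)) b)) L0"
        using connection_relation_pullback[OF c[OF i\<nu> k h, folded cut_def] b E(2) t'pt[OF i\<nu>(2)] cut_sub] unfolding sumK .
    next
      fix q assume q: "q \<in> K"
      note qq = Kq[OF q]
      show "okubo_level N M \<tau> 0 ?St (\<lambda>b z. vec_index (w \<nu> (fst q) (snd q) (\<eta>0 + exp z)) b)" by (rule wlev[OF i\<nu>(2) qq])
      show "lam \<nu> (fst q) \<notin> \<int>" by (rule nonint(1)[OF i\<nu>(2) qq(1)])
      show "extension_equation N M \<tau> \<rho>1 \<rho>2 ?St (\<lambda>b z. vec_index (V (fst q) (snd q) (tp + exp (- z))) b)" by (rule comps(1)[OF V(1)[OF qq]])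
      show "g \<nu> (lam \<nu> (fst q)) \<noteq> 0" by (simp add: g_def)
      fix b assume b: "b < N"
      show "branch_at (pt \<nu>) ?St (lam \<nu> (fst q)) (\<lambda>z. vec_index (w \<nu> (fst q) (snd q) (\<eta>0 + exp z)) b)
          (exp (lam \<nu> (fst q) * aw \<nu>) * vec_index (block_unit_vec N n l \<nu> (fst q) (snd q)) b)"
        by (rule bw[OF _ w[OF i\<nu>(2) qq, folded cut_def] b]) simp
      show "\<tau> b * exp (pt \<nu>) = 1" if "exp (lam \<nu> (fst q) * aw \<nu>) * vec_index (block_unit_vec N n l \<nu> (fst q) (snd q)) b \<noteq> 0"
        using buv(2)[OF i\<nu>(2) qq b] that \<tau>1[OF b i\<nu>(2)] by simp
      show "branch_at (pt \<nu>) ?St (lam \<nu> (fst q)) (\<lambda>z. vec_index (V (fst q) (snd q) (tp + exp (- z))) b)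
          (g \<nu> (lam \<nu> (fst q)) * (exp (lam \<nu> (fst q) * aw \<nu>) * vec_index (block_unit_vec N n l \<nu> (fst q) (snd q)) b))"
        using V(2)[OF qq, of b] b d unfolding gsplit buv(1)[OF i\<nu>(2) qq b] by (simp add: mult.assoc)
    qed
    \<comment> \<open>The components b \<ge> N are recovered from the first N by applying P^{-1} to
      the upper rows of the system.\<close>
    have reg: "\<exists>L1. branch_at (pt \<nu>) ?St 0 (\<lambda>z. vec_index (U (tp + exp (- z))) b
        - (\<Sum>q\<in>K. CC q * vec_index (V (fst q) (snd q) (tp + exp (- z))) b)) L1" if b: "b < d" for b
    proof (cases "b < N")
      case False
      then have bj: "b - N < N0" "N + (b - N) = b" using b d by auto
      show ?thesis
        using companion_connection[OF E(2) comps(2)[OF U(1)] comps(2)[OF V(1)[OF Kq]] regN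
            comps(3)[OF U(1) bj(1)] comps(3)[OF V(1)[OF Kq] bj(1)]] unfolding bj(2) .
    qed (rule regN)
    have Cq: "C' \<nu> (fst q) (snd q) i k h = CC q" for q
    proof -
      have bl: "branch_powr (\<theta> E) (t E - tp) e = exp (e * (- pt E))" if "E \<in> {1..p}" for E e
        unfolding branch_powr_def
        by (subst branch_ln_eqI[OF ept[OF that]]) (use pi_gt_zero in \<open>auto simp: Impt\<close>)
      \<comment> \<open>With t_E - t_{p+1} = e^{-pt E} on the branch \<theta>_E, the stated power
        with exponent 2e - \<rho>1 - \<mu>_q splits into the quotient of the two normalisations and
        the factor e^{\<sigma>z} at \<open>pt E\<close>.\<close>
      have ex: "exp (of_real pi * \<i> * e) * exp ((2 * e - \<rho>1 - \<mu> q') * - pt E) = g E e * exp ((\<rho>1 + \<mu> q') * pt E)" for E e q'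
        by (simp add: g_def exp_add[symmetric] algebra_simps)
      show ?thesis
        unfolding C' tp_def[symmetric] bl[OF i\<nu>(1)] bl[OF i\<nu>(2)] ex CC_def \<rho>2 ..
    qed
    show ?thesis
    proof (rule connection_relation_pushforward[OF E(2) tpt[OF i\<nu>(2)] S])
      fix b assume b: "b < d"
      show "\<exists>L. branch_at (pt \<nu>) ?St 0 (\<lambda>z. vec_index (U (tp + exp (- z))) b
          - (\<Sum>k'=1..r \<nu>. \<Sum>h'=1..l \<nu> k'. C' \<nu> k' h' i k h * vec_index (V k' h' (tp + exp (- z))) b)) L"
        unfolding sumK Cq by (rule reg[OF b])
    qed
  qed
  \<comment> \<open>Half the smallest gap, so that the two sectors between neighbours overlap. The
    entry \<pi> keeps the set nonempty when there are no neighbours and bounds \<delta> by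
    \<pi>.\<close>
  define \<delta>0 where "\<delta>0 = Min (insert pi ((\<lambda>i. (\<theta> (i + 1) - \<theta> i) / 2) ` {1..<p}))"
  have gap: "\<theta> lo < \<theta> (lo + 1)" "\<theta> (lo + 1) - \<theta> lo < 2 * pi" if lo: "lo \<in> {1..<p}" for lo
  proof -
    show "\<theta> lo < \<theta> (lo + 1)" by (rule strict_mono_onD[OF args(2)]) (use lo in auto)
    have "\<theta> 1 \<le> \<theta> lo" "\<theta> (lo + 1) \<le> \<theta> p"
      using strict_mono_on_leD[OF args(2)] lo by auto
    then show "\<theta> (lo + 1) - \<theta> lo < 2 * pi" using args(3) by linarith
  qed
  have \<delta>0: "\<delta>0 > 0" unfolding \<delta>0_def using gap(1) by (subst Min_gr_iff) auto
  have \<delta>0_le: "\<delta>0 \<le> pi" "lo \<in> {1..<p} \<Longrightarrow> 2 * \<delta>0 \<le> \<theta> (lo + 1) - \<theta> lo" for lo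
  proof -
    show "\<delta>0 \<le> pi" unfolding \<delta>0_def by (rule Min_le) auto
    show "2 * \<delta>0 \<le> \<theta> (lo + 1) - \<theta> lo" if "lo \<in> {1..<p}"
    proof -
      have "\<delta>0 \<le> (\<theta> (lo + 1) - \<theta> lo) / 2" unfolding \<delta>0_def by (rule Min_le) (use that in auto)
      then show ?thesis by simp
    qed
  qed
  \<comment> \<open>Both directions between t_lo and its successor live on the same strip. As Im z
    is minus the argument of x - t_{p+1}, t_lo is on the upper edge and its successor on the lower
    one.\<close>
  have both: "(\<forall>k h U V. k \<in> {1..r lo} \<and> h \<in> {1..l lo k} \<and>
        local_solution d TT AP' (t lo) (lam lo k) (block_unit_vec d n l lo k h) (\<theta> lo) (sector_plus p t \<theta> \<delta> lo) S U \<and>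
        (\<forall>k'\<in>{1..r (lo + 1)}. \<forall>h'\<in>{1..l (lo + 1) k'}.
           local_solution d TT AP' (t (lo + 1)) (lam (lo + 1) k') (block_unit_vec d n l (lo + 1) k' h')
             (\<theta> (lo + 1)) (sector_minus p t \<theta> \<delta> (lo + 1)) S (V k' h')) \<longrightarrow>
        connection_relation d S (t (lo + 1)) (r (lo + 1)) (l (lo + 1)) (\<lambda>k' h'. C' (lo + 1) k' h' lo k h) U V) \<and>
     (\<forall>k h U V. k \<in> {1..r (lo + 1)} \<and> h \<in> {1..l (lo + 1) k} \<and>
        local_solution d TT AP' (t (lo + 1)) (lam (lo + 1) k) (block_unit_vec d n l (lo + 1) k h) (\<theta> (lo + 1)) (sector_minus p t \<theta> \<delta> (lo + 1)) S U \<and>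
        (\<forall>k'\<in>{1..r lo}. \<forall>h'\<in>{1..l lo k'}.
           local_solution d TT AP' (t lo) (lam lo k') (block_unit_vec d n l lo k' h')
             (\<theta> lo) (sector_plus p t \<theta> \<delta> lo) S (V k' h')) \<longrightarrow>
        connection_relation d S (t lo) (r lo) (l lo) (\<lambda>k' h'. C' lo k' h' (lo + 1) k h) U V)"
    if lo: "lo \<in> {1..<p}" and \<delta>: "0 < \<delta>" "\<delta> < \<delta>0" and S: "S = sector_plus p t \<theta> \<delta> lo \<union> sector_minus p t \<theta> \<delta> (lo + 1)" for lo \<delta> S
  proof -
    define x y where "x = - \<theta> (lo + 1)" and "y = - \<theta> lo"
    define M1 M2 where "M1 = min (\<theta> (lo + 1) - \<delta>) (\<theta> lo + pi)" and "M2 = max (\<theta> lo + \<delta>) (\<theta> (lo + 1) - pi)"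
    note gp = gap[OF lo]
    have small: "2 * \<delta> < \<theta> (lo + 1) - \<theta> lo" "\<delta> < pi" using \<delta> \<delta>0_le(2)[OF lo] \<delta>0_le(1) by linarith+
    have lop: "lo \<in> {1..p}" "lo + 1 \<in> {1..p}" "lo \<noteq> lo + 1" "lo + 1 \<noteq> lo" using lo by auto
    have Elo: "edge_point x y (pt lo)" and Ehi: "edge_point x y (pt (lo + 1))"
      using gp by (auto simp: edge_point_def x_def y_def Impt)
    have sp: "sector_plus p t \<theta> \<delta> lo = (\<lambda>z. tp + exp (- z)) ` strip (- M1) y"
      by (simp add: sector_plus_def sector_strip tp_def M1_def y_def)
    have sm: "sector_minus p t \<theta> \<delta> (lo + 1) = (\<lambda>z. tp + exp (- z)) ` strip x (- M2)"
      by (simp add: sector_minus_def sector_strip tp_def M2_def x_def)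
    have Sim: "S = (\<lambda>z. tp + exp (- z)) ` strip x y"
    proof -
      \<comment> \<open>M2 < M1 consists of four inequalities: one is 2\<delta> below the gap, two
        are \<delta> < \<pi>, and the last is that the gap is below 2\<pi>.\<close>
      have "strip (- M1) y \<union> strip x (- M2) = strip x y"
        by (rule strip_union) (use small gp \<delta> in \<open>auto simp: M1_def M2_def x_def y_def\<close>)
      then show ?thesis unfolding S sp sm image_Un[symmetric] by simp
    qed
    \<comment> \<open>A cut has argument -\<theta>_j modulo 2\<pi>. All \<theta>_j lie in a window
      shorter than 2\<pi>, which excludes a shift, and none lies strictly between two consecutive
      ones.\<close>
    have cut_sub: "\<eta>0 + exp z \<in> cut" if z: "z \<in> strip x y" for z
    proof (rule ccontr)
      assume "\<eta>0 + exp z \<notin> cut"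
      then obtain j s where js: "j \<in> {1..p}" "1 \<le> s" "\<eta>0 + exp z = \<eta>0 + (t' j - \<eta>0) * of_real s"
        by (auto simp: cut_def cut_plane_def)
      have "of_real s = exp (of_real (ln s) :: complex)" using js(2) by (simp add: exp_of_real)
      then have "exp z = exp (pt j + of_real (ln s))" using js(3) t'pt[OF js(1)] by (simp add: exp_add)
      then obtain kk :: int where "z = pt j + of_real (ln s) + (of_int (2 * kk) * pi) * \<i>" by (auto simp: exp_eq)
      then have "Im z = - \<theta> j + 2 * pi * of_int kk" by (simp add: Impt)
      moreover have zb: "\<theta> lo < - Im z" "- Im z < \<theta> (lo + 1)" using z by (auto simp: strip_def x_def y_def)
      ultimately have e: "- Im z - \<theta> j = - (2 * pi * of_int kk)" by simp
      have m: "\<theta> 1 \<le> \<theta> lo" "\<theta> (lo + 1) \<le> \<theta> p" "\<theta> 1 \<le> \<theta> j" "\<theta> j \<le> \<theta> p"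
        using strict_mono_on_leD[OF args(2)] lo js(1) by auto
      then have "\<bar>- Im z - \<theta> j\<bar> < 2 * pi" using zb args(3) by linarith
      then have "2 * pi * \<bar>of_int kk\<bar> < 2 * pi * 1" unfolding e by (simp add: abs_mult)
      then have "\<bar>of_int kk\<bar> < (1::real)" using mult_less_cancel_left_pos[of "2 * pi" "\<bar>of_int kk\<bar>" 1] by simp
      then have "kk = 0" by linarith
      then have "\<theta> j = - Im z" using e by simp
      then have "\<theta> lo < \<theta> j" "\<theta> j < \<theta> (lo + 1)" using zb by simp_all
      moreover have "j \<le> lo \<Longrightarrow> \<theta> j \<le> \<theta> lo" "lo + 1 \<le> j \<Longrightarrow> \<theta> (lo + 1) \<le> \<theta> j"
        using strict_mono_on_leD[OF args(2)] lo js(1) by auto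
      ultimately show False by linarith
    qed
    \<comment> \<open>The argument of \<zeta> - t'_E must lie in (-\<theta>_E - 2\<pi>,
      -\<theta>_E). At the upper edge z - \<open>pt E\<close> has argument in (-\<pi>, 0) and the
      logarithm \<open>pt E\<close> is right; at the lower edge the argument is in (0, \<pi>) and
      2\<pi>i must be subtracted.\<close>
    define aw where "aw = (\<lambda>E. if E = lo then pt E else pt E - 2 * of_real pi * \<i>)"
    have bw: "branch_at (pt E) (strip x y) e (\<lambda>z. vec_index (F (\<eta>0 + exp z)) b) (exp (e * aw E) * vec_index v b)"
      if "E \<in> {lo, lo + 1}" "local_solution N T' (0 \<cdot>\<^sub>m 1\<^sub>m N + A) (t' E) e v (\<theta>' E - pi) cut cut F" "b < N" for E e v F b
    proof -
      have Ep: "E \<in> {1..p}" using that(1) lop by auto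
      have edge: "edge_point x y (pt E)" using that(1) Elo Ehi by auto
      have "branch_at (pt E) (strip x y) e (\<lambda>z. vec_index (F (\<eta>0 + exp (1 * z))) b) (exp (e * aw E) * vec_index v b)"
      proof (rule local_solution_branch[OF that(2,3) edge])
        show "exp (aw E) = 1 * exp (1 * pt E)" by (simp add: aw_def exp_diff)
        show "t' E = \<eta>0 + exp (1 * pt E)" using t'pt[OF Ep] by simp
        show "(0::real) < 1" by simp
        show "\<eta>0 + exp (1 * z) \<in> cut" if "z \<in> strip x y" for z using cut_sub[OF that] by simp
        show "\<theta>' E - pi - pi \<le> Im (aw E) \<and> Im (aw E) \<le> \<theta>' E - pi" if "Im (pt E) = x"
        proof -
          have "E \<noteq> lo" using that gp by (auto simp: Impt x_def)
          then show ?thesis using underlying(2)[OF Ep] by (simp add: aw_def Impt)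
        qed
        show "\<theta>' E - pi \<le> Im (aw E) \<and> Im (aw E) \<le> \<theta>' E - pi + pi" if "Im (pt E) = y"
        proof -
          have "E = lo" using that gp \<open>E \<in> {lo, lo + 1}\<close> by (auto simp: Impt y_def)
          then show ?thesis using underlying(2)[OF Ep] by (simp add: aw_def Impt)
        qed
      qed simp
      then show ?thesis by simp
    qed
    have bUlo: "branch_at (pt lo) (strip x y) e (\<lambda>z. vec_index (F (tp + exp (- z))) b)
        (exp (e * (\<i> * of_real pi - 2 * pt lo + aw lo)) * vec_index v b)"
      if "local_solution d TT AP' (t lo) e v (\<theta> lo) (sector_plus p t \<theta> \<delta> lo) S F" "b < d" for e v F b
    proof -
      \<comment> \<open>The branch of U is prescribed on the plus sector only; this radius keeps the
        strip near \<open>pt lo\<close> above that sector.\<close>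
      define \<epsilon> where "\<epsilon> = min (\<theta> (lo + 1) - \<delta> - \<theta> lo) pi"
      have "branch_at (pt lo) (strip x y) e (\<lambda>z. vec_index (F (tp + exp (- 1 * z))) b) (exp (e * (\<i> * of_real pi - 2 * pt lo + aw lo)) * vec_index v b)"
      proof (rule local_solution_branch[OF that Elo])
        show "exp (\<i> * of_real pi - 2 * pt lo + aw lo) = - 1 * exp (- 1 * pt lo)"
          by (simp add: aw_def exp_add exp_diff exp_minus exp_double power2_eq_square field_simps)
        show "t lo = tp + exp (- 1 * pt lo)" using tpt[OF lop(1)] by simp
        show "\<theta> lo - pi \<le> Im (\<i> * of_real pi - 2 * pt lo + aw lo) \<and> Im (\<i> * of_real pi - 2 * pt lo + aw lo) \<le> \<theta> lo" if "Im (pt lo) = x"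
          using that gp by (simp add: Impt x_def)
        show "\<theta> lo \<le> Im (\<i> * of_real pi - 2 * pt lo + aw lo) \<and> Im (\<i> * of_real pi - 2 * pt lo + aw lo) \<le> \<theta> lo + pi" if "Im (pt lo) = y"
          by (simp add: aw_def Impt)
        show "\<epsilon> > 0" using small \<delta>(1) by (simp add: \<epsilon>_def)
        fix z assume z: "z \<in> strip x y" "z \<in> ball (pt lo) \<epsilon>"
        have "\<bar>Im (z - pt lo)\<bar> < \<epsilon>" using z(2) abs_Im_le_cmod[of "z - pt lo"] by (simp add: dist_norm norm_minus_commute)
        then have "z \<in> strip (- M1) y" using z(1) by (auto simp: strip_def Impt \<epsilon>_def M1_def)
        then show "tp + exp (- 1 * z) \<in> sector_plus p t \<theta> \<delta> lo" unfolding sp by auto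
      qed simp
      then show ?thesis by simp
    qed
    have bUhi: "branch_at (pt (lo + 1)) (strip x y) e (\<lambda>z. vec_index (F (tp + exp (- z))) b)
        (exp (e * (\<i> * of_real pi - 2 * pt (lo + 1) + aw (lo + 1))) * vec_index v b)"
      if "local_solution d TT AP' (t (lo + 1)) e v (\<theta> (lo + 1)) (sector_minus p t \<theta> \<delta> (lo + 1)) S F" "b < d" for e v F b
    proof -
      define hi where "hi = lo + 1"
      define \<epsilon> where "\<epsilon> = min (\<theta> hi - \<delta> - \<theta> lo) pi"
      \<comment> \<open>The imaginary part is \<theta>_hi - \<pi>. Adding an argument of z -
        \<open>pt hi\<close> in (0, \<pi>) gives the range (\<theta>_hi - \<pi>, \<theta>_hi)
        prescribed on the minus sector; so the shift \<pi>i - 2 \<open>pt E\<close> is the same as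
        at the other edge.\<close>
      have awhi: "\<i> * of_real pi - 2 * pt hi + aw hi = - pt hi - \<i> * of_real pi" by (simp add: aw_def hi_def algebra_simps)
      have "branch_at (pt hi) (strip x y) e (\<lambda>z. vec_index (F (tp + exp (- 1 * z))) b) (exp (e * (\<i> * of_real pi - 2 * pt hi + aw hi)) * vec_index v b)"
      proof (rule local_solution_branch[OF that[folded hi_def] Ehi[folded hi_def]])
        show "exp (\<i> * of_real pi - 2 * pt hi + aw hi) = - 1 * exp (- 1 * pt hi)"
          unfolding awhi by (simp add: exp_diff)
        show "t hi = tp + exp (- 1 * pt hi)" using tpt[OF lop(2)] by (simp add: hi_def)
        show "\<theta> hi - pi \<le> Im (\<i> * of_real pi - 2 * pt hi + aw hi) \<and> Im (\<i> * of_real pi - 2 * pt hi + aw hi) \<le> \<theta> hi" if "Im (pt hi) = x"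
          unfolding awhi by (simp add: Impt)
        show "\<theta> hi \<le> Im (\<i> * of_real pi - 2 * pt hi + aw hi) \<and> Im (\<i> * of_real pi - 2 * pt hi + aw hi) \<le> \<theta> hi + pi" if "Im (pt hi) = y"
          using that gp by (simp add: Impt y_def hi_def)
        show "\<epsilon> > 0" using small \<delta>(1) by (simp add: \<epsilon>_def hi_def)
        fix z assume z: "z \<in> strip x y" "z \<in> ball (pt hi) \<epsilon>"
        have "\<bar>Im (z - pt hi)\<bar> < \<epsilon>" using z(2) abs_Im_le_cmod[of "z - pt hi"] by (simp add: dist_norm norm_minus_commute)
        then have "z \<in> strip x (- M2)" using z(1) by (auto simp: strip_def Impt \<epsilon>_def M2_def hi_def)
        then show "tp + exp (- 1 * z) \<in> sector_minus p t \<theta> \<delta> hi" unfolding hi_def sm by auto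
      qed simp
      then show ?thesis by (simp add: hi_def)
    qed
    show ?thesis
    proof (intro conjI allI impI; elim conjE)
      fix k h U V
      assume kh: "k \<in> {1..r lo}" "h \<in> {1..l lo k}"
        and U: "local_solution d TT AP' (t lo) (lam lo k) (block_unit_vec d n l lo k h) (\<theta> lo) (sector_plus p t \<theta> \<delta> lo) S U"
        and V: "\<forall>k'\<in>{1..r (lo + 1)}. \<forall>h'\<in>{1..l (lo + 1) k'}.
           local_solution d TT AP' (t (lo + 1)) (lam (lo + 1) k') (block_unit_vec d n l (lo + 1) k' h')
             (\<theta> (lo + 1)) (sector_minus p t \<theta> \<delta> (lo + 1)) S (V k' h')"
      show "connection_relation d S (t (lo + 1)) (r (lo + 1)) (l (lo + 1)) (\<lambda>k' h'. C' (lo + 1) k' h' lo k h) U V"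
      proof (rule pair[OF lop(1,2,4) kh Elo Ehi Sim cut_sub bw _ bUlo[OF U]])
        show "solves_okubo d TT AP' S U" using U by (simp add: local_solution_def)
        fix k' h' assume "k' \<in> {1..r (lo + 1)}" "h' \<in> {1..l (lo + 1) k'}"
        then have V': "local_solution d TT AP' (t (lo + 1)) (lam (lo + 1) k') (block_unit_vec d n l (lo + 1) k' h')
             (\<theta> (lo + 1)) (sector_minus p t \<theta> \<delta> (lo + 1)) S (V k' h')" using V by blast
        then show "solves_okubo d TT AP' S (V k' h')" by (simp add: local_solution_def)
        show "branch_at (pt (lo + 1)) (strip x y) (lam (lo + 1) k') (\<lambda>z. vec_index (V k' h' (tp + exp (- z))) b)
          (exp (lam (lo + 1) k' * (\<i> * of_real pi - 2 * pt (lo + 1) + aw (lo + 1))) * vec_index (block_unit_vec d n l (lo + 1) k' h') b)"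
          if "b < d" for b by (rule bUhi[OF V' that])
      qed
    next
      fix k h U V
      assume kh: "k \<in> {1..r (lo + 1)}" "h \<in> {1..l (lo + 1) k}"
        and U: "local_solution d TT AP' (t (lo + 1)) (lam (lo + 1) k) (block_unit_vec d n l (lo + 1) k h) (\<theta> (lo + 1)) (sector_minus p t \<theta> \<delta> (lo + 1)) S U"
        and V: "\<forall>k'\<in>{1..r lo}. \<forall>h'\<in>{1..l lo k'}.
           local_solution d TT AP' (t lo) (lam lo k') (block_unit_vec d n l lo k' h')
             (\<theta> lo) (sector_plus p t \<theta> \<delta> lo) S (V k' h')"
      show "connection_relation d S (t lo) (r lo) (l lo) (\<lambda>k' h'. C' lo k' h' (lo + 1) k h) U V"
      proof (rule pair[OF lop(2,1,3) kh Ehi Elo Sim cut_sub bw _ bUhi[OF U]])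
        show "solves_okubo d TT AP' S U" using U by (simp add: local_solution_def)
        show "E \<in> {lo, lo + 1}" if "E \<in> {lo + 1, lo}" for E using that by auto
        fix k' h' assume "k' \<in> {1..r lo}" "h' \<in> {1..l lo k'}"
        then have V': "local_solution d TT AP' (t lo) (lam lo k') (block_unit_vec d n l lo k' h')
             (\<theta> lo) (sector_plus p t \<theta> \<delta> lo) S (V k' h')" using V by blast
        then show "solves_okubo d TT AP' S (V k' h')" by (simp add: local_solution_def)
        show "branch_at (pt lo) (strip x y) (lam lo k') (\<lambda>z. vec_index (V k' h' (tp + exp (- z))) b)
          (exp (lam lo k' * (\<i> * of_real pi - 2 * pt lo + aw lo)) * vec_index (block_unit_vec d n l lo k' h') b)"
          if "b < d" for b by (rule bUlo[OF V' that])
      qed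
    qed
  qed
  show ?thesis
  proof (rule eventually_at_rightI[OF _ \<delta>0], intro conjI allI impI; elim conjE)
    fix \<delta> i k h assume \<delta>: "\<delta> \<in> {0<..<\<delta>0}" and i: "1 \<le> i" "i \<le> p - 1" and kh: "k \<in> {1..r i}" "h \<in> {1..l i k}"
    have "i \<in> {1..<p}" using i by auto
    from both[OF this _ _ refl, of \<delta>] \<delta> kh
    show "let S = sector_plus p t \<theta> \<delta> i \<union> sector_minus p t \<theta> \<delta> (i + 1) in
          \<forall>U V. local_solution d TT AP' (t i) (lam i k) (block_unit_vec d n l i k h)
                  (\<theta> i) (sector_plus p t \<theta> \<delta> i) S U \<and>
                (\<forall>k'\<in>{1..r (i + 1)}. \<forall>h'\<in>{1..l (i + 1) k'}.
                  local_solution d TT AP' (t (i + 1)) (lam (i + 1) k') (block_unit_vec d n l (i + 1) k' h')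
                    (\<theta> (i + 1)) (sector_minus p t \<theta> \<delta> (i + 1)) S (V k' h')) \<longrightarrow>
             connection_relation d S (t (i + 1)) (r (i + 1)) (l (i + 1))
               (\<lambda>k' h'. C' (i + 1) k' h' i k h) U V"
      unfolding Let_def by auto
  next
    fix \<delta> i k h assume \<delta>: "\<delta> \<in> {0<..<\<delta>0}" and i: "2 \<le> i" "i \<le> p" and kh: "k \<in> {1..r i}" "h \<in> {1..l i k}"
    \<comment> \<open>The second direction starts at the upper index, so the pair is re-indexed by
      its lower member.\<close>
    define lo where "lo = i - 1"
    have lo: "lo \<in> {1..<p}" "i = lo + 1" using i by (auto simp: lo_def)
    from both[OF lo(1) _ _ refl, of \<delta>] \<delta> kh
    show "let S = sector_minus p t \<theta> \<delta> i \<union> sector_plus p t \<theta> \<delta> (i - 1) in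
          \<forall>U V. local_solution d TT AP' (t i) (lam i k) (block_unit_vec d n l i k h)
                  (\<theta> i) (sector_minus p t \<theta> \<delta> i) S U \<and>
                (\<forall>k'\<in>{1..r (i - 1)}. \<forall>h'\<in>{1..l (i - 1) k'}.
                  local_solution d TT AP' (t (i - 1)) (lam (i - 1) k') (block_unit_vec d n l (i - 1) k' h')
                    (\<theta> (i - 1)) (sector_plus p t \<theta> \<delta> (i - 1)) S (V k' h')) \<longrightarrow>
             connection_relation d S (t (i - 1)) (r (i - 1)) (l (i - 1))
               (\<lambda>k' h'. C' (i - 1) k' h' i k h) U V"
      unfolding Let_def lo_def[symmetric] lo(2) Un_commute[of "sector_minus p t \<theta> \<delta> (lo + 1)"] by auto
  qed
qed

end
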